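(* Let $P_1,P_2$ be fixed probability distributions on $[0,\infty)$ and, for each $n$, let $\tilde G_n=G_1(n,m,P_1,P_2)$ be the inhomogeneous random intersection graph with $m=m_n$. Let $m,n\to\infty$ and put $\beta_n=m/n$. Let $A_1$ and $B_1$ have distributions $P_1$ and $P_2$ respectively, and assume that $0<\mathbf{E} A_1^2<\infty$ and $0<\mathbf{E} B_1^3<\infty$. Suppose that $\beta_n\to\beta\in(0,+\infty)$. Denote $a_k=\mathbf{E} A_1^k$, $b_k=\mathbf{E} B_1^k$, $\kappa=a_1a_2^{-1}b_2^{-2}$ and $b_k^*=\mathbf{E}\, B_1^k e^{-a_1B_1/\sqrt{\beta}}$. Then, as $n\to\infty$, the clustering coefficient $\alpha$ of $\tilde G_n$ satisfies $$ \alpha=\frac{b_3\kappa}{b_3\kappa+\sqrt{\beta}}+o(1), $$ and the clustering function $cl(\cdot)$ of $\tilde G_n$ satisfies $$ cl(r)= \begin{cases} a_1^2b_2^*n^{-1}(1+o(1)), & r=0;\\[2pt] \dfrac{b_3^*\kappa}{b_3^*\kappa+\sqrt{\beta}}(1+o(1)), & r=1;\\[6pt] 1-o(1), & \text{for each fixed integer } r\ge 2. \end{cases} $$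
   Context: Inhomogeneous random intersection graph $G_1(n,m,P_1,P_2)$: the vertex set is $V=\{v_1,\dots,v_n\}$ and the set of attributes is $W=\{w_1,\dots,w_m\}$. First generate independent nonnegative random variables $A_1,\dots,A_n,B_1,\dots,B_m$, each $A_i$ with distribution $P_1$ and each $B_j$ with distribution $P_2$. Then, conditionally on the realized values $\{A_i,B_j\}$, include the attribute $w_j$ in the set $D_i\subset W$ with probability $p_{ij}=\min\{1,A_iB_j(nm)^{-1/2}\}$, independently for each $i$ and $j$. Distinct vertices $v_i,v_j$ are adjacent, written $v_i\sim v_j$, iff $D_i\cap D_j\neq\emptyset$. Notation: $d(v_1,v_2)$ is the number of common neighbours of $v_1$ and $v_2$. The clustering function is $cl(r)=\mathbf{P}(v_1\sim v_2\mid d(v_1,v_2)=r)$, $r=0,1,2,\dots$, and the clustering coefficient is $\alpha=\mathbf{P}(v_1\sim v_2\mid v_1\sim v_3,\ v_2\sim v_3)$; probabilities include the randomness of the $A_i$, $B_j$, and both quantities depend on $n$. *)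

theory Defs
  imports "HOL-Probability.Probability" "HOL-Library.Landau_Symbols"
begin

text \<open>
  The vertices $v_1, \dots, v_n$ and the attributes $w_1, \dots, w_m$ are represented by their
  indices, that is, by the elements of \<open>{1..n}\<close> and of \<open>{1..m}\<close>.
\<close>

definition attr_prob :: "nat \<Rightarrow> nat \<Rightarrow> (nat \<Rightarrow> real) \<Rightarrow> (nat \<Rightarrow> real) \<Rightarrow> nat \<times> nat \<Rightarrow> real" where
  "attr_prob n m A B = (\<lambda>(i, j). min 1 (A i * B j / sqrt (real n * real m)))"

text \<open>
  An outcome \<open>X\<close> is the incidence relation between vertices and attributes: \<open>X (i, j)\<close> means that
  $w_j \in D_i$. It is \<open>False\<close> outside \<open>{1..n} \<times> {1..m}\<close>.
\<close>

definition attr_law ::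
  "nat \<Rightarrow> nat \<Rightarrow> (nat \<Rightarrow> real) \<Rightarrow> (nat \<Rightarrow> real) \<Rightarrow> (nat \<times> nat \<Rightarrow> bool) pmf" where
  "attr_law n m A B =
     Pi_pmf ({1..n} \<times> {1..m}) False (\<lambda>ij. bernoulli_pmf (attr_prob n m A B ij))"

definition rig ::
  "nat \<Rightarrow> nat \<Rightarrow> real measure \<Rightarrow> real measure \<Rightarrow> (nat \<times> nat \<Rightarrow> bool) measure" where
  "rig n m P1 P2 =
     (PiM {1..n} (\<lambda>_. P1) \<Otimes>\<^sub>M PiM {1..m} (\<lambda>_. P2)) \<bind>
       (\<lambda>(A, B). measure_pmf (attr_law n m A B))"

definition attrs :: "(nat \<times> nat \<Rightarrow> bool) \<Rightarrow> nat \<Rightarrow> nat set" where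
  "attrs X i = {j. X (i, j)}"

definition adj :: "(nat \<times> nat \<Rightarrow> bool) \<Rightarrow> nat \<Rightarrow> nat \<Rightarrow> bool" where
  "adj X i j \<longleftrightarrow> i \<noteq> j \<and> attrs X i \<inter> attrs X j \<noteq> {}"

definition common_nbrs :: "nat \<Rightarrow> (nat \<times> nat \<Rightarrow> bool) \<Rightarrow> nat \<Rightarrow> nat \<Rightarrow> nat" where
  "common_nbrs n X i j = card {k \<in> {1..n}. adj X i k \<and> adj X j k}"

definition clustering_coeff :: "nat \<Rightarrow> nat \<Rightarrow> real measure \<Rightarrow> real measure \<Rightarrow> real" where
  "clustering_coeff n m P1 P2 =
     \<P>(X in rig n m P1 P2. adj X 1 2 \<bar> adj X 1 3 \<and> adj X 2 3)"

definition clustering_fun :: "nat \<Rightarrow> nat \<Rightarrow> real measure \<Rightarrow> real measure \<Rightarrow> nat \<Rightarrow> real" where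
  "clustering_fun n m P1 P2 r =
     \<P>(X in rig n m P1 P2. adj X 1 2 \<bar> common_nbrs n X 1 2 = r)"

text \<open>
  The kernel in \<^const>\<open>rig\<close> is measurable, so that the monadic bind is not degenerate and
  \<^const>\<open>rig\<close> is the mixture of the conditional laws.
\<close>

lemma measurable_attr_law:
  assumes P1: "sets P1 = sets borel" and P2: "sets P2 = sets borel"
  shows "(\<lambda>(A, B). measure_pmf (attr_law n m A B)) \<in>
           PiM {1..n} (\<lambda>_. P1) \<Otimes>\<^sub>M PiM {1..m} (\<lambda>_. P2) \<rightarrow>\<^sub>M prob_algebra (count_space UNIV)"
    (is "?K \<in> ?M \<rightarrow>\<^sub>M _")
proof (intro measurable_prob_algebraI measurable_subprob_algebra)
  fix S :: "(nat \<times> nat \<Rightarrow> bool) set"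
  let ?I = "{1..n} \<times> {1..m}"
  let ?F = "PiE_dflt ?I False (\<lambda>_. UNIV)"
  have [measurable_cong]: "sets P1 = sets borel" "sets P2 = sets borel"
    by (fact assms)+
  have fin: "finite ?F"
    by (intro finite_PiE_dflt) auto
  have p [measurable]: "(\<lambda>(A, B). attr_prob n m A B ij) \<in> borel_measurable ?M"
    if "ij \<in> ?I" for ij
  proof (cases ij)
    case (Pair i j)
    with that have [measurable]: "i \<in> {1..n}" "j \<in> {1..m}" by auto
    have "(\<lambda>x. min 1 (fst x i * snd x j / sqrt (real n * real m))) \<in> borel_measurable ?M"
      by measurable
    then show ?thesis
      by (simp add: Pair attr_prob_def case_prod_beta)
  qed
  have "(\<lambda>x. pmf (bernoulli_pmf (case x of (A, B) \<Rightarrow> attr_prob n m A B ij)) b)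
          \<in> borel_measurable ?M" if "ij \<in> ?I" for ij b
    using p[OF that] by (cases b) (simp_all add: bernoulli_pmf.rep_eq)
  then have pmf: "(\<lambda>x. \<Prod>ij\<in>?I. pmf (bernoulli_pmf (case x of (A, B) \<Rightarrow> attr_prob n m A B ij)) (f ij))
          \<in> borel_measurable ?M" for f
    by (intro borel_measurable_prod) auto
  have K: "emeasure (?K x) S = ennreal (\<Sum>f\<in>?F \<inter> S.
          \<Prod>ij\<in>?I. pmf (bernoulli_pmf (case x of (A, B) \<Rightarrow> attr_prob n m A B ij)) (f ij))" for x
  proof (cases x)
    case (Pair A B)
    have sub: "set_pmf (attr_law n m A B) \<subseteq> ?F"
      unfolding attr_law_def by (auto simp: set_Pi_pmf PiE_dflt_def)
    have "emeasure (measure_pmf (attr_law n m A B)) S =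
            emeasure (measure_pmf (attr_law n m A B)) (?F \<inter> S)"
      using sub by (intro emeasure_eq_AE) (auto simp: AE_measure_pmf_iff)
    also have "\<dots> = ennreal (\<Sum>f\<in>?F \<inter> S. pmf (attr_law n m A B) f)"
      using fin by (simp add: measure_pmf.emeasure_eq_measure measure_measure_pmf_finite)
    also have "(\<Sum>f\<in>?F \<inter> S. pmf (attr_law n m A B) f) =
        (\<Sum>f\<in>?F \<inter> S. \<Prod>ij\<in>?I. pmf (bernoulli_pmf (attr_prob n m A B ij)) (f ij))"
      unfolding attr_law_def
      by (intro sum.cong refl pmf_Pi') (auto simp del: mem_Sigma_iff simp: PiE_dflt_def)
    finally show ?thesis
      using Pair by simp
  qed
  show "(\<lambda>x. emeasure (?K x) S) \<in> borel_measurable ?M"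
    unfolding K by (intro measurable_compose[OF _ measurable_ennreal] borel_measurable_sum pmf)
qed (auto simp: measure_pmf.prob_space_axioms measure_pmf.subprob_space_axioms split: prod.splits)

lemma prob_space_rig:
  assumes "real_distribution P1" "real_distribution P2"
  shows "prob_space (rig n m P1 P2)"
proof -
  interpret P1: real_distribution P1 by fact
  interpret P2: real_distribution P2 by fact
  interpret A: prob_space "PiM {1..n} (\<lambda>_. P1)"
    by (intro prob_space_PiM P1.prob_space_axioms)
  interpret B: prob_space "PiM {1..m} (\<lambda>_. P2)"
    by (intro prob_space_PiM P2.prob_space_axioms)
  interpret AB: pair_prob_space "PiM {1..n} (\<lambda>_. P1)" "PiM {1..m} (\<lambda>_. P2)" ..
  have "PiM {1..n} (\<lambda>_. P1) \<Otimes>\<^sub>M PiM {1..m} (\<lambda>_. P2)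
          \<in> space (prob_algebra (PiM {1..n} (\<lambda>_. P1) \<Otimes>\<^sub>M PiM {1..m} (\<lambda>_. P2)))"
    using AB.prob_space_axioms by (simp add: space_prob_algebra)
  from prob_space_bind'[OF this measurable_attr_law] show ?thesis
    unfolding rig_def by simp
qed

end

theory Submission
  imports Defs
begin

text \<open>
  Put $s = \sqrt{nm}$, so that $n/s \to \beta^{-1/2}$ and $m/s \to \beta^{1/2}$. The probability that
  a prescribed set of \<open>t\<close> vertex--attribute incidences is present is at most a constant times
  $s^{-t}$, provided that no vertex occurs in more than two and no attribute in more than three of
  them. A union bound over the positions of the pattern then leaves few configurations that matter.

  \<^item> A triangle $v_1, v_2, v_3$ comes from one attribute shared by all three vertices, and
    $v_1 \sim v_2$ comes from one attribute $w$ whose other members are exactly the common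
    neighbours. With $f(b) = \mathbf{E} \min(1, A b / s)$, the latter gives
    $n \mathbf{P}(v_1 \sim v_2, d(v_1, v_2) = r) \approx
    n m \binom{n-2}{r} \mathbf{E} f(B)^{r+2} (1 - f(B))^{n-2-r}$, and dominated convergence turns
    this into $a_1^2 \, \mathbf{E} B^2 \mathrm{Po}_\lambda(r)$ with $\lambda = a_1 B \beta^{-1/2}$.
  \<^item> If $v_1 \not\sim v_2$, then $d(v_1, v_2) \ge 2$ has probability $O(n^{-2})$, and
    $d(v_1, v_2) = 1$ has the probability of a single open path $v_1 \sim v_k \sim v_2$ summed over
    \<open>k\<close>. The path probability is found by conditioning on $A_k = z$: for fixed \<open>z\<close> Bonferroni's
    inequality is sharp, and the union bound dominates by a multiple of $z + z^2$.
\<close>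

section \<open>The law of the incidence relation\<close>

text \<open>The development is shaped by \<open>P1\<close> having two moments and \<open>P2\<close>
  three. A pattern that uses a vertex three times cannot be paid for under \<open>P1\<close>, and
  the second Bonferroni terms for a path v_1 ~ v_k ~ v_2 contain such patterns, with a third
  attribute at v_k. Fixing A_k = z removes this obstacle, but the error becomes a polynomial of high
  degree in |z|, which need not be integrable. It is therefore used only pointwise in z: the upper
  bound carries no error at all, and the lower bound is cut off at 0, so that both stay below the
  union bound.

  Errors are settled by counting. A pattern with t incidences and p + q free vertices and
  attributes, a scaling by n or n^2 included, contributes n^p m^q s^(-t), which vanishes if p + q <
  t.

  The parameter \<kappa> arises by cancellation. A path uses one attribute, and then closes to a
  triangle, or two different ones; scaled by n^2 the limits are a_1^3 b_3 / sqrt \<beta> and a_1^2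
  a_2 b_2^2. Their quotient is that of b_3 \<kappa> and sqrt \<beta>.\<close>

declare One_nat_def [simp del]

text \<open>The lower clamp at 0 mirrors how \<open>bernoulli_pmf\<close> treats a parameter outside
  [0, 1]. With it the pattern formulas hold for all real weights, and the sign of the weights enters
  only with moments and limits.\<close>

definition edge_prob :: "real \<Rightarrow> real \<Rightarrow> real \<Rightarrow> real" where
  "edge_prob s a b = min 1 (max 0 (a * b / s))"

lemma edge_prob_nonneg [simp]: "0 \<le> edge_prob s a b"
  and edge_prob_le_1 [simp]: "edge_prob s a b \<le> 1"
  by (auto simp: edge_prob_def)

lemma edge_prob_le: "0 \<le> s \<Longrightarrow> edge_prob s a b \<le> \<bar>a\<bar> * \<bar>b\<bar> / s"
  by (auto simp: edge_prob_def min_le_iff_disj abs_mult[symmetric] divide_right_mono)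

lemma borel_measurable_edge_prob [measurable (raw)]:
  assumes "f \<in> borel_measurable M" "g \<in> borel_measurable M"
  shows "(\<lambda>x. edge_prob s (f x) (g x)) \<in> borel_measurable M"
  using assms unfolding edge_prob_def by measurable

lemma min_max_clamp: "max 0 (min 1 x) = min 1 (max 0 x)" for x :: real
  by (auto simp: min_def max_def)

lemma measure_bernoulli_pmf_True:
  "measure_pmf.prob (bernoulli_pmf p) {True} = min 1 (max 0 p)"
  "measure_pmf.prob (bernoulli_pmf p) {False} = 1 - min 1 (max 0 p)"
  by (simp_all add: measure_pmf_single bernoulli_pmf.rep_eq)

definition pattern_prob ::
  "(nat \<times> nat) set \<Rightarrow> (nat \<times> nat) set \<Rightarrow> real \<Rightarrow> nat \<Rightarrow> nat \<Rightarrow> real \<Rightarrow> real \<Rightarrow> real" where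
  "pattern_prob S T s i j a b =
     (if (i, j) \<in> S then edge_prob s a b else if (i, j) \<in> T then 1 - edge_prob s a b else 1)"

lemma pattern_prob_nonneg [simp]: "0 \<le> pattern_prob S T s i j a b"
  by (simp add: pattern_prob_def)

lemma borel_measurable_pattern_prob [measurable (raw)]:
  assumes "f \<in> borel_measurable M" "g \<in> borel_measurable M"
  shows "(\<lambda>x. pattern_prob S T s i j (f x) (g x)) \<in> borel_measurable M"
  using assms unfolding pattern_prob_def by measurable

text \<open>Given the weights, the incidences are independent, and the pattern is a product event:
  {True} on \<open>S\<close>, {False} on \<open>T\<close>, no restriction and hence a factor 1
  elsewhere. The product is arranged by rows so that the vertex weights can be integrated out one at
  a time.\<close>

lemma prob_attr_law_pattern:
  assumes "S \<subseteq> {1..n} \<times> {1..m}" "T \<subseteq> {1..n} \<times> {1..m}" "S \<inter> T = {}"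
  shows "measure_pmf.prob (attr_law n m A B) {X. (\<forall>ij\<in>S. X ij) \<and> (\<forall>ij\<in>T. \<not> X ij)} =
    (\<Prod>i\<in>{1..n}. \<Prod>j\<in>{1..m}. pattern_prob S T (sqrt (real n * real m)) i j (A i) (B j))"
proof -
  let ?I = "{1..n} \<times> {1..m}"
  let ?F = "\<lambda>ij. if ij \<in> S then {True} else if ij \<in> T then {False} else UNIV"
  have "{X. (\<forall>ij\<in>S. X ij) \<and> (\<forall>ij\<in>T. \<not> X ij)} = Pi ?I ?F"
  proof (intro set_eqI iffI)
    fix X assume "X \<in> Pi ?I ?F"
    then have X: "X ij \<in> ?F ij" if "ij \<in> S \<union> T" for ij
      using assms that by blast
    show "X \<in> {X. (\<forall>ij\<in>S. X ij) \<and> (\<forall>ij\<in>T. \<not> X ij)}"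
    proof (intro CollectI conjI ballI)
      show "X ij" if "ij \<in> S" for ij using X[of ij] that by simp
      show "\<not> X ij" if "ij \<in> T" for ij
      proof -
        have "ij \<notin> S" using assms(3) that by blast
        then show ?thesis using X[of ij] that by simp
      qed
    qed
  qed (auto simp: Pi_def)
  then have "measure_pmf.prob (attr_law n m A B) {X. (\<forall>ij\<in>S. X ij) \<and> (\<forall>ij\<in>T. \<not> X ij)} =
     (\<Prod>ij\<in>?I. measure_pmf.prob (bernoulli_pmf (attr_prob n m A B ij)) (?F ij))"
    unfolding attr_law_def by (simp add: measure_Pi_pmf_Pi)
  also have "\<dots> = (\<Prod>(i, j)\<in>?I. pattern_prob S T (sqrt (real n * real m)) i j (A i) (B j))"
    by (intro prod.cong refl)
       (simp add: pattern_prob_def attr_prob_def edge_prob_def measure_bernoulli_pmf_True min_max_clamp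
         split: prod.splits)
  finally show ?thesis
    by (simp add: prod.cartesian_product)
qed

text \<open>
  The weight distribution may depend on the vertex, so that conditioning on the weight of a vertex
  stays within the model: its distribution becomes a point mass.
\<close>

locale weighted_rig =
  fixes n m :: nat and Q :: "nat \<Rightarrow> real measure" and P :: "real measure"
  assumes row_distribution: "\<And>i. real_distribution (Q i)"
    and column_distribution: "real_distribution P"
begin

definition "s = sqrt (real n * real m)"

definition law :: "(nat \<times> nat \<Rightarrow> bool) measure" where
  "law = (PiM {1..n} Q \<Otimes>\<^sub>M PiM {1..m} (\<lambda>_. P)) \<bind>
     (\<lambda>(A, B). measure_pmf (attr_law n m A B))"

lemma sets_Q [simp, measurable_cong]: "sets (Q i) = sets borel"
  and sets_P [simp, measurable_cong]: "sets P = sets borel"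
  and space_Q [simp]: "space (Q i) = UNIV"
  and space_P [simp]: "space P = UNIV"
  using row_distribution[of i] column_distribution real_distribution.space_eq_univ
  by (auto simp: real_distribution_def real_distribution_axioms_def)

sublocale Q: product_prob_space Q
  by (intro product_prob_spaceI real_distribution.axioms(1)[OF row_distribution])

sublocale P: product_prob_space "\<lambda>_::nat. P"
  by (intro product_prob_spaceI real_distribution.axioms(1)[OF column_distribution])

lemma s_nonneg [simp]: "0 \<le> s"
  by (simp add: s_def)

lemma prob_space_Q: "prob_space (Q i)" and prob_space_P: "prob_space P"
  using row_distribution column_distribution by (auto simp: real_distribution_def)

lemma prob_space_weights: "prob_space (PiM {1..n} Q \<Otimes>\<^sub>M PiM {1..m} (\<lambda>_. P))"
proof -
  interpret A: prob_space "PiM {1..n} Q" by (intro prob_space_PiM prob_space_Q)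
  interpret B: prob_space "PiM {1..m} (\<lambda>_. P)" by (intro prob_space_PiM prob_space_P)
  interpret AB: pair_prob_space "PiM {1..n} Q" "PiM {1..m} (\<lambda>_. P)" ..
  show ?thesis by (rule AB.prob_space_axioms)
qed

lemma measurable_attr_law_weights:
  "(\<lambda>(A, B). measure_pmf (attr_law n m A B)) \<in>
     PiM {1..n} Q \<Otimes>\<^sub>M PiM {1..m} (\<lambda>_. P) \<rightarrow>\<^sub>M prob_algebra (count_space UNIV)"
proof -
  have "sets (PiM {1..n} Q \<Otimes>\<^sub>M PiM {1..m} (\<lambda>_. P)) =
      sets (PiM {1..n} (\<lambda>_. P) \<Otimes>\<^sub>M PiM {1..m} (\<lambda>_. P))"
    by (intro sets_pair_measure_cong sets_PiM_cong) auto
  with measurable_attr_law[of P P n m] show ?thesis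
    by (simp cong: measurable_cong_sets)
qed

lemma weights_in_prob_algebra:
  "PiM {1..n} Q \<Otimes>\<^sub>M PiM {1..m} (\<lambda>_. P)
     \<in> space (prob_algebra (PiM {1..n} Q \<Otimes>\<^sub>M PiM {1..m} (\<lambda>_. P)))"
  using prob_space_weights by (simp add: space_prob_algebra)

sublocale prob_space law
  using prob_space_bind'[OF weights_in_prob_algebra measurable_attr_law_weights]
  by (simp add: law_def)

lemma sets_law [simp]: "sets law = UNIV"
proof -
  have "sets law = sets (count_space UNIV)"
    unfolding law_def
    using weights_in_prob_algebra measurable_attr_law_weights by (rule sets_bind')
  then show ?thesis by simp
qed

lemma space_law [simp]: "space law = UNIV"
  using sets_eq_imp_space_eq[of law "count_space UNIV"] by simp

text \<open>The vertex weights are integrated first: with \<open>B\<close> held fixed, different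
  rows involve independent weights, and a product over vertices can be integrated factor by
  factor.\<close>

lemma emeasure_law:
  "emeasure law E = (\<integral>\<^sup>+B. \<integral>\<^sup>+A. emeasure (measure_pmf (attr_law n m A B)) E
     \<partial>PiM {1..n} Q \<partial>PiM {1..m} (\<lambda>_. P))"
proof -
  interpret A: prob_space "PiM {1..n} Q" by (intro prob_space_PiM prob_space_Q)
  interpret B: prob_space "PiM {1..m} (\<lambda>_. P)" by (intro prob_space_PiM prob_space_P)
  interpret AB: pair_sigma_finite "PiM {1..n} Q" "PiM {1..m} (\<lambda>_. P)" ..
  have "(\<lambda>(A, B). emeasure (measure_pmf (attr_law n m A B)) E)
      \<in> borel_measurable (PiM {1..n} Q \<Otimes>\<^sub>M PiM {1..m} (\<lambda>_. P))"
    using measurable_compose[OF measurable_prob_algebraD[OF measurable_attr_law_weights]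
        measurable_emeasure_subprob_algebra[of E]]
    by (simp add: case_prod_beta)
  note Fubini = AB.nn_integral_snd[OF this]
  have "emeasure law E = (\<integral>\<^sup>+x. (case x of (A, B) \<Rightarrow> emeasure (measure_pmf (attr_law n m A B)) E)
      \<partial>(PiM {1..n} Q \<Otimes>\<^sub>M PiM {1..m} (\<lambda>_. P)))"
    unfolding law_def
    by (subst emeasure_bind_prob_algebra[OF weights_in_prob_algebra measurable_attr_law_weights])
       (auto intro!: nn_integral_cong)
  with Fubini show ?thesis by simp
qed

lemma emeasure_law_pattern:
  assumes "S \<subseteq> {1..n} \<times> {1..m}" "T \<subseteq> {1..n} \<times> {1..m}" "S \<inter> T = {}"
  shows "emeasure law {X. (\<forall>ij\<in>S. X ij) \<and> (\<forall>ij\<in>T. \<not> X ij)} =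
    (\<integral>\<^sup>+B. (\<Prod>i\<in>{1..n}. \<integral>\<^sup>+a. ennreal (\<Prod>j\<in>{1..m}. pattern_prob S T s i j a (B j)) \<partial>Q i)
       \<partial>PiM {1..m} (\<lambda>_. P))"
  unfolding emeasure_law measure_pmf.emeasure_eq_measure prob_attr_law_pattern[OF assms]
proof (intro nn_integral_cong)
  fix B :: "nat \<Rightarrow> real"
  have "(\<integral>\<^sup>+A. ennreal (\<Prod>i\<in>{1..n}. \<Prod>j\<in>{1..m}.
          pattern_prob S T (sqrt (real n * real m)) i j (A i) (B j)) \<partial>PiM {1..n} Q) =
      (\<integral>\<^sup>+A. (\<Prod>i\<in>{1..n}. ennreal (\<Prod>j\<in>{1..m}. pattern_prob S T s i j (A i) (B j))) \<partial>PiM {1..n} Q)"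
    unfolding s_def by (intro nn_integral_cong prod_ennreal[symmetric] prod_nonneg) simp
  also have "\<dots> = (\<Prod>i\<in>{1..n}. \<integral>\<^sup>+a. ennreal (\<Prod>j\<in>{1..m}. pattern_prob S T s i j a (B j)) \<partial>Q i)"
    by (rule Q.product_nn_integral_prod) simp_all
  finally show "(\<integral>\<^sup>+A. ennreal (\<Prod>i\<in>{1..n}. \<Prod>j\<in>{1..m}.
          pattern_prob S T (sqrt (real n * real m)) i j (A i) (B j)) \<partial>PiM {1..n} Q) =
      (\<Prod>i\<in>{1..n}. \<integral>\<^sup>+a. ennreal (\<Prod>j\<in>{1..m}. pattern_prob S T s i j a (B j)) \<partial>Q i)" .
qed

text \<open>A pattern within column \<open>w\<close> involves no attribute weight but
  \<open>B w\<close>, so the outer integral collapses to the marginal of that coordinate.\<close>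

lemma emeasure_law_column:
  assumes "w \<in> {1..m}" "S \<subseteq> {1..n}" "T \<subseteq> {1..n}" "S \<inter> T = {}"
  shows "emeasure law {X. (\<forall>i\<in>S. X (i, w)) \<and> (\<forall>i\<in>T. \<not> X (i, w))} =
    (\<integral>\<^sup>+b. (\<Prod>i\<in>{1..n}. \<integral>\<^sup>+a. ennreal (pattern_prob (S \<times> {w}) (T \<times> {w}) s i w a b) \<partial>Q i) \<partial>P)"
proof -
  let ?F = "\<lambda>b. \<Prod>i\<in>{1..n}. \<integral>\<^sup>+a. ennreal (pattern_prob (S \<times> {w}) (T \<times> {w}) s i w a b) \<partial>Q i"
  have *: "(\<Prod>j\<in>{1..m}. pattern_prob (S \<times> {w}) (T \<times> {w}) s i j a (B j)) =
      pattern_prob (S \<times> {w}) (T \<times> {w}) s i w a (B w)" for i a B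
    using assms(1)
    by (subst prod.remove[of _ w]) (auto simp: pattern_prob_def intro!: prod.neutral)
  have F: "?F \<in> borel_measurable P"
    by measurable
  have subs: "S \<times> {w} \<subseteq> {1..n} \<times> {1..m}" "T \<times> {w} \<subseteq> {1..n} \<times> {1..m}" "S \<times> {w} \<inter> T \<times> {w} = {}"
    using assms by auto
  have "emeasure law {X. (\<forall>i\<in>S. X (i, w)) \<and> (\<forall>i\<in>T. \<not> X (i, w))} =
      emeasure law {X. (\<forall>ij\<in>S \<times> {w}. X ij) \<and> (\<forall>ij\<in>T \<times> {w}. \<not> X ij)}"
    by (intro arg_cong[of _ _ "emeasure law"]) auto
  also have "\<dots> = (\<integral>\<^sup>+B. ?F (B w) \<partial>PiM {1..m} (\<lambda>_. P))"
    unfolding emeasure_law_pattern[OF subs] * ..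
  also have "\<dots> = (\<integral>\<^sup>+b. ?F b \<partial>distr (PiM {1..m} (\<lambda>_. P)) P (\<lambda>B. B w))"
    using assms(1) F by (intro nn_integral_distr[symmetric] measurable_component_singleton) auto
  also have "distr (PiM {1..m} (\<lambda>_. P)) P (\<lambda>B. B w) = P"
    by (rule distr_PiM_component[of "{1..m}" "\<lambda>_. P", OF prob_space_P assms(1)])
  finally show ?thesis .
qed

text \<open>\<open>adj\<close> searches all natural numbers for a shared attribute. The product law
  is \<open>False\<close> outside the index rectangle, so a witness is almost surely a genuine
  attribute.\<close>

lemma AE_law_in_range: "AE X in law. \<forall>i j. X (i, j) \<longrightarrow> i \<in> {1..n} \<and> j \<in> {1..m}"
proof (rule AE_I)
  let ?N = "{X :: nat \<times> nat \<Rightarrow> bool. \<not> (\<forall>i j. X (i, j) \<longrightarrow> i \<in> {1..n} \<and> j \<in> {1..m})}"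
  have "set_pmf (attr_law n m A B) \<inter> ?N = {}" for A B
    using set_Pi_pmf_subset[of "{1..n} \<times> {1..m}" False "\<lambda>ij. bernoulli_pmf (attr_prob n m A B ij)"]
    unfolding attr_law_def by fastforce
  then have "emeasure (measure_pmf (attr_law n m A B)) ?N = 0" for A B
    unfolding measure_pmf.emeasure_eq_measure by (subst measure_pmf_zero_iff[THEN iffD2]) auto
  then show "emeasure law ?N = 0"
    unfolding emeasure_law by simp
qed auto

text \<open>Each incidence probability is at most |a| |b| / s, which separates vertex from attribute
  weights. Rows and columns each contribute one factor C per incidence, and both counts add up to
  \<open>card S\<close>. A moment is demanded only in the order in which the weight occurs.\<close>

lemma prob_all_le:
  fixes C :: real
  assumes S: "S \<subseteq> {1..n} \<times> {1..m}"
    and C: "0 \<le> C"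
    and row: "\<And>i. (\<integral>\<^sup>+a. ennreal (\<bar>a\<bar> ^ card {j. (i, j) \<in> S}) \<partial>Q i) \<le> ennreal (C ^ card {j. (i, j) \<in> S})"
    and col: "\<And>j. (\<integral>\<^sup>+b. ennreal (\<bar>b\<bar> ^ card {i. (i, j) \<in> S}) \<partial>P) \<le> ennreal (C ^ card {i. (i, j) \<in> S})"
  shows "prob {X. \<forall>ij\<in>S. X ij} \<le> (C\<^sup>2 / s) ^ card S"
proof -
  let ?r = "\<lambda>i. card {j. (i, j) \<in> S}" and ?c = "\<lambda>j. card {i. (i, j) \<in> S}"
  let ?k = "\<lambda>B i. (\<Prod>j\<in>{1..m}. if (i, j) \<in> S then \<bar>B j\<bar> / s else 1)"
  have finS: "finite S"
    using S by (rule finite_subset) auto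
  have fin: "finite {j. (i, j) \<in> S}" "finite {i. (i, j) \<in> S}" for i j
    using finite_subset[of "{j. (i, j) \<in> S}" "{1..m}"] finite_subset[of "{i. (i, j) \<in> S}" "{1..n}"] S
    by auto
  have k: "0 \<le> ?k B i" for B i
    by (intro prod_nonneg) auto
  have card_r: "(\<Sum>i\<in>{1..n}. ?r i) = card S"
  proof -
    have "S = Sigma {1..n} (\<lambda>i. {j. (i, j) \<in> S})" using S by auto
    then show ?thesis using fin by (metis card_SigmaI finite_atLeastAtMost)
  qed
  have card_c: "(\<Sum>j\<in>{1..m}. ?c j) = card S"
  proof -
    have "card S = card (prod.swap ` S)"
      by (intro card_image[symmetric] inj_onI) auto
    also have "prod.swap ` S = Sigma {1..m} (\<lambda>j. {i. (i, j) \<in> S})" using S by force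
    finally show ?thesis using fin by (metis card_SigmaI finite_atLeastAtMost)
  qed
  have pat: "(\<Prod>j\<in>{1..m}. pattern_prob S {} s i j a (B j)) \<le> \<bar>a\<bar> ^ ?r i * ?k B i" for i a and B :: "nat \<Rightarrow> real"
  proof -
    have "(\<Prod>j\<in>{1..m}. pattern_prob S {} s i j a (B j)) \<le>
        (\<Prod>j\<in>{1..m}. (if (i, j) \<in> S then \<bar>a\<bar> else 1) * (if (i, j) \<in> S then \<bar>B j\<bar> / s else 1))"
      by (intro prod_mono) (auto simp: pattern_prob_def edge_prob_le[OF s_nonneg, simplified] split: if_splits)
    also have "\<dots> = (\<Prod>j\<in>{1..m}. if (i, j) \<in> S then \<bar>a\<bar> else 1) * ?k B i"
      by (rule prod.distrib)
    also have "(\<Prod>j\<in>{1..m}. if (i, j) \<in> S then \<bar>a\<bar> else 1) = \<bar>a\<bar> ^ card {j \<in> {1..m}. (i, j) \<in> S}"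
      by (subst prod.inter_filter[symmetric]) auto
    also have "{j \<in> {1..m}. (i, j) \<in> S} = {j. (i, j) \<in> S}" using S by auto
    finally show ?thesis .
  qed
  have "emeasure law {X. \<forall>ij\<in>S. X ij} =
    (\<integral>\<^sup>+B. (\<Prod>i\<in>{1..n}. \<integral>\<^sup>+a. ennreal (\<Prod>j\<in>{1..m}. pattern_prob S {} s i j a (B j)) \<partial>Q i)
       \<partial>PiM {1..m} (\<lambda>_. P))"
    using emeasure_law_pattern[OF S, of "{}"] by simp
  also have "\<dots> \<le> (\<integral>\<^sup>+B. (\<Prod>i\<in>{1..n}. ennreal (C ^ ?r i * ?k B i)) \<partial>PiM {1..m} (\<lambda>_. P))"
  proof (intro nn_integral_mono prod_mono_ennreal)
    fix B i
    have "(\<integral>\<^sup>+a. ennreal (\<Prod>j\<in>{1..m}. pattern_prob S {} s i j a (B j)) \<partial>Q i) \<le>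
        (\<integral>\<^sup>+a. ennreal (\<bar>a\<bar> ^ ?r i) * ennreal (?k B i) \<partial>Q i)"
      using pat k by (intro nn_integral_mono) (simp add: ennreal_mult[symmetric] ennreal_leI)
    also have "\<dots> = (\<integral>\<^sup>+a. ennreal (\<bar>a\<bar> ^ ?r i) \<partial>Q i) * ennreal (?k B i)"
      by (rule nn_integral_multc) measurable
    also have "\<dots> \<le> ennreal (C ^ ?r i) * ennreal (?k B i)"
      by (intro mult_right_mono row) simp
    finally show "(\<integral>\<^sup>+a. ennreal (\<Prod>j\<in>{1..m}. pattern_prob S {} s i j a (B j)) \<partial>Q i) \<le>
        ennreal (C ^ ?r i * ?k B i)"
      using C k by (simp add: ennreal_mult)
  qed
  also have "\<dots> = (\<integral>\<^sup>+B. ennreal (C ^ card S) * (\<Prod>j\<in>{1..m}. ennreal ((\<bar>B j\<bar> / s) ^ ?c j)) \<partial>PiM {1..m} (\<lambda>_. P))"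
  proof (intro nn_integral_cong)
    fix B :: "nat \<Rightarrow> real"
    \<comment> \<open>Exchanging the products regroups the attribute weights by column, so that the
      remaining integrand is a product over independent weights.\<close>
    have "(\<Prod>i\<in>{1..n}. ?k B i) = (\<Prod>j\<in>{1..m}. \<Prod>i\<in>{1..n}. if (i, j) \<in> S then \<bar>B j\<bar> / s else 1)"
      by (rule prod.swap)
    also have "\<dots> = (\<Prod>j\<in>{1..m}. (\<bar>B j\<bar> / s) ^ ?c j)"
    proof (intro prod.cong refl)
      fix j
      have "(\<Prod>i\<in>{1..n}. if (i, j) \<in> S then \<bar>B j\<bar> / s else 1) = (\<bar>B j\<bar> / s) ^ card {i \<in> {1..n}. (i, j) \<in> S}"
        by (subst prod.inter_filter[symmetric]) auto
      also have "{i \<in> {1..n}. (i, j) \<in> S} = {i. (i, j) \<in> S}" using S by auto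
      finally show "(\<Prod>i\<in>{1..n}. if (i, j) \<in> S then \<bar>B j\<bar> / s else 1) = (\<bar>B j\<bar> / s) ^ ?c j" .
    qed
    finally have "(\<Prod>i\<in>{1..n}. C ^ ?r i * ?k B i) = C ^ card S * (\<Prod>j\<in>{1..m}. (\<bar>B j\<bar> / s) ^ ?c j)"
      by (simp add: prod.distrib power_sum[symmetric] card_r del: prod_constant)
    then show "(\<Prod>i\<in>{1..n}. ennreal (C ^ ?r i * ?k B i)) =
        ennreal (C ^ card S) * (\<Prod>j\<in>{1..m}. ennreal ((\<bar>B j\<bar> / s) ^ ?c j))"
      using C k by (subst prod_ennreal) (simp_all add: prod_ennreal ennreal_mult[symmetric] prod_nonneg)
  qed
  also have "\<dots> = ennreal (C ^ card S) * (\<Prod>j\<in>{1..m}. \<integral>\<^sup>+b. ennreal ((\<bar>b\<bar> / s) ^ ?c j) \<partial>P)"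
    by (subst nn_integral_cmult, simp, subst P.product_nn_integral_prod) simp_all
  also have "\<dots> \<le> ennreal (C ^ card S) * (\<Prod>j\<in>{1..m}. ennreal ((C / s) ^ ?c j))"
  proof (intro mult_left_mono prod_mono_ennreal)
    fix j
    have "(\<integral>\<^sup>+b. ennreal ((\<bar>b\<bar> / s) ^ ?c j) \<partial>P) =
        (\<integral>\<^sup>+b. ennreal (\<bar>b\<bar> ^ ?c j) * ennreal (1 / s ^ ?c j) \<partial>P)"
      by (intro nn_integral_cong) (simp add: ennreal_mult[symmetric] power_divide)
    also have "\<dots> = (\<integral>\<^sup>+b. ennreal (\<bar>b\<bar> ^ ?c j) \<partial>P) * ennreal (1 / s ^ ?c j)"
      by (rule nn_integral_multc) measurable
    also have "\<dots> \<le> ennreal (C ^ ?c j) * ennreal (1 / s ^ ?c j)"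
      by (intro mult_right_mono col) simp
    finally show "(\<integral>\<^sup>+b. ennreal ((\<bar>b\<bar> / s) ^ ?c j) \<partial>P) \<le> ennreal ((C / s) ^ ?c j)"
      using C by (simp add: ennreal_mult[symmetric] power_divide)
  qed simp
  also have "\<dots> = ennreal (C ^ card S * (C / s) ^ card S)"
  proof -
    have "(\<Prod>j\<in>{1..m}. ennreal ((C / s) ^ ?c j)) = ennreal ((C / s) ^ card S)"
      unfolding card_c[symmetric] power_sum using C by (intro prod_ennreal) auto
    then show ?thesis
      using C by (simp only: ennreal_mult zero_le_power divide_nonneg_nonneg s_nonneg)
  qed
  also have "C ^ card S * (C / s) ^ card S = (C * (C / s)) ^ card S"
    by (rule power_mult_distrib[symmetric])
  also have "C * (C / s) = C\<^sup>2 / s"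
    by (simp add: power2_eq_square)
  finally have "ennreal (prob {X. \<forall>ij\<in>S. X ij}) \<le> ennreal ((C\<^sup>2 / s) ^ card S)"
    unfolding emeasure_eq_measure .
  moreover have "0 \<le> (C\<^sup>2 / s) ^ card S"
    using C by (intro zero_le_power divide_nonneg_nonneg) auto
  ultimately show ?thesis
    by (subst (asm) ennreal_le_iff)
qed

section \<open>Single columns, and conditioning on the weight of one vertex\<close>

definition mean_edge_prob :: "nat \<Rightarrow> real \<Rightarrow> real" where
  "mean_edge_prob i b = (\<integral>a. edge_prob s a b \<partial>Q i)"

lemma integrable_edge_prob [simp]: "integrable (Q i) (\<lambda>a. edge_prob s a b)"
proof -
  show ?thesis
    by (rule Q.M.integrable_const_bound[where B = 1]) simp_all
qed

lemma mean_edge_prob_nonneg [simp]: "0 \<le> mean_edge_prob i b"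
  by (simp add: mean_edge_prob_def)

lemma mean_edge_prob_le_1 [simp]: "mean_edge_prob i b \<le> 1"
proof -
  show ?thesis
    unfolding mean_edge_prob_def by (rule Q.M.integral_le_const) simp_all
qed

lemma nn_integral_edge_prob:
  "(\<integral>\<^sup>+a. ennreal (edge_prob s a b) \<partial>Q i) = ennreal (mean_edge_prob i b)"
  unfolding mean_edge_prob_def by (intro nn_integral_eq_integral) simp_all

lemma nn_integral_1_minus_edge_prob:
  "(\<integral>\<^sup>+a. ennreal (1 - edge_prob s a b) \<partial>Q i) = ennreal (1 - mean_edge_prob i b)"
proof -
  have "(\<integral>\<^sup>+a. ennreal (1 - edge_prob s a b) \<partial>Q i) = ennreal (\<integral>a. 1 - edge_prob s a b \<partial>Q i)"
    by (intro nn_integral_eq_integral) simp_all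
  also have "(\<integral>a. 1 - edge_prob s a b \<partial>Q i) = 1 - mean_edge_prob i b"
    unfolding mean_edge_prob_def by (subst Bochner_Integration.integral_diff) (simp_all add: Q.M.prob_space[simplified])
  finally show ?thesis .
qed

lemma borel_measurable_mean_edge_prob [measurable]: "mean_edge_prob i \<in> borel_measurable borel"
proof -
  show ?thesis unfolding mean_edge_prob_def by measurable
qed

text \<open>Conditionally on B_w = b the memberships in \<open>w\<close> are independent, since each
  vertex has its own weight; averaging that weight gives vertex i the probability
  \<open>mean_edge_prob i b\<close>.\<close>

lemma prob_column:
  assumes "w \<in> {1..m}" "S \<subseteq> {1..n}" "T \<subseteq> {1..n}" "S \<inter> T = {}"
  shows "prob {X. (\<forall>i\<in>S. X (i, w)) \<and> (\<forall>i\<in>T. \<not> X (i, w))} =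
    (\<integral>b. (\<Prod>i\<in>S. mean_edge_prob i b) * (\<Prod>i\<in>T. 1 - mean_edge_prob i b) \<partial>P)"
proof -
  have fin: "finite S" "finite T" using assms finite_subset by blast+
  let ?f = "\<lambda>b. (\<Prod>i\<in>S. mean_edge_prob i b) * (\<Prod>i\<in>T. 1 - mean_edge_prob i b)"
  have f: "0 \<le> ?f b" "?f b \<le> 1" for b
    by (auto intro!: mult_nonneg_nonneg prod_nonneg mult_le_one prod_le_1)
  have *: "(\<integral>\<^sup>+a. ennreal (pattern_prob (S \<times> {w}) (T \<times> {w}) s i w a b) \<partial>Q i) =
     ennreal (if i \<in> S then mean_edge_prob i b else 1) *
     ennreal (if i \<in> T then 1 - mean_edge_prob i b else 1)" for i b
  proof -
    show ?thesis
      using assms(4) Q.M.emeasure_space_1[of i]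
      by (auto simp: pattern_prob_def nn_integral_edge_prob nn_integral_1_minus_edge_prob)
  qed
  have "(\<Prod>i\<in>{1..n}. \<integral>\<^sup>+a. ennreal (pattern_prob (S \<times> {w}) (T \<times> {w}) s i w a b) \<partial>Q i) = ennreal (?f b)" for b
  proof -
    have "(\<Prod>i\<in>{1..n}. ennreal (if i \<in> S then mean_edge_prob i b else 1) *
        ennreal (if i \<in> T then 1 - mean_edge_prob i b else 1)) =
      ennreal ((\<Prod>i\<in>{1..n}. if i \<in> S then mean_edge_prob i b else 1) *
        (\<Prod>i\<in>{1..n}. if i \<in> T then 1 - mean_edge_prob i b else 1))"
      by (subst prod.distrib, subst (1 2) prod_ennreal) (auto simp: ennreal_mult prod_nonneg)
    also have "(\<Prod>i\<in>{1..n}. if i \<in> S then mean_edge_prob i b else 1) = (\<Prod>i\<in>S. mean_edge_prob i b)"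
      using assms(2) by (subst prod.inter_filter[symmetric]) (auto intro!: prod.cong)
    also have "(\<Prod>i\<in>{1..n}. if i \<in> T then 1 - mean_edge_prob i b else 1) = (\<Prod>i\<in>T. 1 - mean_edge_prob i b)"
      using assms(3) by (subst prod.inter_filter[symmetric]) (auto intro!: prod.cong)
    finally show ?thesis by (simp only: *)
  qed
  then have "emeasure law {X. (\<forall>i\<in>S. X (i, w)) \<and> (\<forall>i\<in>T. \<not> X (i, w))} = (\<integral>\<^sup>+b. ennreal (?f b) \<partial>P)"
    unfolding emeasure_law_column[OF assms] by simp
  also have "\<dots> = ennreal (\<integral>b. ?f b \<partial>P)"
  proof (rule nn_integral_eq_integral)
    show "integrable P ?f"
      by (rule P.M.integrable_const_bound[where B = 1]) (use f in auto)
  qed (use f in auto)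
  finally have "ennreal (prob {X. (\<forall>i\<in>S. X (i, w)) \<and> (\<forall>i\<in>T. \<not> X (i, w))}) = ennreal (\<integral>b. ?f b \<partial>P)"
    unfolding emeasure_eq_measure .
  then show ?thesis
    by (subst (asm) ennreal_inj) (auto intro!: integral_nonneg_AE simp: f)
qed

lemma weighted_rig_point_mass: "weighted_rig (Q(k := return borel z)) P"
proof (rule weighted_rig.intro)
  fix i
  have "real_distribution (return borel z)"
    by (auto simp: real_distribution_def real_distribution_axioms_def intro!: prob_space_return)
  then show "real_distribution ((Q(k := return borel z)) i)"
    using row_distribution[of i] by simp
qed (rule column_distribution)

text \<open>Disintegration over A_k: splitting coordinate k off the product measure leaves the same
  integral over the other rows as in the model where this weight is the point mass at z.\<close>

lemma emeasure_law_condition_row: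
  assumes k: "k \<in> {1..n}"
  shows "emeasure law E =
    (\<integral>\<^sup>+z. emeasure (weighted_rig.law n m (Q(k := return borel z)) P) E \<partial>Q k)"
proof -
  let ?I = "{1..n} - {k}"
  let ?K = "\<lambda>B A. emeasure (measure_pmf (attr_law n m A B)) E"
  have I: "finite ?I" "k \<notin> ?I" "insert k ?I = {1..n}" using k by auto
  interpret A: prob_space "PiM {1..n} Q" by (intro prob_space_PiM prob_space_Q)
  interpret A': prob_space "PiM ?I Q" by (intro prob_space_PiM prob_space_Q)
  interpret B: prob_space "PiM {1..m} (\<lambda>_. P)" by (intro prob_space_PiM prob_space_P)
  have K [measurable]: "(\<lambda>(A, B). ?K B A) \<in> borel_measurable (PiM {1..n} Q \<Otimes>\<^sub>M PiM {1..m} (\<lambda>_. P))"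
    using measurable_compose[OF measurable_prob_algebraD[OF measurable_attr_law_weights]
        measurable_emeasure_subprob_algebra[of E]]
    by (simp add: case_prod_beta)
  have KB: "?K B \<in> borel_measurable (PiM {1..n} Q)" if "B \<in> space (PiM {1..m} (\<lambda>_. P))" for B
    using measurable_compose[OF measurable_Pair2'[OF that, of "PiM {1..n} Q"] K] by simp
  \<comment> \<open>The common value of both models at A_k = z for given attribute weights. Its
    joint measurability is what the exchange of integrals at the end needs.\<close>
  define F where "F z B = (\<integral>\<^sup>+A. ?K B (A(k := z)) \<partial>PiM ?I Q)" for z B
  have F_meas [measurable]: "(\<lambda>(z, B). F z B) \<in> borel_measurable (Q k \<Otimes>\<^sub>M PiM {1..m} (\<lambda>_. P))"
  proof -
    have "(\<lambda>x. ((snd x)(k := fst (fst x)), snd (fst x))) \<in>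
       measurable ((Q k \<Otimes>\<^sub>M PiM {1..m} (\<lambda>_. P)) \<Otimes>\<^sub>M PiM ?I Q) (PiM (insert k ?I) Q \<Otimes>\<^sub>M PiM {1..m} (\<lambda>_. P))"
      by (intro measurable_Pair measurable_fun_upd[where J = ?I]) (use I in auto)
    from measurable_compose[OF this[unfolded I(3)] K]
    have "(\<lambda>(x, A). ?K (snd x) (A(k := fst x))) \<in> borel_measurable ((Q k \<Otimes>\<^sub>M PiM {1..m} (\<lambda>_. P)) \<Otimes>\<^sub>M PiM ?I Q)"
      by (simp add: case_prod_unfold)
    then show ?thesis
      unfolding F_def case_prod_unfold by (intro A'.borel_measurable_nn_integral) (simp add: case_prod_unfold)
  qed
  have F_law: "emeasure (weighted_rig.law n m (Q(k := return borel z)) P) E =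
      (\<integral>\<^sup>+B. F z B \<partial>PiM {1..m} (\<lambda>_. P))" for z
  proof -
    let ?Q = "Q(k := return borel z)"
    interpret z: weighted_rig n m ?Q P by (rule weighted_rig_point_mass)
    have PI: "PiM ?I ?Q = PiM ?I Q" by (intro PiM_cong) auto
    have sets_PI: "sets (PiM {1..n} ?Q) = sets (PiM {1..n} Q)"
      by (intro sets_PiM_cong) auto
    have dirac: "(\<integral>\<^sup>+y. ?K B (A(k := y)) \<partial>return borel z) = ?K B (A(k := z))"
      if "A \<in> space (PiM ?I Q)" "B \<in> space (PiM {1..m} (\<lambda>_. P))" for A B
    proof (rule nn_integral_return)
      have "(\<lambda>y. A(k := y)) \<in> measurable (Q k) (PiM (insert k ?I) Q)"
        using measurable_component_update[OF that(1) I(2)] .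
      from measurable_compose[OF this[unfolded I(3)] KB[OF that(2)]]
      show "(\<lambda>y. ?K B (A(k := y))) \<in> borel_measurable borel"
        by (simp cong: measurable_cong_sets)
    qed simp
    have "(\<integral>\<^sup>+A. ?K B A \<partial>PiM {1..n} ?Q) = F z B" if B: "B \<in> space (PiM {1..m} (\<lambda>_. P))" for B
    proof -
      have "?K B \<in> borel_measurable (PiM {1..n} ?Q)"
        using KB[OF B] measurable_cong_sets[OF sets_PI refl, of borel] by blast
      from z.Q.product_nn_integral_insert[OF I(1,2), unfolded I(3), OF this]
      show ?thesis
        unfolding F_def PI fun_upd_same by (simp add: dirac[OF _ B] cong: nn_integral_cong)
    qed
    then show ?thesis
      unfolding z.emeasure_law by (intro nn_integral_cong)
  qed
  have "emeasure law E = (\<integral>\<^sup>+B. \<integral>\<^sup>+z. F z B \<partial>Q k \<partial>PiM {1..m} (\<lambda>_. P))"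
    unfolding emeasure_law F_def
    by (intro nn_integral_cong Q.product_nn_integral_insert_rev[OF I(1,2), unfolded I(3)] KB)
  also have "\<dots> = (\<integral>\<^sup>+z. \<integral>\<^sup>+B. F z B \<partial>PiM {1..m} (\<lambda>_. P) \<partial>Q k)"
  proof -
    interpret pair_sigma_finite "Q k" "PiM {1..m} (\<lambda>_. P)" ..
    show ?thesis by (rule Fubini') measurable
  qed
  finally show ?thesis
    by (simp only: F_law)
qed

end

text \<open>With A_k deterministic, the columns \<open>w\<close> and \<open>w'\<close> share no
  random weight: i occurs only in the first, j only in the second, and the factors of k depend on
  the attribute weights alone. Hence the probability splits.\<close>

lemma prob_two_columns_point_mass:
  assumes "weighted_rig Q P"
    and ijk: "i \<in> {1..n}" "j \<in> {1..n}" "k \<in> {1..n}" "i \<noteq> j" "i \<noteq> k" "j \<noteq> k"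
    and w: "w \<in> {1..m}" "w' \<in> {1..m}" "w \<noteq> w'"
    and Qk: "Q k = return borel z"
  shows "measure (weighted_rig.law n m Q P) {X. X (i, w) \<and> X (k, w) \<and> X (j, w') \<and> X (k, w')} =
    (\<integral>b. weighted_rig.mean_edge_prob n m Q i b * edge_prob (sqrt (real n * real m)) z b \<partial>P) *
    (\<integral>b. weighted_rig.mean_edge_prob n m Q j b * edge_prob (sqrt (real n * real m)) z b \<partial>P)"
proof -
  interpret weighted_rig n m Q P by fact
  let ?S = "{(i, w), (k, w), (j, w'), (k, w')}"
  \<comment> \<open>The contribution of column v once the vertex weights are integrated out; columns
    outside the pattern contribute 1.\<close>
  let ?h = "\<lambda>v b. if v = w then mean_edge_prob i b * edge_prob s z b
    else if v = w' then mean_edge_prob j b * edge_prob s z b else 1"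
  have h: "0 \<le> ?h v b" "?h v b \<le> 1" for v b
    by (auto intro!: mult_le_one)
  have rows: "(\<Prod>v\<in>{1..m}. pattern_prob ?S {} s l v a (B v)) =
     (if l = i then edge_prob s a (B w) else if l = j then edge_prob s a (B w') else
      if l = k then edge_prob s a (B w) * edge_prob s a (B w') else 1)" for l a and B :: "nat \<Rightarrow> real"
  proof -
    have "(\<Prod>v\<in>{1..m}. pattern_prob ?S {} s l v a (B v)) = (\<Prod>v\<in>{w, w'}. pattern_prob ?S {} s l v a (B v))"
      using w by (intro prod.mono_neutral_right) (auto simp: pattern_prob_def)
    then show ?thesis
      using w(3) ijk by (auto simp: pattern_prob_def)
  qed
  have int: "(\<Prod>l\<in>{1..n}. \<integral>\<^sup>+a. ennreal (\<Prod>v\<in>{1..m}. pattern_prob ?S {} s l v a (B v)) \<partial>Q l) =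
     (\<Prod>v\<in>{1..m}. ennreal (?h v (B v)))" for B :: "nat \<Rightarrow> real"
  proof -
    have one: "(\<integral>\<^sup>+a. 1 \<partial>Q l) = 1" for l
      using Q.M.emeasure_space_1[of l] by simp
    have "(\<Prod>l\<in>{1..n}. \<integral>\<^sup>+a. ennreal (\<Prod>v\<in>{1..m}. pattern_prob ?S {} s l v a (B v)) \<partial>Q l) =
       (\<Prod>l\<in>{i, j, k}. \<integral>\<^sup>+a. ennreal (\<Prod>v\<in>{1..m}. pattern_prob ?S {} s l v a (B v)) \<partial>Q l)"
      using ijk unfolding rows by (intro prod.mono_neutral_right) (auto simp: one[simplified])
    also have "\<dots> = ennreal (mean_edge_prob i (B w)) * (ennreal (mean_edge_prob j (B w')) *
        ennreal (edge_prob s z (B w) * edge_prob s z (B w')))"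
    proof -
      have "(\<integral>\<^sup>+a. ennreal (edge_prob s a (B w) * edge_prob s a (B w')) \<partial>Q k) =
          ennreal (edge_prob s z (B w) * edge_prob s z (B w'))"
        unfolding Qk by (rule nn_integral_return) auto
      then show ?thesis
        using ijk unfolding rows by (simp add: nn_integral_edge_prob)
    qed
    also have "\<dots> = (\<Prod>v\<in>{w, w'}. ennreal (?h v (B v)))"
      using w(3) by (simp add: ennreal_mult[symmetric] ac_simps)
    also have "\<dots> = (\<Prod>v\<in>{1..m}. ennreal (?h v (B v)))"
      using w by (intro prod.mono_neutral_left) auto
    finally show ?thesis .
  qed
  have S: "?S \<subseteq> {1..n} \<times> {1..m}" using ijk w by auto
  have "emeasure law {X. X (i, w) \<and> X (k, w) \<and> X (j, w') \<and> X (k, w')} =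
    emeasure law {X. (\<forall>ij\<in>?S. X ij) \<and> (\<forall>ij\<in>{}. \<not> X ij)}"
    by (intro arg_cong[of _ _ "emeasure law"]) auto
  also have "\<dots> = (\<integral>\<^sup>+B. (\<Prod>v\<in>{1..m}. ennreal (?h v (B v))) \<partial>PiM {1..m} (\<lambda>_. P))"
    by (subst emeasure_law_pattern[OF S]) (simp_all only: int, auto)
  also have "\<dots> = (\<Prod>v\<in>{1..m}. \<integral>\<^sup>+b. ennreal (?h v b) \<partial>P)"
    by (rule P.product_nn_integral_prod) simp_all
  also have "\<dots> = (\<Prod>v\<in>{1..m}. ennreal (\<integral>b. ?h v b \<partial>P))"
  proof (intro prod.cong refl nn_integral_eq_integral)
    fix v
    show "integrable P (?h v)"
      by (rule P.M.integrable_const_bound[where B = 1]) (use h in \<open>auto intro!: mult_le_one\<close>)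
  qed (use h in auto)
  also have "\<dots> = (\<Prod>v\<in>{w, w'}. ennreal (\<integral>b. ?h v b \<partial>P))"
    using w by (intro prod.mono_neutral_right) (auto simp: P.M.prob_space[simplified])
  also have "\<dots> = ennreal ((\<integral>b. mean_edge_prob i b * edge_prob s z b \<partial>P) *
      (\<integral>b. mean_edge_prob j b * edge_prob s z b \<partial>P))"
    using w(3) by (simp add: ennreal_mult[symmetric] integral_nonneg_AE)
  finally show ?thesis
    unfolding emeasure_eq_measure
    by (subst (asm) ennreal_inj) (auto intro!: mult_nonneg_nonneg integral_nonneg_AE simp: s_def)
qed

section \<open>Union bounds\<close>

context weighted_rig
begin

definition in_range :: "(nat \<times> nat \<Rightarrow> bool) \<Rightarrow> bool" where
  "in_range X \<longleftrightarrow> (\<forall>i j. X (i, j) \<longrightarrow> i \<in> {1..n} \<and> j \<in> {1..m})"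

lemma AE_in_range: "AE X in law. in_range X"
  using AE_law_in_range by (simp add: in_range_def)

lemma prob_mono_in_range:
  assumes "\<And>X. in_range X \<Longrightarrow> E X \<Longrightarrow> F X"
  shows "prob {X. E X} \<le> prob {X. F X}"
  using AE_in_range by (intro finite_measure_mono_AE) (auto elim!: eventually_mono intro: assms)

lemma prob_Un_le: "prob {X. E X \<or> F X} \<le> prob {X. E X} + prob {X. F X}"
  unfolding Collect_disj_eq by (rule measure_Un_le) auto

lemma prob_bex_le:
  assumes "finite W"
  shows "prob {X. \<exists>w\<in>W. E w X} \<le> (\<Sum>w\<in>W. prob {X. E w X})"
proof -
  have "{X. \<exists>w\<in>W. E w X} = (\<Union>w\<in>W. {X. E w X})" by auto
  then show ?thesis using measure_UNION_le[OF assms, of "\<lambda>w. {X. E w X}" law] by simp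
qed

text \<open>Bonferroni's inequality, with error events in place of the pairwise intersections.\<close>

lemma prob_approx_union:
  assumes W: "finite W"
    and upper: "\<And>X. in_range X \<Longrightarrow> A X \<Longrightarrow> \<exists>w\<in>W. E w X \<or> H w X"
    and lower: "\<And>X w. in_range X \<Longrightarrow> w \<in> W \<Longrightarrow> E w X \<Longrightarrow> A X \<or> H w X"
    and disj: "\<And>X v w. v \<in> W \<Longrightarrow> w \<in> W \<Longrightarrow> v \<noteq> w \<Longrightarrow> E v X \<Longrightarrow> E w X \<Longrightarrow> H v X \<or> H w X"
    and H: "(\<Sum>w\<in>W. prob {X. H w X}) \<le> \<epsilon>"
  shows "\<bar>prob {X. A X} - (\<Sum>w\<in>W. prob {X. E w X})\<bar> \<le> \<epsilon>"
proof -
  have "prob {X. A X} \<le> prob {X. \<exists>w\<in>W. E w X \<or> H w X}"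
    by (intro prob_mono_in_range upper)
  also have "\<dots> \<le> (\<Sum>w\<in>W. prob {X. E w X \<or> H w X})"
    by (rule prob_bex_le[OF W])
  also have "\<dots> \<le> (\<Sum>w\<in>W. prob {X. E w X} + prob {X. H w X})"
    by (intro sum_mono prob_Un_le)
  finally have le: "prob {X. A X} \<le> (\<Sum>w\<in>W. prob {X. E w X}) + \<epsilon>"
    using H by (simp add: sum.distrib)
  \<comment> \<open>Without the error events these sets are pairwise disjoint, so their
    probabilities add up to that of a union, which is almost surely contained in the event
    \<open>A\<close>.\<close>
  let ?E = "\<lambda>w. {X. E w X \<and> \<not> H w X}"
  have "(\<Sum>w\<in>W. prob {X. E w X}) \<le> (\<Sum>w\<in>W. prob (?E w) + prob {X. H w X})"
  proof (intro sum_mono)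
    fix w
    have "prob {X. E w X} \<le> prob {X. (E w X \<and> \<not> H w X) \<or> H w X}"
      by (intro finite_measure_mono) auto
    also have "\<dots> \<le> prob (?E w) + prob {X. H w X}"
      by (rule prob_Un_le)
    finally show "prob {X. E w X} \<le> prob (?E w) + prob {X. H w X}" .
  qed
  also have "\<dots> = (\<Sum>w\<in>W. prob (?E w)) + (\<Sum>w\<in>W. prob {X. H w X})"
    by (rule sum.distrib)
  also have "(\<Sum>w\<in>W. prob (?E w)) = prob (\<Union>w\<in>W. ?E w)"
    using W disj by (intro finite_measure_finite_Union[symmetric]) (auto simp: disjoint_family_on_def)
  also have "(\<Union>w\<in>W. ?E w) = {X. \<exists>w\<in>W. E w X \<and> \<not> H w X}"
    by auto
  also have "prob \<dots> \<le> prob {X. A X}"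
    using lower by (intro prob_mono_in_range) blast
  finally show ?thesis
    using le H by linarith
qed

end

text \<open>\<open>D i\<close> is the order up to which the moments of the weight of vertex \<open>i\<close> are controlled.\<close>

locale moment_bounded_rig = weighted_rig +
  fixes C :: real and D :: "nat \<Rightarrow> nat"
  assumes C_nonneg: "0 \<le> C"
    and row_moment: "\<And>i d. d \<le> D i \<Longrightarrow> (\<integral>\<^sup>+a. ennreal (\<bar>a\<bar> ^ d) \<partial>Q i) \<le> ennreal (C ^ d)"
    and D_ge_2: "\<And>i. 2 \<le> D i"
    and column_moment: "\<And>d. d \<le> 3 \<Longrightarrow> (\<integral>\<^sup>+b. ennreal (\<bar>b\<bar> ^ d) \<partial>P) \<le> ennreal (C ^ d)"
begin

section \<open>Incidence patterns and the cost of their free positions\<close>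

definition c :: real where "c = C\<^sup>2 / s"

lemma c_nonneg [simp]: "0 \<le> c"
  by (simp add: c_def)

text \<open>Patterns are lists rather than sets so that, for a concrete pattern, distinctness and
  the row and column counts reduce by simplification to inequalities between indices. The limits
  \<open>D i\<close> and 3 are the available moment orders.\<close>

definition admissible :: "(nat \<times> nat) list \<Rightarrow> bool" where
  "admissible xs \<longleftrightarrow> distinct xs \<and>
     (\<forall>i. length (filter (\<lambda>p. fst p = i) xs) \<le> D i) \<and>
     (\<forall>j. length (filter (\<lambda>p. snd p = j) xs) \<le> 3)"

text \<open>A pattern leaving the index rectangle has probability 0, so the union bounds carry no
  range conditions.\<close>

lemma prob_list_le:
  assumes "admissible xs"
  shows "prob {X. \<forall>p\<in>set xs. X p} \<le> c ^ length xs"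
proof (cases "set xs \<subseteq> {1..n} \<times> {1..m}")
  case True
  have "card {j. (i, j) \<in> set xs} \<le> D i" for i
  proof -
    have "{j. (i, j) \<in> set xs} = snd ` set (filter (\<lambda>p. fst p = i) xs)"
      by (force simp: image_iff)
    then have "card {j. (i, j) \<in> set xs} \<le> length (filter (\<lambda>p. fst p = i) xs)"
      by (metis card_image_le card_length finite_set order_trans)
    then show ?thesis using assms unfolding admissible_def by (meson order_trans)
  qed
  moreover have "card {i. (i, j) \<in> set xs} \<le> 3" for j
  proof -
    have "{i. (i, j) \<in> set xs} = fst ` set (filter (\<lambda>p. snd p = j) xs)"
      by (force simp: image_iff)
    then have "card {i. (i, j) \<in> set xs} \<le> length (filter (\<lambda>p. snd p = j) xs)"
      by (metis card_image_le card_length finite_set order_trans)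
    then show ?thesis using assms unfolding admissible_def by (meson order_trans)
  qed
  ultimately have "prob {X. \<forall>p\<in>set xs. X p} \<le> (C\<^sup>2 / s) ^ card (set xs)"
    by (intro prob_all_le True C_nonneg row_moment column_moment)
  then show ?thesis
    using assms by (simp add: admissible_def distinct_card c_def)
next
  case False
  then have "prob {X. \<forall>p\<in>set xs. X p} \<le> prob {X. False}"
    by (intro prob_mono_in_range) (auto simp: in_range_def)
  also have "\<dots> \<le> c ^ length xs" by simp
  finally show ?thesis .
qed

lemma admissibleI:
  assumes "distinct xs" "\<And>i. length (filter (\<lambda>p. fst p = i) xs) \<le> 2"
    "\<And>j. length (filter (\<lambda>p. snd p = j) xs) \<le> 3"
  shows "admissible xs"
  using assms D_ge_2 unfolding admissible_def by (meson order_trans)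

text \<open>\<open>ok\<close> collects the inequalities between indices under which the pattern is
  admissible. They do not depend on the outcome: where they fail, the event is empty.\<close>

lemma prob_le_power_c:
  assumes "l = length xs" "\<And>X. E X \<Longrightarrow> ok \<and> (\<forall>p\<in>set xs. X p)" "ok \<Longrightarrow> admissible xs"
  shows "prob {X. E X} \<le> c ^ l"
proof (cases ok)
  case True
  have "prob {X. E X} \<le> prob {X. \<forall>p\<in>set xs. X p}"
    using assms(2) by (intro finite_measure_mono) auto
  also have "\<dots> \<le> c ^ length xs"
    using assms(3) True by (intro prob_list_le) auto
  finally show ?thesis using assms(1) by simp
next
  case False
  with assms(2) have "{X. E X} = {}" by auto
  then show ?thesis by simp
qed

text \<open>A free attribute costs a factor m: the second assumption makes a witness
  \<open>w\<close> belong to some attribute set, which confines it almost surely to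
  \<open>{1..m}\<close>.\<close>

lemma prob_ex_column_le:
  fixes K :: real
  assumes K: "\<And>w. prob {X. E w X} \<le> K" and E: "\<And>X w. E w X \<Longrightarrow> \<exists>i. X (i, w)"
  shows "prob {X. \<exists>w. E w X} \<le> m * K"
proof -
  have "prob {X. \<exists>w. E w X} \<le> prob {X. \<exists>w\<in>{1..m}. E w X}"
    using E by (intro prob_mono_in_range) (metis in_range_def)
  also have "\<dots> \<le> (\<Sum>w\<in>{1..m}. prob {X. E w X})"
    by (rule prob_bex_le) simp
  also have "\<dots> \<le> (\<Sum>w\<in>{1..m}. K)"
    by (intro sum_mono K)
  finally show ?thesis by simp
qed

lemma prob_ex_row_le:
  fixes K :: real
  assumes K: "\<And>k. prob {X. E k X} \<le> K" and E: "\<And>X k. E k X \<Longrightarrow> \<exists>w. X (k, w)"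
  shows "prob {X. \<exists>k. E k X} \<le> n * K"
proof -
  have "prob {X. \<exists>k. E k X} \<le> prob {X. \<exists>k\<in>{1..n}. E k X}"
    using E by (intro prob_mono_in_range) (metis in_range_def)
  also have "\<dots> \<le> (\<Sum>k\<in>{1..n}. prob {X. E k X})"
    by (rule prob_bex_le) simp
  also have "\<dots> \<le> (\<Sum>k\<in>{1..n}. K)"
    by (intro sum_mono K)
  finally show ?thesis by simp
qed

text \<open>A common neighbour k uses one attribute shared by i, j and k, or two different ones: 3
  or 4 incidences, with k and one or two attributes free. For m of order n and c of order 1/n both
  terms are O(1/n).\<close>

lemma prob_common_neighbour_le:
  assumes "i \<noteq> j"
  shows "prob {X. \<exists>k. adj X i k \<and> adj X j k} \<le> n * (m * c ^ 3) + n * (m * (m * c ^ 4))"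
proof -
  let ?E = "\<lambda>k w X. k \<noteq> i \<and> k \<noteq> j \<and> X (i, w) \<and> X (j, w) \<and> X (k, w)"
  let ?F = "\<lambda>k w v X. (k \<noteq> i \<and> k \<noteq> j \<and> w \<noteq> v) \<and> X (i, w) \<and> X (k, w) \<and> X (j, v) \<and> X (k, v)"
  have "prob {X. \<exists>k. adj X i k \<and> adj X j k} \<le> prob {X. (\<exists>k w. ?E k w X) \<or> (\<exists>k w v. ?F k w v X)}"
    by (intro finite_measure_mono) (auto simp: adj_def attrs_def, metis)
  also have "\<dots> \<le> prob {X. \<exists>k w. ?E k w X} + prob {X. \<exists>k w v. ?F k w v X}"
    by (rule prob_Un_le)
  also have "prob {X. \<exists>k w. ?E k w X} \<le> n * (m * c ^ 3)"
  proof -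
    have "prob {X. ?E k w X} \<le> c ^ 3" for k w
      by (rule prob_le_power_c[of _ "[(i, w), (j, w), (k, w)]" _ "k \<noteq> i \<and> k \<noteq> j"])
         (use assms in \<open>auto intro!: admissibleI\<close>)
    then show ?thesis
      by (intro prob_ex_row_le prob_ex_column_le) blast+
  qed
  also have "prob {X. \<exists>k w v. ?F k w v X} \<le> n * (m * (m * c ^ 4))"
  proof -
    have "prob {X. ?F k w v X} \<le> c ^ 4" for k w v
      by (rule prob_le_power_c[of _ "[(i, w), (k, w), (j, v), (k, v)]" _ "k \<noteq> i \<and> k \<noteq> j \<and> w \<noteq> v"])
         (use assms in \<open>auto intro!: admissibleI\<close>)
    then show ?thesis
      by (intro prob_ex_row_le prob_ex_column_le) blast+
  qed
  finally show ?thesis by simp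
qed

lemma prob_two_common_attrs_le:
  assumes "i \<noteq> j"
  shows "prob {X. \<exists>v. v \<noteq> w \<and> X (i, w) \<and> X (j, w) \<and> X (i, v) \<and> X (j, v)} \<le> m * c ^ 4"
proof -
  have "prob {X. v \<noteq> w \<and> X (i, w) \<and> X (j, w) \<and> X (i, v) \<and> X (j, v)} \<le> c ^ 4" for v
    by (rule prob_le_power_c[of _ "[(i, w), (j, w), (i, v), (j, v)]" _ "v \<noteq> w"])
       (use assms in \<open>auto intro!: admissibleI\<close>)
  then show ?thesis by (intro prob_ex_column_le) blast+
qed

text \<open>The detour joins i and j through k by attributes other than \<open>w\<close>. With
  \<open>w\<close> shared as well this takes six incidences, while only \<open>v\<close> and
  \<open>v'\<close> are free.\<close>

lemma prob_detour_le:
  assumes "i \<noteq> j" "k \<noteq> i" "k \<noteq> j"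
  shows "prob {X. \<exists>v v'. (w \<noteq> v \<and> w \<noteq> v' \<and> v \<noteq> v') \<and>
    X (i, w) \<and> X (j, w) \<and> X (i, v) \<and> X (k, v) \<and> X (j, v') \<and> X (k, v')} \<le> m * (m * c ^ 6)"
proof -
  have "prob {X. (w \<noteq> v \<and> w \<noteq> v' \<and> v \<noteq> v') \<and>
      X (i, w) \<and> X (j, w) \<and> X (i, v) \<and> X (k, v) \<and> X (j, v') \<and> X (k, v')} \<le> c ^ 6" for v v'
    by (rule prob_le_power_c[of _ "[(i, w), (j, w), (i, v), (k, v), (j, v'), (k, v')]" _
          "w \<noteq> v \<and> w \<noteq> v' \<and> v \<noteq> v'"])
       (use assms in \<open>auto intro!: admissibleI\<close>)
  then show ?thesis by (intro prob_ex_column_le) blast+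
qed

lemma prob_ex_detour_le:
  assumes "i \<noteq> j"
  shows "prob {X. \<exists>k v v'. (k \<noteq> i \<and> k \<noteq> j \<and> w \<noteq> v \<and> w \<noteq> v' \<and> v \<noteq> v') \<and>
    X (i, w) \<and> X (j, w) \<and> X (i, v) \<and> X (k, v) \<and> X (j, v') \<and> X (k, v')} \<le> n * (m * (m * c ^ 6))"
proof -
  have "prob {X. \<exists>v v'. (k \<noteq> i \<and> k \<noteq> j \<and> w \<noteq> v \<and> w \<noteq> v' \<and> v \<noteq> v') \<and>
      X (i, w) \<and> X (j, w) \<and> X (i, v) \<and> X (k, v) \<and> X (j, v') \<and> X (k, v')} \<le> m * (m * c ^ 6)" for k
    using prob_detour_le[OF assms, of k w] by (cases "k \<noteq> i \<and> k \<noteq> j") auto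
  then show ?thesis by (intro prob_ex_row_le) blast+
qed

text \<open>The three pairs are witnessed by attributes w, v and v'. If two of these coincide, that
  attribute contains all three vertices, which is the main term. The errors are three different
  witnesses, or two attributes each shared by all three vertices.\<close>

lemma triangle_approx:
  assumes "i \<noteq> j" "i \<noteq> k" "j \<noteq> k"
  shows "\<bar>prob {X. adj X i j \<and> adj X i k \<and> adj X j k} -
      (\<Sum>w\<in>{1..m}. prob {X. X (i, w) \<and> X (j, w) \<and> X (k, w)})\<bar> \<le> m * (m * c ^ 6 + m * (m * c ^ 6))"
proof (rule prob_approx_union[where H = "\<lambda>w X.
    (\<exists>v. v \<noteq> w \<and> X (i, w) \<and> X (j, w) \<and> X (k, w) \<and> X (i, v) \<and> X (j, v) \<and> X (k, v)) \<or>
    (\<exists>v v'. (w \<noteq> v \<and> w \<noteq> v' \<and> v \<noteq> v') \<and>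
      X (i, w) \<and> X (j, w) \<and> X (i, v) \<and> X (k, v) \<and> X (j, v') \<and> X (k, v'))"])
  fix X assume "in_range X" "adj X i j \<and> adj X i k \<and> adj X j k"
  then obtain w v v' where w: "X (i, w)" "X (j, w)" "X (i, v)" "X (k, v)" "X (j, v')" "X (k, v')" "w \<in> {1..m}" "v \<in> {1..m}"
    by (auto simp: adj_def attrs_def in_range_def)
  show "\<exists>w\<in>{1..m}. (X (i, w) \<and> X (j, w) \<and> X (k, w)) \<or> (
    (\<exists>v. v \<noteq> w \<and> X (i, w) \<and> X (j, w) \<and> X (k, w) \<and> X (i, v) \<and> X (j, v) \<and> X (k, v)) \<or>
    (\<exists>v v'. (w \<noteq> v \<and> w \<noteq> v' \<and> v \<noteq> v') \<and>
      X (i, w) \<and> X (j, w) \<and> X (i, v) \<and> X (k, v) \<and> X (j, v') \<and> X (k, v')))"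
  proof (cases "w \<noteq> v \<and> w \<noteq> v' \<and> v \<noteq> v'")
    case True
    then show ?thesis using w by blast
  next
    case False
    then have "(X (i, w) \<and> X (j, w) \<and> X (k, w)) \<or> (X (i, v) \<and> X (j, v) \<and> X (k, v))"
      using w by auto
    then show ?thesis using w(7,8) by blast
  qed
next
  show "(\<Sum>w\<in>{1..m}. prob {X.
    (\<exists>v. v \<noteq> w \<and> X (i, w) \<and> X (j, w) \<and> X (k, w) \<and> X (i, v) \<and> X (j, v) \<and> X (k, v)) \<or>
    (\<exists>v v'. (w \<noteq> v \<and> w \<noteq> v' \<and> v \<noteq> v') \<and>
      X (i, w) \<and> X (j, w) \<and> X (i, v) \<and> X (k, v) \<and> X (j, v') \<and> X (k, v'))}) \<le>
    m * (m * c ^ 6 + m * (m * c ^ 6))" (is "(\<Sum>w\<in>_. prob {X. ?H1 w X \<or> ?H2 w X}) \<le> _")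
  proof -
    have "prob {X. v \<noteq> w \<and> X (i, w) \<and> X (j, w) \<and> X (k, w) \<and> X (i, v) \<and> X (j, v) \<and> X (k, v)} \<le> c ^ 6" for v w
      by (rule prob_le_power_c[of _ "[(i, w), (j, w), (k, w), (i, v), (j, v), (k, v)]" _ "v \<noteq> w"])
         (use assms in \<open>auto intro!: admissibleI\<close>)
    then have H1: "prob {X. ?H1 w X} \<le> m * c ^ 6" for w by (intro prob_ex_column_le) blast+
    have H2: "prob {X. ?H2 w X} \<le> m * (m * c ^ 6)" for w
      using assms by (intro prob_detour_le) auto
    have "prob {X. ?H1 w X \<or> ?H2 w X} \<le> m * c ^ 6 + m * (m * c ^ 6)" for w
      using prob_Un_le[of "?H1 w" "?H2 w"] H1[of w] H2[of w] by linarith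
    then have "(\<Sum>w\<in>{1..m}. prob {X. ?H1 w X \<or> ?H2 w X}) \<le> (\<Sum>w\<in>{1..m}. m * c ^ 6 + m * (m * c ^ 6))"
      by (intro sum_mono)
    then show ?thesis by simp
  qed
qed (use assms in \<open>auto simp: adj_def attrs_def\<close>)

end

section \<open>Common neighbours as members of a shared attribute\<close>

lemma adj_iff: "adj X i j \<longleftrightarrow> i \<noteq> j \<and> (\<exists>w. X (i, w) \<and> X (j, w))"
  by (auto simp: adj_def attrs_def)

text \<open>A common neighbour k reaches i through some \<open>v\<close> and j through some
  \<open>v'\<close>. If \<open>v = v'\<close>, uniqueness makes it \<open>w\<close>; otherwise the
  absence of detours makes one of the two \<open>w\<close>. Either way k belongs to
  \<open>w\<close>.\<close>

lemma common_nbrs_eq_column: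
  assumes "i \<noteq> j" "X (i, w)" "X (j, w)"
    and unique: "\<And>v. X (i, v) \<Longrightarrow> X (j, v) \<Longrightarrow> v = w"
    and no_detour: "\<And>k v v'. k \<noteq> i \<Longrightarrow> k \<noteq> j \<Longrightarrow> X (i, v) \<Longrightarrow> X (k, v) \<Longrightarrow> X (j, v') \<Longrightarrow> X (k, v') \<Longrightarrow>
      v = w \<or> v' = w \<or> v = v'"
  shows "common_nbrs n X i j = card {k \<in> {1..n} - {i, j}. X (k, w)}"
proof -
  have "X (k, w)" if k: "adj X i k" "adj X j k" for k
  proof -
    obtain v v' where v: "X (i, v)" "X (k, v)" "X (j, v')" "X (k, v')"
      using k unfolding adj_iff by blast
    have "k \<noteq> i" "k \<noteq> j"
      using k by (auto simp: adj_def)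
    then have "v = w \<or> v' = w \<or> v = v'"
      using no_detour v by blast
    then show ?thesis
      using v unique by metis
  qed
  then have "{k \<in> {1..n}. adj X i k \<and> adj X j k} = {k \<in> {1..n} - {i, j}. X (k, w)}"
    using assms(2,3) by (auto simp: adj_def attrs_def)
  then show ?thesis
    by (simp add: common_nbrs_def)
qed

context weighted_rig
begin

text \<open>Splitting by the exact set T of further members of \<open>w\<close>: given B_w all
  vertices have the same membership probability, so each of the \<open>(n - 2) choose r\<close> sets
  contributes equally.\<close>

lemma prob_column_card:
  assumes w: "w \<in> {1..m}" and ij: "i \<in> {1..n}" "j \<in> {1..n}" "i \<noteq> j"
    and iid: "\<And>i. mean_edge_prob i = f"
  shows "prob {X. X (i, w) \<and> X (j, w) \<and> card {k \<in> {1..n} - {i, j}. X (k, w)} = r} =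
    real ((n - 2) choose r) * (\<integral>b. f b ^ (r + 2) * (1 - f b) ^ (n - 2 - r) \<partial>P)"
proof -
  let ?V = "{1..n} - {i, j}"
  let ?\<T> = "{T. T \<subseteq> ?V \<and> card T = r}"
  let ?E = "\<lambda>T. {X. (\<forall>l\<in>{i, j} \<union> T. X (l, w)) \<and> (\<forall>l\<in>?V - T. \<not> X (l, w))}"
  have cardV: "card ?V = n - 2"
    using ij by (subst card_Diff_subset) auto
  have fin: "finite ?\<T>" by simp
  \<comment> \<open>The event for T determines T, which makes the events disjoint.\<close>
  have column: "{k \<in> ?V. X (k, w)} = T" if "T \<subseteq> ?V" "X \<in> ?E T" for X T
    using that by blast
  have "{X. X (i, w) \<and> X (j, w) \<and> card {k \<in> ?V. X (k, w)} = r} = (\<Union>T\<in>?\<T>. ?E T)"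
  proof (intro set_eqI iffI)
    fix X assume "X \<in> {X. X (i, w) \<and> X (j, w) \<and> card {k \<in> ?V. X (k, w)} = r}"
    then show "X \<in> (\<Union>T\<in>?\<T>. ?E T)"
      by (intro UN_I[of "{k \<in> ?V. X (k, w)}"]) auto
  next
    fix X assume "X \<in> (\<Union>T\<in>?\<T>. ?E T)"
    then obtain T where T: "T \<subseteq> ?V" "card T = r" "X \<in> ?E T" by blast
    then have "{k \<in> ?V. X (k, w)} = T" by (intro column)
    with T show "X \<in> {X. X (i, w) \<and> X (j, w) \<and> card {k \<in> ?V. X (k, w)} = r}" by auto
  qed
  then have "prob {X. X (i, w) \<and> X (j, w) \<and> card {k \<in> ?V. X (k, w)} = r} = (\<Sum>T\<in>?\<T>. prob (?E T))"
  proof (simp only:, intro finite_measure_finite_Union fin)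
    show "disjoint_family_on ?E ?\<T>"
    proof (unfold disjoint_family_on_def, intro ballI impI)
      fix S T assume ST: "S \<in> ?\<T>" "T \<in> ?\<T>" "S \<noteq> T"
      show "?E S \<inter> ?E T = {}"
      proof (rule equals0I, elim IntE)
        fix X assume "X \<in> ?E S" "X \<in> ?E T"
        then have "S = T"
          using column[of S X] column[of T X] ST(1,2) by simp
        then show False using ST(3) by simp
      qed
    qed
  qed auto
  also have "\<dots> = (\<Sum>T\<in>?\<T>. \<integral>b. f b ^ (r + 2) * (1 - f b) ^ (n - 2 - r) \<partial>P)"
  proof (intro sum.cong refl)
    fix T assume T: "T \<in> ?\<T>"
    then have finT: "finite T" by (auto intro: finite_subset)
    have 1: "card ({i, j} \<union> T) = r + 2"
    proof -
      have "card ({i, j} \<union> T) = card {i, j} + card T"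
        using T finT by (intro card_Un_disjoint) auto
      then show ?thesis using T ij by simp
    qed
    have 2: "card (?V - T) = n - 2 - r"
      using T finT cardV by (subst card_Diff_subset) auto
    show "prob (?E T) = (\<integral>b. f b ^ (r + 2) * (1 - f b) ^ (n - 2 - r) \<partial>P)"
      by (subst prob_column[OF w]) (use T ij in \<open>auto simp: iid 1 2 simp del: Un_insert_left\<close>)
  qed
  also have "\<dots> = real ((n - 2) choose r) * (\<integral>b. f b ^ (r + 2) * (1 - f b) ^ (n - 2 - r) \<partial>P)"
    using n_subsets[of ?V r] cardV by simp
  finally show ?thesis .
qed

lemma prob_path_le:
  "prob {X. adj X i k \<and> adj X j k} \<le>
    (\<Sum>(w, w')\<in>{1..m} \<times> {1..m}. prob {X. X (i, w) \<and> X (k, w) \<and> X (j, w') \<and> X (k, w')})"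
proof -
  let ?E = "\<lambda>p X. X (i, fst p) \<and> X (k, fst p) \<and> X (j, snd p) \<and> X (k, snd p)"
  have "prob {X. adj X i k \<and> adj X j k} \<le> prob {X. \<exists>p\<in>{1..m} \<times> {1..m}. ?E p X}"
  proof (rule prob_mono_in_range)
    fix X assume "in_range X" "adj X i k \<and> adj X j k"
    then obtain w w' where "X (i, w)" "X (k, w)" "X (j, w')" "X (k, w')" "w \<in> {1..m}" "w' \<in> {1..m}"
      unfolding adj_iff in_range_def by blast
    then show "\<exists>p\<in>{1..m} \<times> {1..m}. ?E p X"
      by (intro bexI[of _ "(w, w')"]) auto
  qed
  also have "\<dots> \<le> (\<Sum>p\<in>{1..m} \<times> {1..m}. prob {X. ?E p X})"
    by (rule prob_bex_le) simp
  finally show ?thesis by (simp add: split_beta)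
qed

end

section \<open>Shared attributes, paths and wedges up to error terms\<close>

context moment_bounded_rig
begin

text \<open>Outside the error events \<open>w\<close> is the only attribute shared by i and j, and
  no detour avoids it, so the common neighbours are the other members of \<open>w\<close>. For m of
  order n and c of order 1/n the error is O(n^-2), one order below the main term.\<close>

lemma adj_common_nbrs_approx:
  assumes "i \<noteq> j"
  shows "\<bar>prob {X. adj X i j \<and> common_nbrs n X i j = r} -
      (\<Sum>w\<in>{1..m}. prob {X. X (i, w) \<and> X (j, w) \<and> card {k \<in> {1..n} - {i, j}. X (k, w)} = r})\<bar>
    \<le> m * (m * c ^ 4 + n * (m * (m * c ^ 6)))"
proof (rule prob_approx_union[where H = "\<lambda>w X.
    (\<exists>v. v \<noteq> w \<and> X (i, w) \<and> X (j, w) \<and> X (i, v) \<and> X (j, v)) \<or>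
    (\<exists>k v v'. (k \<noteq> i \<and> k \<noteq> j \<and> w \<noteq> v \<and> w \<noteq> v' \<and> v \<noteq> v') \<and>
      X (i, w) \<and> X (j, w) \<and> X (i, v) \<and> X (k, v) \<and> X (j, v') \<and> X (k, v'))"])
  let ?H = "\<lambda>w X. (\<exists>v. v \<noteq> w \<and> X (i, w) \<and> X (j, w) \<and> X (i, v) \<and> X (j, v)) \<or>
    (\<exists>k v v'. (k \<noteq> i \<and> k \<noteq> j \<and> w \<noteq> v \<and> w \<noteq> v' \<and> v \<noteq> v') \<and>
      X (i, w) \<and> X (j, w) \<and> X (i, v) \<and> X (k, v) \<and> X (j, v') \<and> X (k, v'))"
  have nbrs: "common_nbrs n X i j = card {k \<in> {1..n} - {i, j}. X (k, w)}"
    if "X (i, w)" "X (j, w)" "\<not> ?H w X" for w X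
    by (rule common_nbrs_eq_column) (use that assms in metis)+
  {
    fix X assume "in_range X" and A: "adj X i j \<and> common_nbrs n X i j = r"
    then obtain w where w: "w \<in> {1..m}" "X (i, w)" "X (j, w)"
      unfolding adj_iff in_range_def by blast
    have "(X (i, w) \<and> X (j, w) \<and> card {k \<in> {1..n} - {i, j}. X (k, w)} = r) \<or> ?H w X"
    proof (rule disjCI)
      assume "\<not> ?H w X"
      from nbrs[OF w(2,3) this] A have "card {k \<in> {1..n} - {i, j}. X (k, w)} = r"
        by (simp only:)
      with w(2,3) show "X (i, w) \<and> X (j, w) \<and> card {k \<in> {1..n} - {i, j}. X (k, w)} = r"
        by (intro conjI)
    qed
    then show "\<exists>w\<in>{1..m}. (X (i, w) \<and> X (j, w) \<and> card {k \<in> {1..n} - {i, j}. X (k, w)} = r) \<or> ?H w X"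
      using w(1) by (rule bexI[of _ w])
  next
    fix X :: "nat \<times> nat \<Rightarrow> bool" and w assume E: "X (i, w) \<and> X (j, w) \<and> card {k \<in> {1..n} - {i, j}. X (k, w)} = r"
    then have adj: "adj X i j"
      using assms unfolding adj_iff by blast
    show "(adj X i j \<and> common_nbrs n X i j = r) \<or> ?H w X"
    proof (rule disjCI)
      assume "\<not> ?H w X"
      from nbrs[OF E[THEN conjunct1] E[THEN conjunct2, THEN conjunct1] this] E adj
      show "adj X i j \<and> common_nbrs n X i j = r"
        by (simp only:)
    qed
  next
    have "prob {X. ?H w X} \<le> m * c ^ 4 + n * (m * (m * c ^ 6))" for w
      using prob_two_common_attrs_le[OF assms, of w] prob_ex_detour_le[OF assms, of w]
      by (rule order_trans[OF prob_Un_le add_mono])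
    then have "(\<Sum>w\<in>{1..m}. prob {X. ?H w X}) \<le> (\<Sum>w\<in>{1..m}. m * c ^ 4 + n * (m * (m * c ^ 6)))"
      by (intro sum_mono)
    then show "(\<Sum>w\<in>{1..m}. prob {X. ?H w X}) \<le> m * (m * c ^ 4 + n * (m * (m * c ^ 6)))"
      by simp
  }
qed auto

text \<open>This is the event of a second attribute \<open>v\<close> linking i to k. For
  \<open>w = w'\<close> it gives five incidences with \<open>v\<close> free. Otherwise
  \<open>v\<close> is \<open>w'\<close>, which gives five incidences and no free position, or a
  third attribute of k, the pattern that needs \<open>3 \<le> D k\<close>.\<close>

lemma prob_repeated_path_le:
  assumes "i \<noteq> j" "i \<noteq> k" "j \<noteq> k" "3 \<le> D k"
  shows "prob {X. X (i, w) \<and> X (k, w) \<and> X (j, w') \<and> X (k, w') \<and> (\<exists>v. v \<noteq> w \<and> X (i, v) \<and> X (k, v))}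
    \<le> (if w = w' then m * c ^ 5 else 0) + (c ^ 5 + m * c ^ 6)"
proof (cases "w = w'")
  case True
  have "prob {X. v \<noteq> w \<and> X (i, w) \<and> X (k, w) \<and> X (j, w) \<and> X (i, v) \<and> X (k, v)} \<le> c ^ 5" for v
    by (rule prob_le_power_c[of _ "[(i, w), (k, w), (j, w), (i, v), (k, v)]" _ "v \<noteq> w"])
       (use assms in \<open>auto intro!: admissibleI\<close>)
  then have "prob {X. \<exists>v. v \<noteq> w \<and> X (i, w) \<and> X (k, w) \<and> X (j, w) \<and> X (i, v) \<and> X (k, v)} \<le> m * c ^ 5"
    by (intro prob_ex_column_le) blast+
  moreover have "{X. X (i, w) \<and> X (k, w) \<and> X (j, w') \<and> X (k, w') \<and> (\<exists>v. v \<noteq> w \<and> X (i, v) \<and> X (k, v))} =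
      {X. \<exists>v. v \<noteq> w \<and> X (i, w) \<and> X (k, w) \<and> X (j, w) \<and> X (i, v) \<and> X (k, v)}"
    using True by blast
  ultimately show ?thesis using True by (simp add: add_increasing2)
next
  case False
  let ?E = "\<lambda>X. X (i, w) \<and> X (k, w) \<and> X (j, w') \<and> X (k, w') \<and> X (i, w')"
  let ?F = "\<lambda>v X. (v \<noteq> w \<and> v \<noteq> w') \<and> X (i, w) \<and> X (k, w) \<and> X (j, w') \<and> X (k, w') \<and> X (i, v) \<and> X (k, v)"
  have "prob {X. ?F v X} \<le> c ^ 6" for v
    by (rule prob_le_power_c[of _ "[(i, w), (k, w), (j, w'), (k, w'), (i, v), (k, v)]" _ "v \<noteq> w \<and> v \<noteq> w'"])
       (use assms False D_ge_2[of i] D_ge_2[of j] in \<open>auto simp: admissible_def\<close>)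
  then have F: "prob {X. \<exists>v. ?F v X} \<le> m * c ^ 6"
    by (intro prob_ex_column_le) blast+
  have E: "prob {X. ?E X} \<le> c ^ 5"
    by (rule prob_le_power_c[of _ "[(i, w), (k, w), (j, w'), (k, w'), (i, w')]" _ True])
       (use assms False in \<open>auto intro!: admissibleI\<close>)
  have "prob {X. X (i, w) \<and> X (k, w) \<and> X (j, w') \<and> X (k, w') \<and> (\<exists>v. v \<noteq> w \<and> X (i, v) \<and> X (k, v))}
      \<le> prob {X. ?E X \<or> (\<exists>v. ?F v X)}"
    by (intro finite_measure_mono) auto
  also have "\<dots> \<le> c ^ 5 + m * c ^ 6"
    using E F by (rule order_trans[OF prob_Un_le add_mono])
  finally show ?thesis using False by simp
qed

text \<open>The pairs (w, w') index the ways to realize the path. Two realizations differ in the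
  attribute linking i or in the one linking j, which is what \<open>?H1\<close> and
  \<open>?H2\<close> record. For m of order n and c of order 1/n the error stays O(1/n) after
  multiplication by n^2.\<close>

lemma path_approx:
  assumes "i \<noteq> j" "i \<noteq> k" "j \<noteq> k" "3 \<le> D k"
  shows "\<bar>prob {X. adj X i k \<and> adj X j k} -
      (\<Sum>(w, w')\<in>{1..m} \<times> {1..m}. prob {X. X (i, w) \<and> X (k, w) \<and> X (j, w') \<and> X (k, w')})\<bar>
    \<le> 4 * m\<^sup>2 * c ^ 5 + 2 * real m ^ 3 * c ^ 6"
proof -
  let ?E = "\<lambda>p X. X (i, fst p) \<and> X (k, fst p) \<and> X (j, snd p) \<and> X (k, snd p)"
  let ?H1 = "\<lambda>w w' X. X (i, w) \<and> X (k, w) \<and> X (j, w') \<and> X (k, w') \<and> (\<exists>v. v \<noteq> w \<and> X (i, v) \<and> X (k, v))"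
  let ?H2 = "\<lambda>w w' X. X (j, w') \<and> X (k, w') \<and> X (i, w) \<and> X (k, w) \<and> (\<exists>v. v \<noteq> w' \<and> X (j, v) \<and> X (k, v))"
  let ?e = "c ^ 5 + m * c ^ 6"
  have "\<bar>prob {X. adj X i k \<and> adj X j k} - (\<Sum>p\<in>{1..m} \<times> {1..m}. prob {X. ?E p X})\<bar>
    \<le> 4 * m\<^sup>2 * c ^ 5 + 2 * real m ^ 3 * c ^ 6"
  proof (rule prob_approx_union[where H = "\<lambda>p X. ?H1 (fst p) (snd p) X \<or> ?H2 (fst p) (snd p) X"])
    fix X assume "in_range X" "adj X i k \<and> adj X j k"
    then obtain w w' where "?E (w, w') X" "(w, w') \<in> {1..m} \<times> {1..m}"
      unfolding adj_iff in_range_def by (metis fst_conv mem_Sigma_iff snd_conv)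
    then show "\<exists>p\<in>{1..m} \<times> {1..m}. ?E p X \<or> ?H1 (fst p) (snd p) X \<or> ?H2 (fst p) (snd p) X"
      by blast
  next
    fix X :: "nat \<times> nat \<Rightarrow> bool" and p assume "?E p X"
    then show "(adj X i k \<and> adj X j k) \<or> ?H1 (fst p) (snd p) X \<or> ?H2 (fst p) (snd p) X"
      using assms unfolding adj_iff by blast
  next
    fix X :: "nat \<times> nat \<Rightarrow> bool" and p q :: "nat \<times> nat" assume "p \<noteq> q" "?E p X" "?E q X"
    moreover from this have "fst p \<noteq> fst q \<or> snd p \<noteq> snd q"
      by (metis prod_eqI)
    ultimately show "(?H1 (fst p) (snd p) X \<or> ?H2 (fst p) (snd p) X) \<or> (?H1 (fst q) (snd q) X \<or> ?H2 (fst q) (snd q) X)"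
      by metis
  next
    have "prob {X. ?H1 w w' X \<or> ?H2 w w' X} \<le> (if w = w' then 2 * (m * c ^ 5) else 0) + 2 * ?e" for w w'
    proof -
      have "prob {X. ?H1 w w' X} \<le> (if w = w' then m * c ^ 5 else 0) + ?e"
        using assms by (intro prob_repeated_path_le)
      moreover have "prob {X. ?H2 w w' X} \<le> (if w' = w then m * c ^ 5 else 0) + ?e"
        using assms by (intro prob_repeated_path_le) auto
      ultimately show ?thesis
        using prob_Un_le[of "?H1 w w'" "?H2 w w'"] by (auto split: if_splits)
    qed
    then have "(\<Sum>p\<in>{1..m} \<times> {1..m}. prob {X. ?H1 (fst p) (snd p) X \<or> ?H2 (fst p) (snd p) X}) \<le>
        (\<Sum>p\<in>{1..m} \<times> {1..m}. (if fst p = snd p then 2 * (m * c ^ 5) else 0) + 2 * ?e)"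
      by (intro sum_mono)
    also have "\<dots> = (\<Sum>w\<in>{1..m}. \<Sum>w'\<in>{1..m}. (if w = w' then 2 * (m * c ^ 5) else 0) + 2 * ?e)"
      by (simp add: sum.cartesian_product split_beta)
    also have "\<dots> = m * (2 * (m * c ^ 5)) + m * (m * (2 * ?e))"
      by (simp add: sum.distrib distrib_left)
    also have "\<dots> = 4 * m\<^sup>2 * c ^ 5 + 2 * real m ^ 3 * c ^ 6"
      by (simp add: power2_eq_square power3_eq_cube algebra_simps)
    finally show "(\<Sum>p\<in>{1..m} \<times> {1..m}. prob {X. ?H1 (fst p) (snd p) X \<or> ?H2 (fst p) (snd p) X}) \<le>
      4 * m\<^sup>2 * c ^ 5 + 2 * real m ^ 3 * c ^ 6" .
  qed auto
  then show ?thesis by (simp add: split_beta)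
qed

text \<open>
  Two non-adjacent vertices \<open>i\<close>, \<open>j\<close> with common neighbours \<open>k\<close>, \<open>l\<close>: the attributes shared with
  \<open>i\<close> differ from those shared with \<open>j\<close>, which leaves four configurations.
\<close>

lemma prob_two_common_neighbours_le:
  assumes d: "i \<noteq> j" "i \<noteq> k" "j \<noteq> k" "i \<noteq> l" "j \<noteq> l" "k \<noteq> l"
  shows "prob {X. (adj X i k \<and> adj X j k \<and> \<not> adj X i j) \<and> (adj X i l \<and> adj X j l \<and> \<not> adj X i j)}
    \<le> m * (m * c ^ 6) + 2 * (m * (m * (m * c ^ 7))) + m * (m * (m * (m * c ^ 8)))"
proof -
  \<comment> \<open>\<open>?E1\<close> has one attribute on either side, \<open>?E2 i j\<close> one
    at i and two at j, \<open>?E3\<close> two on either side. The mixed case occurs in both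
    orientations.\<close>
  let ?E1 = "\<lambda>w v X. w \<noteq> v \<and> X (i, w) \<and> X (k, w) \<and> X (l, w) \<and> X (j, v) \<and> X (k, v) \<and> X (l, v)"
  let ?E2 = "\<lambda>i j w v v' X. (w \<noteq> v \<and> w \<noteq> v' \<and> v \<noteq> v') \<and>
    X (i, w) \<and> X (k, w) \<and> X (l, w) \<and> X (j, v) \<and> X (k, v) \<and> X (j, v') \<and> X (l, v')"
  let ?E3 = "\<lambda>w w' v v' X. (w \<noteq> w' \<and> w \<noteq> v \<and> w \<noteq> v' \<and> w' \<noteq> v \<and> w' \<noteq> v' \<and> v \<noteq> v') \<and>
    X (i, w) \<and> X (k, w) \<and> X (i, w') \<and> X (l, w') \<and> X (j, v) \<and> X (k, v) \<and> X (j, v') \<and> X (l, v')"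
  let ?B1 = "\<lambda>X. \<exists>w v. ?E1 w v X" and ?B2 = "\<lambda>i j X. \<exists>w v v'. ?E2 i j w v v' X"
    and ?B3 = "\<lambda>X. \<exists>w w' v v'. ?E3 w w' v v' X"
  have "prob {X. ?E1 w v X} \<le> c ^ 6" for w v
    by (rule prob_le_power_c[of _ "[(i, w), (k, w), (l, w), (j, v), (k, v), (l, v)]" _ "w \<noteq> v"])
       (use d in \<open>auto intro!: admissibleI\<close>)
  then have B1: "prob {X. ?B1 X} \<le> m * (m * c ^ 6)"
    by (intro prob_ex_column_le) blast+
  have "prob {X. ?E2 i j w v v' X} \<le> c ^ 7" if "i \<noteq> j" "i \<noteq> k" "j \<noteq> k" "i \<noteq> l" "j \<noteq> l" for i j w v v'
    by (rule prob_le_power_c[of _ "[(i, w), (k, w), (l, w), (j, v), (k, v), (j, v'), (l, v')]" _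
          "w \<noteq> v \<and> w \<noteq> v' \<and> v \<noteq> v'"])
       (use d that in \<open>auto intro!: admissibleI\<close>)
  then have B2: "prob {X. ?B2 i j X} \<le> m * (m * (m * c ^ 7))"
    if "i \<noteq> j" "i \<noteq> k" "j \<noteq> k" "i \<noteq> l" "j \<noteq> l" for i j
    using that by (intro prob_ex_column_le) blast+
  have "prob {X. ?E3 w w' v v' X} \<le> c ^ 8" for w w' v v'
    by (rule prob_le_power_c[of _ "[(i, w), (k, w), (i, w'), (l, w'), (j, v), (k, v), (j, v'), (l, v')]" _
          "w \<noteq> w' \<and> w \<noteq> v \<and> w \<noteq> v' \<and> w' \<noteq> v \<and> w' \<noteq> v' \<and> v \<noteq> v'"])
       (use d in \<open>auto intro!: admissibleI\<close>)
  then have B3: "prob {X. ?B3 X} \<le> m * (m * (m * (m * c ^ 8)))"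
    by (intro prob_ex_column_le) blast+
  have "prob {X. (adj X i k \<and> adj X j k \<and> \<not> adj X i j) \<and> (adj X i l \<and> adj X j l \<and> \<not> adj X i j)} \<le>
      prob {X. ?B1 X \<or> ?B2 i j X \<or> ?B2 j i X \<or> ?B3 X}"
  proof (intro finite_measure_mono subsetI CollectI)
    fix X assume "X \<in> {X. (adj X i k \<and> adj X j k \<and> \<not> adj X i j) \<and> (adj X i l \<and> adj X j l \<and> \<not> adj X i j)}"
    then have X: "adj X i k" "adj X j k" "\<not> adj X i j" "adj X i l" "adj X j l"
      by auto
    obtain w w' v v' where w: "X (i, w)" "X (k, w)" "X (i, w')" "X (l, w')"
      "X (j, v)" "X (k, v)" "X (j, v')" "X (l, v')"
      using X(1,2,4,5) unfolding adj_iff by blast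
    have ne: "w \<noteq> v" "w \<noteq> v'" "w' \<noteq> v" "w' \<noteq> v'"
      using X(3) w d(1) unfolding adj_iff by blast+
    show "?B1 X \<or> ?B2 i j X \<or> ?B2 j i X \<or> ?B3 X"
    proof (cases "w = w'"; cases "v = v'")
      assume "w = w'" "v = v'"
      then have "?E1 w v X" using w ne by simp
      then have "?B1 X" by (intro exI)
      then show ?thesis by (rule disjI1)
    next
      assume "w = w'" "v \<noteq> v'"
      then have "?E2 i j w v v' X" using w ne by simp
      then have "?B2 i j X" by (intro exI)
      then show ?thesis by (rule disjI1[THEN disjI2])
    next
      assume "w \<noteq> w'" "v = v'"
      then have "?E2 j i v w w' X" using w ne by simp
      then have "?B2 j i X" by (intro exI)
      then show ?thesis by (rule disjI1[THEN disjI2, THEN disjI2])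
    next
      assume "w \<noteq> w'" "v \<noteq> v'"
      then have "?E3 w w' v v' X" using w ne by simp
      then have "?B3 X" by (intro exI)
      then show ?thesis by (rule disjI2[THEN disjI2, THEN disjI2])
    qed
  qed simp
  also have "\<dots> \<le> prob {X. ?B1 X} + (prob {X. ?B2 i j X} + (prob {X. ?B2 j i X} + prob {X. ?B3 X}))"
    by (intro order_trans[OF prob_Un_le add_left_mono] order_refl)
  finally show ?thesis
    using B1 B2[of i j] B2[of j i] B3 d by simp
qed

definition wedge :: "nat \<Rightarrow> nat \<Rightarrow> nat \<Rightarrow> (nat \<times> nat \<Rightarrow> bool) \<Rightarrow> bool" where
  "wedge i j k X \<longleftrightarrow> adj X i k \<and> adj X j k \<and> \<not> adj X i j"

text \<open>The second middle vertex l costs a factor n. For m of order n and c of order 1/n this is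
  O(n^-3), so a sum over k is still O(n^-2).\<close>

lemma prob_two_wedges_le:
  assumes "i \<noteq> j"
  shows "prob {X. \<exists>l. l \<noteq> k \<and> wedge i j k X \<and> wedge i j l X}
    \<le> n * (m * (m * c ^ 6) + 2 * (m * (m * (m * c ^ 7))) + m * (m * (m * (m * c ^ 8))))"
    (is "_ \<le> real n * ?K")
proof (intro prob_ex_row_le)
  fix l
  have K: "0 \<le> ?K" by simp
  show "prob {X. l \<noteq> k \<and> wedge i j k X \<and> wedge i j l X} \<le> ?K"
  proof (cases "k \<noteq> i \<and> k \<noteq> j \<and> l \<noteq> i \<and> l \<noteq> j \<and> l \<noteq> k")
    case True
    have "prob {X. l \<noteq> k \<and> wedge i j k X \<and> wedge i j l X} \<le>
        prob {X. (adj X i k \<and> adj X j k \<and> \<not> adj X i j) \<and> (adj X i l \<and> adj X j l \<and> \<not> adj X i j)}"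
      unfolding wedge_def by (intro finite_measure_mono) auto
    also have "\<dots> \<le> ?K"
      using True assms by (intro prob_two_common_neighbours_le) auto
    finally show ?thesis .
  next
    case False
    then have "{X. l \<noteq> k \<and> wedge i j k X \<and> wedge i j l X} = {}"
      by (auto simp: wedge_def adj_def)
    then show ?thesis using K by (simp only: measure_empty)
  qed
qed (auto simp: wedge_def adj_iff)

lemma not_adj_common_nbrs_1_approx:
  assumes "i \<noteq> j"
  shows "\<bar>prob {X. \<not> adj X i j \<and> common_nbrs n X i j = 1} -
      (\<Sum>k\<in>{1..n} - {i, j}. prob {X. wedge i j k X})\<bar>
    \<le> n * (n * (m * (m * c ^ 6) + 2 * (m * (m * (m * c ^ 7))) + m * (m * (m * (m * c ^ 8)))))"
    (is "_ \<le> real n * ?K")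
proof (rule prob_approx_union[where H = "\<lambda>k X. \<exists>l. l \<noteq> k \<and> wedge i j k X \<and> wedge i j l X"])
  fix X assume "in_range X" and A: "\<not> adj X i j \<and> common_nbrs n X i j = 1"
  then obtain k where "{k \<in> {1..n}. adj X i k \<and> adj X j k} = {k}"
    unfolding common_nbrs_def using card_1_singletonE by blast
  then have "k \<in> {1..n} - {i, j}" "wedge i j k X"
    using A by (auto simp: wedge_def adj_def)
  then show "\<exists>k\<in>{1..n} - {i, j}. wedge i j k X \<or> (\<exists>l. l \<noteq> k \<and> wedge i j k X \<and> wedge i j l X)"
    by blast
next
  fix X k assume k: "k \<in> {1..n} - {i, j}" and G: "wedge i j k X"
  show "(\<not> adj X i j \<and> common_nbrs n X i j = 1) \<or> (\<exists>l. l \<noteq> k \<and> wedge i j k X \<and> wedge i j l X)"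
  proof (cases "\<exists>l. l \<noteq> k \<and> wedge i j l X")
    case False
    then have "{k \<in> {1..n}. adj X i k \<and> adj X j k} = {k}"
      using k G by (auto simp: wedge_def)
    then show ?thesis
      using G by (simp add: common_nbrs_def wedge_def)
  qed (use G in blast)
next
  have K: "0 \<le> ?K" by simp
  have "(\<Sum>k\<in>{1..n} - {i, j}. prob {X. \<exists>l. l \<noteq> k \<and> wedge i j k X \<and> wedge i j l X}) \<le>
      (\<Sum>k\<in>{1..n} - {i, j}. ?K)"
    by (intro sum_mono prob_two_wedges_le assms)
  also have "\<dots> \<le> n * ?K"
  proof -
    have "card ({1..n} - {i, j}) \<le> n"
      using card_mono[of "{1..n}" "{1..n} - {i, j}"] by simp
    then show ?thesis using K by (simp add: mult_right_mono)
  qed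
  finally show "(\<Sum>k\<in>{1..n} - {i, j}. prob {X. \<exists>l. l \<noteq> k \<and> wedge i j k X \<and> wedge i j l X}) \<le> n * ?K" .
qed auto

lemma prob_not_adj_common_nbrs_ge_2_le:
  assumes "i \<noteq> j" "2 \<le> r"
  shows "prob {X. \<not> adj X i j \<and> common_nbrs n X i j = r}
    \<le> n * (n * (m * (m * c ^ 6) + 2 * (m * (m * (m * c ^ 7))) + m * (m * (m * (m * c ^ 8)))))"
    (is "_ \<le> real n * ?K")
proof -
  have "prob {X. \<not> adj X i j \<and> common_nbrs n X i j = r} \<le>
      prob {X. \<exists>k l. l \<noteq> k \<and> wedge i j k X \<and> wedge i j l X}"
  proof (intro finite_measure_mono; clarsimp)
    fix X assume X: "\<not> adj X i j" "r = common_nbrs n X i j"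
    let ?N = "{k \<in> {1..n}. adj X i k \<and> adj X j k}"
    have "\<not> card ?N \<le> 1" using assms(2) X by (simp add: common_nbrs_def)
    then obtain k l where "k \<in> ?N" "l \<in> ?N" "k \<noteq> l"
      using card_le_Suc0_iff_eq[of ?N] by (auto simp: One_nat_def)
    then show "\<exists>k l. l \<noteq> k \<and> wedge i j k X \<and> wedge i j l X"
      using X unfolding wedge_def by blast
  qed
  also have "\<dots> \<le> n * ?K"
  proof (rule prob_ex_row_le)
    show "prob {X. \<exists>l. l \<noteq> k \<and> wedge i j k X \<and> wedge i j l X} \<le> ?K" for k
      by (rule prob_two_wedges_le[OF assms(1)])
  qed (auto simp: wedge_def adj_iff)
  finally show ?thesis .
qed

end

section \<open>Asymptotics\<close>

lemma tendsto_approx: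
  fixes x y e :: "nat \<Rightarrow> real"
  assumes "\<forall>\<^sub>F n in sequentially. \<bar>x n - y n\<bar> \<le> e n" "y \<longlonglongrightarrow> L" "e \<longlonglongrightarrow> 0"
  shows "x \<longlonglongrightarrow> L"
proof -
  have "(\<lambda>n. x n - y n) \<longlonglongrightarrow> 0"
    by (rule Lim_null_comparison[OF _ assms(3)]) (use assms(1) in simp)
  from tendsto_add[OF this assms(2)] show ?thesis by simp
qed

lemma integral_pos:
  fixes h :: "real \<Rightarrow> real"
  assumes "integrable M h" "AE x in M. 0 \<le> h x" "\<not> (AE x in M. h x = 0)"
  shows "0 < (LINT x|M. h x)"
  using integral_nonneg_eq_0_iff_AE[OF assms(1,2)] integral_nonneg_AE[OF assms(2)] assms(3) by linarith

text \<open>Taking logarithms, - x - 2 x^2 \<le> ln (1 - x) \<le> - x for 0 \<le> x < 1/2, and N x^2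
  = (N x) x vanishes because N x converges while x tends to 0.\<close>

lemma tendsto_one_minus_power_exp:
  fixes x :: "nat \<Rightarrow> real" and N :: "nat \<Rightarrow> nat"
  assumes x: "\<And>n. 0 \<le> x n" "x \<longlonglongrightarrow> 0" and lim: "(\<lambda>n. real (N n) * x n) \<longlonglongrightarrow> l"
  shows "(\<lambda>n. (1 - x n) ^ N n) \<longlonglongrightarrow> exp (- l)"
proof -
  have small: "\<forall>\<^sub>F n in sequentially. x n < 1 / 2"
    using x(2) by (rule order_tendstoD) simp
  have "(\<lambda>n. real (N n) * ln (1 - x n)) \<longlonglongrightarrow> - l"
  proof (rule tendsto_sandwich)
    show "\<forall>\<^sub>F n in sequentially. real (N n) * (- x n - 2 * (x n)\<^sup>2) \<le> real (N n) * ln (1 - x n)"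
      using small by eventually_elim (intro mult_left_mono ln_one_minus_pos_lower_bound x; simp)
    show "\<forall>\<^sub>F n in sequentially. real (N n) * ln (1 - x n) \<le> - (real (N n) * x n)"
      using small
    proof eventually_elim
      case (elim n)
      then show ?case
        using mult_left_mono[OF ln_one_minus_pos_upper_bound[of "x n"], of "real (N n)"] x(1)[of n] by simp
    qed
    have "(\<lambda>n. - (real (N n) * x n) - 2 * (real (N n) * x n) * x n) \<longlonglongrightarrow> - l - 2 * l * 0"
      by (intro tendsto_intros lim x)
    then show "(\<lambda>n. real (N n) * (- x n - 2 * (x n)\<^sup>2)) \<longlonglongrightarrow> - l"
      by (simp add: algebra_simps power2_eq_square)
    show "(\<lambda>n. - (real (N n) * x n)) \<longlonglongrightarrow> - l"
      by (intro tendsto_intros lim)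
  qed
  then have "(\<lambda>n. exp (real (N n) * ln (1 - x n))) \<longlonglongrightarrow> exp (- l)"
    by (intro tendsto_intros)
  moreover have "\<forall>\<^sub>F n in sequentially. exp (real (N n) * ln (1 - x n)) = (1 - x n) ^ N n"
    using small by eventually_elim (simp add: exp_of_nat_mult)
  ultimately show ?thesis
    by (rule Lim_transform_eventually)
qed

text \<open>The binomial coefficient is a product of r factors (n - d - i) / (r - i), and each of
  them absorbs one division by n.\<close>

lemma tendsto_binomial_div_power:
  "(\<lambda>n. real ((n - d) choose r) / real n ^ r) \<longlonglongrightarrow> 1 / fact r"
proof -
  have "(\<lambda>n. \<Prod>i = 0..<r. (real (n - d - i) / real n) / real (r - i)) \<longlonglongrightarrow> (\<Prod>i = 0..<r. 1 / real (r - i))"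
  proof (intro tendsto_prod tendsto_divide tendsto_const)
    fix i assume "i \<in> {0..<r}"
    have "(\<lambda>n. 1 - real (d + i) * inverse (real n)) \<longlonglongrightarrow> 1 - real (d + i) * 0"
      by (intro tendsto_intros lim_inverse_n)
    moreover have "\<forall>\<^sub>F n in sequentially. 1 - real (d + i) * inverse (real n) = real (n - d - i) / real n"
      using eventually_ge_at_top[of "d + i + 1"] by eventually_elim (simp add: of_nat_diff field_simps)
    ultimately show "(\<lambda>n. real (n - d - i) / real n) \<longlonglongrightarrow> 1"
      by (simp add: Lim_transform_eventually)
  qed auto
  also have "(\<Prod>i = 0..<r. 1 / real (r - i)) = 1 / fact r"
    by (simp add: prod_dividef fact_prod_rev)
  finally show ?thesis
  proof (rule Lim_transform_eventually)
    show "\<forall>\<^sub>F n in sequentially. (\<Prod>i = 0..<r. (real (n - d - i) / real n) / real (r - i)) =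
        real ((n - d) choose r) / real n ^ r"
      using eventually_ge_at_top[of "d + r + 1"]
    proof eventually_elim
      case (elim n)
      then show ?case
        by (subst binomial_altdef_of_nat) (simp_all add: prod_dividef prod.distrib mult.commute)
    qed
  qed
qed

text \<open>The left side is a binomial point probability. This bounds the factor for the further
  members of an attribute uniformly in n.\<close>

lemma binomial_prob_le_1:
  fixes x :: real
  assumes "0 \<le> x" "x \<le> 1"
  shows "real (N choose r) * x ^ r * (1 - x) ^ (N - r) \<le> 1"
  using pmf_le_1[of "binomial_pmf N x" r] assms by (simp add: pmf_binomial)

lemma integrable_abs_power_le:
  fixes M :: "real measure"
  assumes "real_distribution M" "integrable M (\<lambda>x. x ^ k)" "d \<le> k"
  shows "integrable M (\<lambda>x. \<bar>x\<bar> ^ d)"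
proof -
  interpret real_distribution M by fact
  have "integrable M (\<lambda>x. 1 + \<bar>x ^ k\<bar>)"
    using assms(2) by (intro Bochner_Integration.integrable_add integrable_abs) auto
  then show ?thesis
  proof (rule Bochner_Integration.integrable_bound)
    show "AE x in M. norm (\<bar>x\<bar> ^ d) \<le> norm (1 + \<bar>x ^ k\<bar>)"
    proof (rule AE_I2)
      fix x :: real
      have "\<bar>x\<bar> ^ d \<le> 1 + \<bar>x\<bar> ^ k"
      proof (cases "\<bar>x\<bar> \<le> 1")
        case True
        then have "\<bar>x\<bar> ^ d \<le> 1" by (simp add: power_le_one)
        then show ?thesis by (simp add: add_increasing2)
      next
        case False
        then have "\<bar>x\<bar> ^ d \<le> \<bar>x\<bar> ^ k" using assms(3) by (intro power_increasing) auto
        then show ?thesis by simp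
      qed
      then show "norm (\<bar>x\<bar> ^ d) \<le> norm (1 + \<bar>x ^ k\<bar>)" by (simp add: power_abs)
    qed
  qed simp
qed

text \<open>Once s exceeds a b the truncation is inactive, so the sequence is eventually
  constant.\<close>

lemma tendsto_scaled_edge_prob:
  assumes "0 \<le> a" "0 \<le> b" "filterlim s at_top F"
  shows "((\<lambda>n. s n * edge_prob (s n) a b) \<longlongrightarrow> a * b) F"
proof (rule tendsto_eventually)
  show "\<forall>\<^sub>F n in F. s n * edge_prob (s n) a b = a * b"
    using assms(3)[unfolded filterlim_at_top, rule_format, of "max 1 (a * b)"]
  proof eventually_elim
    case (elim n)
    then have "0 \<le> a * b / s n" "a * b / s n \<le> 1"
      using assms by (auto simp: divide_le_eq)
    then show ?case using elim by (simp add: edge_prob_def)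
  qed
qed

lemma scaled_edge_prob_le:
  assumes "0 \<le> s"
  shows "s * edge_prob s a b \<le> \<bar>a\<bar> * \<bar>b\<bar>"
proof (cases "s = 0")
  case False
  then show ?thesis
    using mult_left_mono[OF edge_prob_le[OF assms, of a b] assms] by simp
qed simp

section \<open>The sequence of graphs: moments, scaling and error terms\<close>

locale rig_sequence =
  fixes P1 P2 :: "real measure" and m :: "nat \<Rightarrow> nat" and \<beta> :: real
  assumes P1: "real_distribution P1" and P1_nonneg: "AE x in P1. 0 \<le> x"
    and P2: "real_distribution P2" and P2_nonneg: "AE x in P2. 0 \<le> x"
    and P1_square: "integrable P1 (\<lambda>x. x ^ 2)"
    and P2_cube: "integrable P2 (\<lambda>x. x ^ 3)"
    and ratio: "(\<lambda>n. real (m n) / real n) \<longlonglongrightarrow> \<beta>" and \<beta>_pos: "0 < \<beta>"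
begin

sublocale P1: real_distribution P1 by (rule P1)
sublocale P2: real_distribution P2 by (rule P2)

definition a :: "nat \<Rightarrow> real" where "a k = (LINT x|P1. x ^ k)"
definition b :: "nat \<Rightarrow> real" where "b k = (LINT x|P2. x ^ k)"
definition s :: "nat \<Rightarrow> real" where "s n = sqrt (real n * real (m n))"

lemma s_nonneg [simp]: "0 \<le> s n"
  by (simp add: s_def)

lemma integrable_P1: "d \<le> 2 \<Longrightarrow> integrable P1 (\<lambda>x. \<bar>x\<bar> ^ d)"
  and integrable_P2: "d \<le> 3 \<Longrightarrow> integrable P2 (\<lambda>x. \<bar>x\<bar> ^ d)"
  using integrable_abs_power_le[OF P1 P1_square] integrable_abs_power_le[OF P2 P2_cube] by auto

lemma integrable_P1_abs [simp]: "integrable P1 (\<lambda>x. \<bar>x\<bar>)" and integrable_P1_id [simp]: "integrable P1 (\<lambda>x. x)"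
proof -
  show *: "integrable P1 (\<lambda>x. \<bar>x\<bar>)" using integrable_P1[of 1] by simp
  show "integrable P1 (\<lambda>x. x)"
    by (rule Bochner_Integration.integrable_bound[OF *]) auto
qed

lemma a_eq_abs: "a k = (\<integral>x. \<bar>x\<bar> ^ k \<partial>P1)"
  unfolding a_def using P1_nonneg by (intro integral_cong_AE) (auto elim: eventually_mono)

lemma b_eq_abs: "b k = (\<integral>x. \<bar>x\<bar> ^ k \<partial>P2)"
  unfolding b_def using P2_nonneg by (intro integral_cong_AE) (auto elim: eventually_mono)

lemma a_nonneg [simp]: "0 \<le> a k" and b_nonneg [simp]: "0 \<le> b k"
  by (simp_all add: a_eq_abs b_eq_abs)

text \<open>One constant for all moments in use. The summand 1 ensures C \<ge> 1, so that a bound by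
  C is also one by C^d for d > 0; the moments of order 0 equal 1.\<close>

definition C :: real where "C = 1 + (\<Sum>d\<le>2. a d) + (\<Sum>d\<le>3. b d)"

lemma C_ge_1: "1 \<le> C"
  unfolding C_def by (simp add: sum_nonneg add_nonneg_nonneg)

lemma a_le_C: "d \<le> 2 \<Longrightarrow> a d \<le> C ^ d" and b_le_C: "d \<le> 3 \<Longrightarrow> b d \<le> C ^ d"
proof -
  have *: "x \<le> C ^ d" if "x \<le> C" "d = 0 \<longrightarrow> x \<le> 1" for x d
    using that C_ge_1 self_le_power[of C d] by (cases "d = 0") auto
  show "a d \<le> C ^ d" if "d \<le> 2"
  proof (rule *)
    have "a d \<le> (\<Sum>d\<le>2. a d)" using that by (intro member_le_sum) auto
    then show "a d \<le> C" unfolding C_def by (simp add: sum_nonneg add_increasing2)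
  qed (simp add: a_def P1.prob_space[simplified])
  show "b d \<le> C ^ d" if "d \<le> 3"
  proof (rule *)
    have "b d \<le> (\<Sum>d\<le>3. b d)" using that by (intro member_le_sum) auto
    then show "b d \<le> C" unfolding C_def by (simp add: sum_nonneg add_increasing)
  qed (simp add: b_def P2.prob_space[simplified])
qed

lemma nn_integral_P1_le: "d \<le> 2 \<Longrightarrow> (\<integral>\<^sup>+x. ennreal (\<bar>x\<bar> ^ d) \<partial>P1) \<le> ennreal (C ^ d)"
  by (subst nn_integral_eq_integral) (auto simp: integrable_P1 a_eq_abs[symmetric] intro!: ennreal_leI a_le_C)

lemma nn_integral_P2_le: "d \<le> 3 \<Longrightarrow> (\<integral>\<^sup>+x. ennreal (\<bar>x\<bar> ^ d) \<partial>P2) \<le> ennreal (C ^ d)"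
  by (subst nn_integral_eq_integral) (auto simp: integrable_P2 b_eq_abs[symmetric] intro!: ennreal_leI b_le_C)

lemma s_eq: "s n = sqrt (real (m n) / real n) * real n"
  by (cases "n = 0") (simp_all add: s_def real_sqrt_mult real_sqrt_divide real_div_sqrt field_simps)

lemma s_at_top: "filterlim s at_top sequentially"
proof -
  have "filterlim (\<lambda>n. sqrt (real (m n) / real n) * real n) at_top sequentially"
    using ratio \<beta>_pos
    by (intro filterlim_tendsto_pos_mult_at_top[where c = "sqrt \<beta>"] tendsto_intros filterlim_real_sequentially) auto
  then show ?thesis
    by (simp add: s_eq[abs_def])
qed

lemma eventually_s_pos: "\<forall>\<^sub>F n in sequentially. 0 < s n"
  using s_at_top by (simp add: filterlim_at_top_dense)

lemma n_over_s: "(\<lambda>n. real n / s n) \<longlonglongrightarrow> 1 / sqrt \<beta>"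
proof -
  have "(\<lambda>n. 1 / sqrt (real (m n) / real n)) \<longlonglongrightarrow> 1 / sqrt \<beta>"
    using \<beta>_pos by (intro tendsto_intros ratio) auto
  then show ?thesis
    by (rule Lim_transform_eventually)
       (use eventually_gt_at_top[of 0] in eventually_elim, simp add: s_eq)
qed

lemma m_over_s: "(\<lambda>n. real (m n) / s n) \<longlonglongrightarrow> sqrt \<beta>"
proof -
  have "(\<lambda>n. (real (m n) / real n) * (real n / s n)) \<longlonglongrightarrow> \<beta> * (1 / sqrt \<beta>)"
    by (intro tendsto_intros ratio n_over_s)
  also have "\<beta> * (1 / sqrt \<beta>) = sqrt \<beta>"
    using \<beta>_pos by (simp add: real_div_sqrt)
  finally show ?thesis
    by (rule Lim_transform_eventually)
       (use eventually_gt_at_top[of 0] in eventually_elim, simp)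
qed

lemma inverse_s: "(\<lambda>n. 1 / s n) \<longlonglongrightarrow> 0"
  using tendsto_inverse_0_at_top[OF s_at_top] by (simp add: inverse_eq_divide)

text \<open>The expression is K^t (n/s)^p (m/s)^q (1/s)^(t - p - q): the first factors converge and
  the last one vanishes, its exponent being positive.\<close>

lemma error_tendsto_0:
  assumes "p + q < t"
  shows "(\<lambda>n. real n ^ p * real (m n) ^ q * (K / s n) ^ t) \<longlonglongrightarrow> 0"
proof -
  define k where "k = t - p - q"
  have t: "t = p + q + k" "0 < k" using assms by (auto simp: k_def)
  have "(\<lambda>n. K ^ t * (real n / s n) ^ p * (real (m n) / s n) ^ q * (1 / s n) ^ k)
     \<longlonglongrightarrow> K ^ t * (1 / sqrt \<beta>) ^ p * (sqrt \<beta>) ^ q * 0 ^ k"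
    by (intro tendsto_intros n_over_s m_over_s inverse_s)
  then have "(\<lambda>n. K ^ t * (real n / s n) ^ p * (real (m n) / s n) ^ q * (1 / s n) ^ k) \<longlonglongrightarrow> 0"
    using t(2) by (simp add: zero_power)
  moreover have "(\<lambda>n. K ^ t * (real n / s n) ^ p * (real (m n) / s n) ^ q * (1 / s n) ^ k) =
      (\<lambda>n. real n ^ p * real (m n) ^ q * (K / s n) ^ t)"
    by (intro ext) (simp add: t(1) power_add power_divide)
  ultimately show ?thesis by simp
qed

section \<open>Limits for a single attribute\<close>

definition f :: "nat \<Rightarrow> real \<Rightarrow> real" where
  "f n x = (\<integral>y. edge_prob (s n) y x \<partial>P1)"

lemma borel_measurable_f [measurable]: "f n \<in> borel_measurable borel"
  unfolding f_def by measurable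

lemma integrable_edge_prob: "integrable P1 (\<lambda>y. edge_prob (s n) y x)"
  by (rule P1.integrable_const_bound[where B = 1]) simp_all

lemma f_nonneg [simp]: "0 \<le> f n x"
  by (simp add: f_def)

lemma f_le_1 [simp]: "f n x \<le> 1"
  unfolding f_def by (rule P1.integral_le_const[OF integrable_edge_prob]) simp

text \<open>This majorant does not depend on n; its powers up to the third are integrable under
  \<open>P2\<close>, which makes dominated convergence available.\<close>

lemma s_f_le: "s n * f n x \<le> a 1 * \<bar>x\<bar>"
proof -
  have "s n * f n x = (\<integral>y. s n * edge_prob (s n) y x \<partial>P1)"
    by (simp add: f_def)
  also have "\<dots> \<le> (\<integral>y. \<bar>y\<bar> * \<bar>x\<bar> \<partial>P1)"
    by (intro integral_mono Bochner_Integration.integrable_mult_right integrable_edge_prob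
        Bochner_Integration.integrable_mult_left integrable_P1_abs scaled_edge_prob_le) auto
  finally show ?thesis by (simp add: a_eq_abs)
qed

lemma s_f_tendsto:
  assumes "0 \<le> x"
  shows "(\<lambda>n. s n * f n x) \<longlonglongrightarrow> a 1 * x"
proof -
  have "(\<lambda>n. \<integral>y. s n * edge_prob (s n) y x \<partial>P1) \<longlonglongrightarrow> (\<integral>y. y * x \<partial>P1)"
  proof (rule integral_dominated_convergence[where w = "\<lambda>y. \<bar>y\<bar> * \<bar>x\<bar>"])
    show "AE y in P1. (\<lambda>n. s n * edge_prob (s n) y x) \<longlonglongrightarrow> y * x"
      using P1_nonneg by eventually_elim (intro tendsto_scaled_edge_prob assms s_at_top)
    show "AE y in P1. norm (s n * edge_prob (s n) y x) \<le> \<bar>y\<bar> * \<bar>x\<bar>" for n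
      by (simp add: scaled_edge_prob_le)
  qed auto
  then show ?thesis by (simp add: f_def a_def)
qed

lemma f_tendsto_0:
  assumes "0 \<le> x"
  shows "(\<lambda>n. f n x) \<longlonglongrightarrow> 0"
proof -
  have "(\<lambda>n. (1 / s n) * (s n * f n x)) \<longlonglongrightarrow> 0 * (a 1 * x)"
    by (intro tendsto_mult inverse_s s_f_tendsto assms)
  then have "(\<lambda>n. (1 / s n) * (s n * f n x)) \<longlonglongrightarrow> 0"
    by simp
  then show ?thesis
    by (rule Lim_transform_eventually) (use eventually_s_pos in eventually_elim, simp)
qed

lemma n_f_tendsto:
  assumes "0 \<le> x"
  shows "(\<lambda>n. real n * f n x) \<longlonglongrightarrow> a 1 * x / sqrt \<beta>"
proof -
  have "(\<lambda>n. (real n / s n) * (s n * f n x)) \<longlonglongrightarrow> (1 / sqrt \<beta>) * (a 1 * x)"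
    by (intro tendsto_mult n_over_s s_f_tendsto assms)
  then have "(\<lambda>n. (real n / s n) * (s n * f n x)) \<longlonglongrightarrow> a 1 * x / sqrt \<beta>"
    by simp
  then show ?thesis
    by (rule Lim_transform_eventually) (use eventually_s_pos in eventually_elim, simp)
qed

text \<open>A Poisson probability at r with random mean a_1 B / sqrt \<beta>, for the further
  members of an attribute, weighted by (a_1 B)^2 for its two prescribed members.\<close>

definition column_limit :: "nat \<Rightarrow> real" where
  "column_limit r = (LINT x|P2. (a 1 * x)\<^sup>2 * ((a 1 * x / sqrt \<beta>) ^ r / fact r * exp (- (a 1 * x / sqrt \<beta>))))"

lemma column_tendsto:
  "(\<lambda>n. real n * (real (m n) * (real ((n - 2) choose r) * (\<integral>x. f n x ^ (r + 2) * (1 - f n x) ^ (n - 2 - r) \<partial>P2))))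
     \<longlonglongrightarrow> column_limit r"
proof -
  \<comment> \<open>As n m = s^2, the scaling is absorbed by the two prescribed memberships. What
    remains is a binomial point probability for the other n - 2 vertices.\<close>
  let ?F = "\<lambda>n x. (s n * f n x)\<^sup>2 * (real ((n - 2) choose r) * f n x ^ r * (1 - f n x) ^ (n - 2 - r))"
  have F: "real n * (real (m n) * (real ((n - 2) choose r) * (f n x ^ (r + 2) * (1 - f n x) ^ (n - 2 - r)))) = ?F n x" for n x
  proof -
    have "(s n)\<^sup>2 = real n * real (m n)" by (simp add: s_def)
    then show ?thesis by (simp add: power_mult_distrib power_add power2_eq_square[of "f n x"] ac_simps)
  qed
  have bound: "?F n x \<le> (a 1)\<^sup>2 * \<bar>x\<bar>\<^sup>2" for n x
  proof -
    have "?F n x \<le> (a 1 * \<bar>x\<bar>)\<^sup>2 * 1"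
      by (intro mult_mono power_mono s_f_le binomial_prob_le_1 mult_nonneg_nonneg) auto
    then show ?thesis by (simp add: power_mult_distrib)
  qed
  have "(\<lambda>n. \<integral>x. ?F n x \<partial>P2) \<longlonglongrightarrow> column_limit r"
    unfolding column_limit_def
  proof (rule integral_dominated_convergence[where w = "\<lambda>x. (a 1)\<^sup>2 * \<bar>x\<bar>\<^sup>2"])
    show "AE x in P2. (\<lambda>n. ?F n x) \<longlonglongrightarrow>
        (a 1 * x)\<^sup>2 * ((a 1 * x / sqrt \<beta>) ^ r / fact r * exp (- (a 1 * x / sqrt \<beta>)))"
      using P2_nonneg
    proof eventually_elim
      case (elim x)
      have "(\<lambda>n. real (n - 2 - r) / real n) \<longlonglongrightarrow> 1"
      proof -
        have "(\<lambda>n. 1 - real (2 + r) * inverse (real n)) \<longlonglongrightarrow> 1 - real (2 + r) * 0"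
          by (intro tendsto_intros lim_inverse_n)
        moreover have "\<forall>\<^sub>F n in sequentially. 1 - real (2 + r) * inverse (real n) = real (n - 2 - r) / real n"
          using eventually_ge_at_top[of "3 + r"] by eventually_elim (simp add: of_nat_diff field_simps)
        ultimately show ?thesis by (simp add: Lim_transform_eventually)
      qed
      then have "(\<lambda>n. real (n - 2 - r) / real n * (real n * f n x)) \<longlonglongrightarrow> 1 * (a 1 * x / sqrt \<beta>)"
        by (intro tendsto_mult n_f_tendsto elim)
      then have "(\<lambda>n. real (n - 2 - r) / real n * (real n * f n x)) \<longlonglongrightarrow> a 1 * x / sqrt \<beta>"
        by simp
      then have "(\<lambda>n. real (n - 2 - r) * f n x) \<longlonglongrightarrow> a 1 * x / sqrt \<beta>"
        by (rule Lim_transform_eventually)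
           (auto intro!: eventually_mono[OF eventually_gt_at_top[of 0]])
      then have E: "(\<lambda>n. (1 - f n x) ^ (n - 2 - r)) \<longlonglongrightarrow> exp (- (a 1 * x / sqrt \<beta>))"
        by (intro tendsto_one_minus_power_exp f_tendsto_0 elim) auto
      have "(\<lambda>n. real ((n - 2) choose r) / real n ^ r * (real n * f n x) ^ r) \<longlonglongrightarrow>
          1 / fact r * (a 1 * x / sqrt \<beta>) ^ r"
        by (intro tendsto_mult tendsto_power tendsto_binomial_div_power n_f_tendsto elim)
      then have "(\<lambda>n. real ((n - 2) choose r) / real n ^ r * (real n * f n x) ^ r) \<longlonglongrightarrow>
          (a 1 * x / sqrt \<beta>) ^ r / fact r"
        by simp
      then have "(\<lambda>n. real ((n - 2) choose r) * f n x ^ r) \<longlonglongrightarrow> (a 1 * x / sqrt \<beta>) ^ r / fact r"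
        by (rule Lim_transform_eventually)
           (auto intro!: eventually_mono[OF eventually_gt_at_top[of 0]] simp: power_mult_distrib)
      with E show ?case
        by (intro tendsto_mult tendsto_power s_f_tendsto elim)
    qed
    show "integrable P2 (\<lambda>x. (a 1)\<^sup>2 * \<bar>x\<bar>\<^sup>2)"
      by (intro Bochner_Integration.integrable_mult_right integrable_P2) simp
    show "AE x in P2. norm (?F n x) \<le> (a 1)\<^sup>2 * \<bar>x\<bar>\<^sup>2" for n
      using bound[of n] by (auto simp: abs_mult)
  qed measurable
  then show ?thesis
    by (simp only: F[symmetric] integral_mult_right_zero)
qed

lemma n2_m_over_s3: "(\<lambda>n. (real n)\<^sup>2 * real (m n) / s n ^ 3) \<longlonglongrightarrow> 1 / sqrt \<beta>"
proof -
  have "(\<lambda>n. (real n / s n)\<^sup>2 * (real (m n) / s n)) \<longlonglongrightarrow> (1 / sqrt \<beta>)\<^sup>2 * sqrt \<beta>"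
    by (intro tendsto_intros n_over_s m_over_s)
  also have "(1 / sqrt \<beta>)\<^sup>2 * sqrt \<beta> = 1 / sqrt \<beta>"
  proof -
    have "(1 / x)\<^sup>2 * x = 1 / x" for x :: real by (simp add: power2_eq_square)
    then show ?thesis .
  qed
  finally show ?thesis
    by (simp add: power_divide power2_eq_square power3_eq_cube)
qed

text \<open>Since n^2 m f^3 = (n^2 m / s^3) (s f)^3, the majorant is cubic, and it is integrable by
  the third moment of \<open>P2\<close>.\<close>

lemma triangle_tendsto:
  "(\<lambda>n. (real n)\<^sup>2 * (real (m n) * (\<integral>x. f n x ^ 3 \<partial>P2))) \<longlonglongrightarrow> a 1 ^ 3 * b 3 / sqrt \<beta>"
proof -
  have "(\<lambda>n. \<integral>x. (s n * f n x) ^ 3 \<partial>P2) \<longlonglongrightarrow> (\<integral>x. (a 1 * x) ^ 3 \<partial>P2)"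
  proof (rule integral_dominated_convergence[where w = "\<lambda>x. (a 1) ^ 3 * \<bar>x\<bar> ^ 3"])
    show "AE x in P2. (\<lambda>n. (s n * f n x) ^ 3) \<longlonglongrightarrow> (a 1 * x) ^ 3"
      using P2_nonneg by eventually_elim (intro tendsto_power s_f_tendsto)
    show "integrable P2 (\<lambda>x. (a 1) ^ 3 * \<bar>x\<bar> ^ 3)"
      by (intro Bochner_Integration.integrable_mult_right integrable_P2) simp
    show "AE x in P2. norm ((s n * f n x) ^ 3) \<le> (a 1) ^ 3 * \<bar>x\<bar> ^ 3" for n
      using s_f_le by (auto simp: power_mult_distrib[symmetric] abs_mult intro!: power_mono)
  qed measurable
  then have "(\<lambda>n. (real n)\<^sup>2 * real (m n) / s n ^ 3 * (\<integral>x. (s n * f n x) ^ 3 \<partial>P2)) \<longlonglongrightarrow>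
      1 / sqrt \<beta> * (\<integral>x. (a 1 * x) ^ 3 \<partial>P2)"
    by (intro tendsto_mult n2_m_over_s3)
  then have "(\<lambda>n. (real n)\<^sup>2 * real (m n) / s n ^ 3 * (\<integral>x. (s n * f n x) ^ 3 \<partial>P2)) \<longlonglongrightarrow>
      a 1 ^ 3 * b 3 / sqrt \<beta>"
    by (simp add: power_mult_distrib b_def)
  then show ?thesis
    by (rule Lim_transform_eventually)
       (use eventually_s_pos in eventually_elim, simp add: power_mult_distrib)
qed

text \<open>A family of interpretations, one for every n. The vertex order is 2 because
  \<open>P1\<close> is controlled up to its second moment.\<close>

sublocale R: moment_bounded_rig n "m n" "\<lambda>_. P1" P2 C "\<lambda>_. 2" for n
proof (intro moment_bounded_rig.intro moment_bounded_rig_axioms.intro weighted_rig.intro P1 P2)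
  show "0 \<le> C" using C_ge_1 by simp
qed (auto intro: nn_integral_P1_le nn_integral_P2_le)

lemma R_s: "R.s n = s n"
  by (simp add: R.s_def s_def)

lemma R_c: "R.c n = C\<^sup>2 / s n"
  by (simp add: R.c_def R_s)

lemma R_mean_edge_prob: "R.mean_edge_prob n i = f n"
  by (simp add: R.mean_edge_prob_def f_def R_s fun_eq_iff)

lemma rig_eq_law: "rig n (m n) P1 P2 = R.law n"
  by (simp add: rig_def R.law_def)

section \<open>Paths through a vertex of given weight\<close>

text \<open>
  Multiple paths through \<open>k\<close> involve the third moment of its weight, which need not exist under
  \<^term>\<open>P1\<close>; it does once this weight is fixed to be \<open>z\<close>.
\<close>

lemma conditioned_rig:
  "moment_bounded_rig ((\<lambda>_. P1)(k := return borel z)) P2 (C + \<bar>z\<bar>) ((\<lambda>_. 2)(k := 3))"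
proof (intro moment_bounded_rig.intro moment_bounded_rig_axioms.intro)
  show "weighted_rig ((\<lambda>_. P1)(k := return borel z)) P2"
    by (rule R.weighted_rig_point_mass)
  show "0 \<le> C + \<bar>z\<bar>" using C_ge_1 by simp
  fix i d :: nat
  \<comment> \<open>\<open>C + \<bar>z\<bar>\<close> dominates the old constant as well as the
    moments of the point mass. The latter are powers of |z|, which permits order 3 at k.\<close>
  have mono: "C ^ d \<le> (C + \<bar>z\<bar>) ^ d" "\<bar>z\<bar> ^ d \<le> (C + \<bar>z\<bar>) ^ d"
    using C_ge_1 by (auto intro!: power_mono)
  show "(2::nat) \<le> ((\<lambda>_. 2)(k := 3)) i" by simp
  show "(\<integral>\<^sup>+x. ennreal (\<bar>x\<bar> ^ d) \<partial>P2) \<le> ennreal ((C + \<bar>z\<bar>) ^ d)" if "d \<le> 3"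
    using nn_integral_P2_le[OF that] mono(1) by (meson ennreal_leI order_trans)
  show "(\<integral>\<^sup>+x. ennreal (\<bar>x\<bar> ^ d) \<partial>((\<lambda>_. P1)(k := return borel z)) i) \<le> ennreal ((C + \<bar>z\<bar>) ^ d)"
    if d: "d \<le> ((\<lambda>_. 2)(k := 3)) i"
  proof (cases "i = k")
    case True
    have "(\<integral>\<^sup>+x. ennreal (\<bar>x\<bar> ^ d) \<partial>return borel z) = ennreal (\<bar>z\<bar> ^ d)"
      by (rule nn_integral_return) simp_all
    then show ?thesis using True mono(2) by (simp add: ennreal_leI)
  next
    case False
    then show ?thesis
      using nn_integral_P1_le[of d] d mono(1) by (auto intro: order_trans ennreal_leI)
  qed
qed

text \<open>The expected number of attribute pairs (w, w') realizing a path whose middle vertex has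
  weight z: m pairs with one shared attribute and m (m - 1) pairs of different attributes, whose
  columns are independent given z.\<close>

definition path_mean :: "nat \<Rightarrow> real \<Rightarrow> real" where
  "path_mean n z = real (m n) * (LINT x|P2. f n x ^ 2 * edge_prob (s n) z x) +
     real (m n) * (real (m n) - 1) * (LINT x|P2. f n x * edge_prob (s n) z x)\<^sup>2"

text \<open>The error of \<open>path_approx\<close> for the constant
  \<open>C + \<bar>z\<bar>\<close>. Its degree in |z| is 12, so it is controlled for fixed z and not
  in the mean under \<open>P1\<close>.\<close>

definition path_error :: "nat \<Rightarrow> real \<Rightarrow> real" where
  "path_error n z = 4 * real ((m n)\<^sup>2) * ((C + \<bar>z\<bar>)\<^sup>2 / s n) ^ 5 + 2 * real (m n) ^ 3 * ((C + \<bar>z\<bar>)\<^sup>2 / s n) ^ 6"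

text \<open>The bounds are asymmetric on purpose: the union bound needs no correction, so
  \<open>path_error\<close> enters only from below, where it can be cut off.\<close>

lemma conditioned_path:
  assumes ijk: "i \<in> {1..n}" "j \<in> {1..n}" "k \<in> {1..n}" "i \<noteq> j" "i \<noteq> k" "j \<noteq> k"
    and p: "p = measure (weighted_rig.law n (m n) ((\<lambda>_. P1)(k := return borel z)) P2) {X. adj X i k \<and> adj X j k}"
  shows "p \<le> path_mean n z" "path_mean n z - path_error n z \<le> p"
proof -
  let ?Q = "(\<lambda>_. P1)(k := return borel z)"
  interpret Z: moment_bounded_rig n "m n" ?Q P2 "C + \<bar>z\<bar>" "(\<lambda>_. 2)(k := 3)"
    by (rule conditioned_rig)
  have Z_s: "Z.s = s n" by (simp add: Z.s_def s_def)
  have mean: "Z.mean_edge_prob i = f n" "Z.mean_edge_prob j = f n"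
    using ijk by (simp_all add: Z.mean_edge_prob_def f_def Z_s fun_eq_iff)
  have mean_k: "Z.mean_edge_prob k x = edge_prob (s n) z x" for x
    unfolding Z.mean_edge_prob_def fun_upd_same Z_s by (rule integral_return) simp_all
  let ?P = "\<lambda>w w'. Z.prob {X. X (i, w) \<and> X (k, w) \<and> X (j, w') \<and> X (k, w')}"
  let ?T = "LINT x|P2. f n x ^ 2 * edge_prob (s n) z x"
  let ?g = "LINT x|P2. f n x * edge_prob (s n) z x"
  have diag: "?P w w = ?T" if w: "w \<in> {1..m n}" for w
  proof -
    have "?P w w = Z.prob {X. (\<forall>l\<in>{i, j, k}. X (l, w)) \<and> (\<forall>l\<in>{}. \<not> X (l, w))}"
      by (intro arg_cong[of _ _ Z.prob]) auto
    also have "\<dots> = ?T"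
      by (subst Z.prob_column) (use ijk w in \<open>auto simp: mean mean_k power2_eq_square mult.assoc\<close>)
    finally show ?thesis .
  qed
  have off_diag: "?P w w' = ?g\<^sup>2" if "w \<in> {1..m n}" "w' \<in> {1..m n}" "w \<noteq> w'" for w w'
    using prob_two_columns_point_mass[OF Z.weighted_rig_axioms ijk that, of z]
    by (simp add: mean s_def power2_eq_square)
  \<comment> \<open>Every pair receives the off-diagonal value, and the m diagonal pairs a
    correction; this produces the factor m (m - 1).\<close>
  have "(\<Sum>(w, w')\<in>{1..m n} \<times> {1..m n}. ?P w w') =
      (\<Sum>w\<in>{1..m n}. \<Sum>w'\<in>{1..m n}. (if w = w' then ?T - ?g\<^sup>2 else 0) + ?g\<^sup>2)"
    unfolding sum.cartesian_product[symmetric]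
    by (intro sum.cong refl) (auto simp: diag off_diag)
  also have "\<dots> = path_mean n z"
    by (simp add: sum.distrib path_mean_def algebra_simps)
  finally have sum: "(\<Sum>(w, w')\<in>{1..m n} \<times> {1..m n}. ?P w w') = path_mean n z" .
  show "p \<le> path_mean n z"
    unfolding p sum[symmetric] by (rule Z.prob_path_le)
  have "Z.c = (C + \<bar>z\<bar>)\<^sup>2 / s n" by (simp add: Z.c_def Z_s)
  with Z.path_approx[of i j k] ijk show "path_mean n z - path_error n z \<le> p"
    by (simp add: p sum path_error_def abs_le_iff)
qed

lemma integrable_edge_mean [simp]:
  "integrable P2 (\<lambda>x. f n x * edge_prob (s n) z x)" "integrable P2 (\<lambda>x. f n x ^ 2 * edge_prob (s n) z x)"
  by (rule P2.integrable_const_bound[where B = 1], auto intro!: mult_le_one power_le_one)+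

lemma borel_measurable_path_mean [measurable]: "path_mean n \<in> borel_measurable borel"
  unfolding path_mean_def by measurable

lemma borel_measurable_path_error [measurable]: "path_error n \<in> borel_measurable borel"
  unfolding path_error_def by measurable

lemma m_mult_m_minus_1_nonneg: "0 \<le> real (m n) * (real (m n) - 1)"
  by (cases "m n") auto

lemma path_mean_nonneg: "0 \<le> path_mean n z"
  unfolding path_mean_def
  by (intro add_nonneg_nonneg mult_nonneg_nonneg[OF m_mult_m_minus_1_nonneg]
      mult_nonneg_nonneg[OF of_nat_0_le_iff]) auto

lemma path_error_nonneg: "0 \<le> path_error n z"
  unfolding path_error_def using C_ge_1 by simp

lemma integrable_path_mean: "integrable P1 (path_mean n)"
proof (rule P1.integrable_const_bound[where B = "real (m n) * 1 + real (m n) * (real (m n) - 1) * 1"])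
  have "path_mean n z \<le> real (m n) * 1 + real (m n) * (real (m n) - 1) * 1" for z
  proof -
    have "(LINT x|P2. f n x ^ 2 * edge_prob (s n) z x) \<le> 1"
      by (rule P2.integral_le_const) (auto intro!: mult_le_one power_le_one)
    moreover have "(LINT x|P2. f n x * edge_prob (s n) z x) \<le> 1"
      by (rule P2.integral_le_const) (auto intro!: mult_le_one)
    then have "(LINT x|P2. f n x * edge_prob (s n) z x)\<^sup>2 \<le> 1"
      by (intro power_le_one) auto
    ultimately show ?thesis
      unfolding path_mean_def using m_mult_m_minus_1_nonneg[of n]
      by (intro add_mono mult_left_mono) auto
  qed
  then show "AE z in P1. norm (path_mean n z) \<le> real (m n) * 1 + real (m n) * (real (m n) - 1) * 1"
    using path_mean_nonneg by auto
qed simp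

definition path_hi :: "nat \<Rightarrow> real" where "path_hi n = (LINT z|P1. path_mean n z)"
text \<open>The cut-off at 0 keeps the integrand between 0 and \<open>path_mean\<close>, hence
  integrable whatever the size of \<open>path_error\<close>.\<close>

definition path_lo :: "nat \<Rightarrow> real" where "path_lo n = (LINT z|P1. max 0 (path_mean n z - path_error n z))"

text \<open>The conditional bounds are integrated over A_k. They do not depend on i, j and k, a
  uniformity needed when summing over a growing number of middle vertices.\<close>

lemma prob_path_bounds:
  assumes ijk: "i \<in> {1..n}" "j \<in> {1..n}" "k \<in> {1..n}" "i \<noteq> j" "i \<noteq> k" "j \<noteq> k"
  shows "R.prob n {X. adj X i k \<and> adj X j k} \<le> path_hi n"
    and "path_lo n \<le> R.prob n {X. adj X i k \<and> adj X j k}"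
proof -
  let ?E = "{X. adj X i k \<and> adj X j k}"
  let ?L = "\<lambda>z. weighted_rig.law n (m n) ((\<lambda>_. P1)(k := return borel z)) P2"
  have em: "emeasure (?L z) ?E = ennreal (measure (?L z) ?E)" for z
  proof -
    interpret Z: moment_bounded_rig n "m n" "(\<lambda>_. P1)(k := return borel z)" P2 "C + \<bar>z\<bar>" "(\<lambda>_. 2)(k := 3)"
      by (rule conditioned_rig)
    show ?thesis by (rule Z.emeasure_eq_measure)
  qed
  have E: "ennreal (R.prob n ?E) = (\<integral>\<^sup>+z. ennreal (measure (?L z) ?E) \<partial>P1)"
    unfolding R.emeasure_eq_measure[symmetric] R.emeasure_law_condition_row[OF ijk(3)] em ..
  also have "\<dots> \<le> (\<integral>\<^sup>+z. ennreal (path_mean n z) \<partial>P1)"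
    using conditioned_path(1)[OF ijk refl] by (intro nn_integral_mono ennreal_leI)
  also have "\<dots> = ennreal (path_hi n)"
    unfolding path_hi_def by (intro nn_integral_eq_integral integrable_path_mean) (simp add: path_mean_nonneg)
  finally show "R.prob n ?E \<le> path_hi n"
    by (subst (asm) ennreal_le_iff) (auto simp: path_hi_def path_mean_nonneg)
  have "ennreal (path_lo n) = (\<integral>\<^sup>+z. ennreal (max 0 (path_mean n z - path_error n z)) \<partial>P1)"
    unfolding path_lo_def
  proof (rule nn_integral_eq_integral[symmetric])
    show "integrable P1 (\<lambda>z. max 0 (path_mean n z - path_error n z))"
      by (rule Bochner_Integration.integrable_bound[OF integrable_path_mean[of n]])
         (auto simp: path_mean_nonneg path_error_nonneg)
  qed simp
  also have "\<dots> \<le> (\<integral>\<^sup>+z. ennreal (measure (?L z) ?E) \<partial>P1)"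
    using conditioned_path(2)[OF ijk refl] by (intro nn_integral_mono ennreal_leI) auto
  finally show "path_lo n \<le> R.prob n ?E"
    unfolding E[symmetric] by (subst (asm) ennreal_le_iff) auto
qed

text \<open>Every membership probability is multiplied by s, which makes the integrals converge.
  \<open>scaled2\<close> describes an attribute joining the middle vertex to one end, its companion
  \<open>scaled3\<close> an attribute shared by all three vertices.\<close>

definition scaled2 :: "nat \<Rightarrow> real \<Rightarrow> real" where
  "scaled2 n z = (LINT x|P2. (s n * f n x) * (s n * edge_prob (s n) z x))"
definition scaled3 :: "nat \<Rightarrow> real \<Rightarrow> real" where
  "scaled3 n z = (LINT x|P2. (s n * f n x)\<^sup>2 * (s n * edge_prob (s n) z x))"

lemma path_mean_scaled:
  "(real n)\<^sup>2 * path_mean n z = (real n)\<^sup>2 * real (m n) / s n ^ 3 * scaled3 n z +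
     (real n)\<^sup>2 * (real (m n) * (real (m n) - 1)) / s n ^ 4 * (scaled2 n z)\<^sup>2"
proof (cases "s n = 0")
  case True
  \<comment> \<open>In this degenerate case both sides are 0, the right one because division by 0
    yields 0.\<close>
  then have "n = 0 \<or> m n = 0" by (simp add: s_def)
  then show ?thesis using True by (auto simp: path_mean_def)
next
  case False
  have "scaled3 n z = s n ^ 3 * (LINT x|P2. f n x ^ 2 * edge_prob (s n) z x)"
    unfolding scaled3_def integral_mult_right_zero[symmetric]
    by (intro Bochner_Integration.integral_cong refl) (simp add: power2_eq_square power3_eq_cube)
  moreover have "scaled2 n z = s n ^ 2 * (LINT x|P2. f n x * edge_prob (s n) z x)"
    unfolding scaled2_def integral_mult_right_zero[symmetric]
    by (intro Bochner_Integration.integral_cong refl) (simp add: power2_eq_square)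
  ultimately show ?thesis
    using False by (simp add: path_mean_def power_mult_distrib distrib_left power_mult[symmetric])
qed

lemma s_edge_bound: "s n * edge_prob (s n) z x \<le> \<bar>z\<bar> * \<bar>x\<bar>"
  by (rule scaled_edge_prob_le) simp

lemma scaled_integrand_le:
  "(s n * f n x) * (s n * edge_prob (s n) z x) \<le> a 1 * \<bar>z\<bar> * \<bar>x\<bar> ^ 2"
  "(s n * f n x)\<^sup>2 * (s n * edge_prob (s n) z x) \<le> (a 1)\<^sup>2 * \<bar>z\<bar> * \<bar>x\<bar> ^ 3"
proof -
  have "(s n * f n x) * (s n * edge_prob (s n) z x) \<le> (a 1 * \<bar>x\<bar>) * (\<bar>z\<bar> * \<bar>x\<bar>)"
    by (intro mult_mono s_f_le s_edge_bound) auto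
  then show "(s n * f n x) * (s n * edge_prob (s n) z x) \<le> a 1 * \<bar>z\<bar> * \<bar>x\<bar> ^ 2"
    by (simp add: power2_eq_square ac_simps)
  have "(s n * f n x)\<^sup>2 * (s n * edge_prob (s n) z x) \<le> (a 1 * \<bar>x\<bar>)\<^sup>2 * (\<bar>z\<bar> * \<bar>x\<bar>)"
    by (intro mult_mono power_mono s_f_le s_edge_bound) auto
  then show "(s n * f n x)\<^sup>2 * (s n * edge_prob (s n) z x) \<le> (a 1)\<^sup>2 * \<bar>z\<bar> * \<bar>x\<bar> ^ 3"
    by (simp add: power2_eq_square power3_eq_cube ac_simps)
qed

text \<open>The bounds are linear in |z|; as \<open>scaled2\<close> enters squared, no power of |z|
  beyond the second has to be integrated under \<open>P1\<close>.\<close>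

lemma scaled_bounds:
  "0 \<le> scaled2 n z" "scaled2 n z \<le> a 1 * \<bar>z\<bar> * b 2"
  "0 \<le> scaled3 n z" "scaled3 n z \<le> (a 1)\<^sup>2 * \<bar>z\<bar> * b 3"
proof -
  show "0 \<le> scaled2 n z" "0 \<le> scaled3 n z"
    unfolding scaled2_def scaled3_def by (intro integral_nonneg_AE AE_I2; simp)+
  have "scaled2 n z \<le> (\<integral>x. a 1 * \<bar>z\<bar> * \<bar>x\<bar> ^ 2 \<partial>P2)"
    unfolding scaled2_def
  proof (rule integral_mono)
    show "integrable P2 (\<lambda>x. a 1 * \<bar>z\<bar> * \<bar>x\<bar> ^ 2)"
      by (intro Bochner_Integration.integrable_mult_right integrable_P2) simp
    then show "integrable P2 (\<lambda>x. (s n * f n x) * (s n * edge_prob (s n) z x))"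
      by (rule Bochner_Integration.integrable_bound) (use scaled_integrand_le(1) in \<open>auto simp: abs_mult\<close>)
  qed (rule scaled_integrand_le)
  then show "scaled2 n z \<le> a 1 * \<bar>z\<bar> * b 2"
    by (simp only: integral_mult_right_zero b_eq_abs)
  have "scaled3 n z \<le> (\<integral>x. (a 1)\<^sup>2 * \<bar>z\<bar> * \<bar>x\<bar> ^ 3 \<partial>P2)"
    unfolding scaled3_def
  proof (rule integral_mono)
    show "integrable P2 (\<lambda>x. (a 1)\<^sup>2 * \<bar>z\<bar> * \<bar>x\<bar> ^ 3)"
      by (intro Bochner_Integration.integrable_mult_right integrable_P2) simp
    then show "integrable P2 (\<lambda>x. (s n * f n x)\<^sup>2 * (s n * edge_prob (s n) z x))"
      by (rule Bochner_Integration.integrable_bound) (use scaled_integrand_le(2) in \<open>auto simp: abs_mult\<close>)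
  qed (rule scaled_integrand_le)
  then show "scaled3 n z \<le> (a 1)\<^sup>2 * \<bar>z\<bar> * b 3"
    by (simp only: integral_mult_right_zero b_eq_abs)
qed

lemma scaled_tendsto:
  assumes "0 \<le> z"
  shows "(\<lambda>n. scaled2 n z) \<longlonglongrightarrow> a 1 * z * b 2" "(\<lambda>n. scaled3 n z) \<longlonglongrightarrow> (a 1)\<^sup>2 * z * b 3"
proof -
  have "(\<lambda>n. scaled2 n z) \<longlonglongrightarrow> (\<integral>x. (a 1 * x) * (z * x) \<partial>P2)"
    unfolding scaled2_def
  proof (rule integral_dominated_convergence[where w = "\<lambda>x. a 1 * \<bar>z\<bar> * \<bar>x\<bar> ^ 2"])
    show "AE x in P2. (\<lambda>n. (s n * f n x) * (s n * edge_prob (s n) z x)) \<longlonglongrightarrow> (a 1 * x) * (z * x)"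
      using P2_nonneg
      by eventually_elim (intro tendsto_mult s_f_tendsto tendsto_scaled_edge_prob assms s_at_top)
    show "integrable P2 (\<lambda>x. a 1 * \<bar>z\<bar> * \<bar>x\<bar> ^ 2)"
      by (intro Bochner_Integration.integrable_mult_right integrable_P2) simp
    show "AE x in P2. norm ((s n * f n x) * (s n * edge_prob (s n) z x)) \<le> a 1 * \<bar>z\<bar> * \<bar>x\<bar> ^ 2" for n
      using scaled_integrand_le(1) by (auto simp: abs_mult)
  qed measurable
  also have "(\<integral>x. (a 1 * x) * (z * x) \<partial>P2) = (\<integral>x. a 1 * z * x ^ 2 \<partial>P2)"
    by (intro Bochner_Integration.integral_cong refl) (simp add: power2_eq_square)
  also have "\<dots> = a 1 * z * b 2"
    by (simp only: integral_mult_right_zero b_def)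
  finally show "(\<lambda>n. scaled2 n z) \<longlonglongrightarrow> a 1 * z * b 2" .
  have "(\<lambda>n. scaled3 n z) \<longlonglongrightarrow> (\<integral>x. (a 1 * x)\<^sup>2 * (z * x) \<partial>P2)"
    unfolding scaled3_def
  proof (rule integral_dominated_convergence[where w = "\<lambda>x. (a 1)\<^sup>2 * \<bar>z\<bar> * \<bar>x\<bar> ^ 3"])
    show "AE x in P2. (\<lambda>n. (s n * f n x)\<^sup>2 * (s n * edge_prob (s n) z x)) \<longlonglongrightarrow> (a 1 * x)\<^sup>2 * (z * x)"
      using P2_nonneg
      by eventually_elim (intro tendsto_mult tendsto_power s_f_tendsto tendsto_scaled_edge_prob assms s_at_top)
    show "integrable P2 (\<lambda>x. (a 1)\<^sup>2 * \<bar>z\<bar> * \<bar>x\<bar> ^ 3)"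
      by (intro Bochner_Integration.integrable_mult_right integrable_P2) simp
    show "AE x in P2. norm ((s n * f n x)\<^sup>2 * (s n * edge_prob (s n) z x)) \<le> (a 1)\<^sup>2 * \<bar>z\<bar> * \<bar>x\<bar> ^ 3" for n
      using scaled_integrand_le(2) by (auto simp: abs_mult)
  qed measurable
  also have "(\<integral>x. (a 1 * x)\<^sup>2 * (z * x) \<partial>P2) = (\<integral>x. (a 1)\<^sup>2 * z * x ^ 3 \<partial>P2)"
    by (intro Bochner_Integration.integral_cong refl) (simp add: power2_eq_square power3_eq_cube)
  also have "\<dots> = (a 1)\<^sup>2 * z * b 3"
    by (simp only: integral_mult_right_zero b_def)
  finally show "(\<lambda>n. scaled3 n z) \<longlonglongrightarrow> (a 1)\<^sup>2 * z * b 3" .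
qed

lemma n2_m2_over_s4: "(\<lambda>n. (real n)\<^sup>2 * (real (m n) * (real (m n) - 1)) / s n ^ 4) \<longlonglongrightarrow> 1"
proof -
  have "(\<lambda>n. (real n / s n)\<^sup>2 * (real (m n) / s n) * (real (m n) / s n - 1 / s n)) \<longlonglongrightarrow>
      (1 / sqrt \<beta>)\<^sup>2 * sqrt \<beta> * (sqrt \<beta> - 0)"
    by (intro tendsto_intros n_over_s m_over_s inverse_s)
  also have "(1 / sqrt \<beta>)\<^sup>2 * sqrt \<beta> * (sqrt \<beta> - 0) = 1"
    using \<beta>_pos by (simp add: power_divide)
  finally show ?thesis
    by (simp add: power_divide diff_divide_distrib[symmetric] power2_eq_square power4_eq_xxxx ac_simps)
qed

text \<open>The first summand comes from a single attribute shared by all three vertices and equals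
  the triangle limit; the second comes from two different attributes.\<close>

definition path_limit :: real where
  "path_limit = a 1 ^ 3 * b 3 / sqrt \<beta> + (a 1)\<^sup>2 * a 2 * (b 2)\<^sup>2"

lemma path_tendsto:
  "(\<lambda>n. (real n)\<^sup>2 * path_hi n) \<longlonglongrightarrow> path_limit" "(\<lambda>n. (real n)\<^sup>2 * path_lo n) \<longlonglongrightarrow> path_limit"
proof -
  let ?U = "\<lambda>n. (real n)\<^sup>2 * real (m n) / s n ^ 3"
  let ?V = "\<lambda>n. (real n)\<^sup>2 * (real (m n) * (real (m n) - 1)) / s n ^ 4"
  let ?L = "\<lambda>z. 1 / sqrt \<beta> * ((a 1)\<^sup>2 * z * b 3) + 1 * (a 1 * z * b 2)\<^sup>2"
  \<comment> \<open>Convergent sequences are bounded, which gives bounds for the prefactors at every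
    n.\<close>
  obtain K1 K2 where K: "\<And>n. \<bar>?U n\<bar> \<le> K1" "\<And>n. \<bar>?V n\<bar> \<le> K2"
    using convergent_imp_Bseq[OF convergentI[OF n2_m_over_s3]] convergent_imp_Bseq[OF convergentI[OF n2_m2_over_s4]]
    unfolding Bseq_def real_norm_def by blast
  have K_nonneg: "0 \<le> K1" "0 \<le> K2" using K[of 0] by auto
  define w where "w z = K1 * ((a 1)\<^sup>2 * \<bar>z\<bar> * b 3) + K2 * (a 1 * \<bar>z\<bar> * b 2)\<^sup>2" for z
  have w_eq: "w = (\<lambda>z. K1 * (a 1)\<^sup>2 * b 3 * \<bar>z\<bar> ^ 1 + K2 * (a 1)\<^sup>2 * (b 2)\<^sup>2 * \<bar>z\<bar> ^ 2)"
    unfolding w_def by (intro ext) (simp add: power_mult_distrib)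
  have int_w: "integrable P1 w"
    unfolding w_eq
    by (intro Bochner_Integration.integrable_add Bochner_Integration.integrable_mult_right integrable_P1) auto
  have bound: "(real n)\<^sup>2 * path_mean n z \<le> w z" for n z
  proof -
    have "?U n * scaled3 n z \<le> K1 * ((a 1)\<^sup>2 * \<bar>z\<bar> * b 3)"
      using K(1)[of n] K_nonneg scaled_bounds(3,4)[of n z] by (intro mult_mono) linarith+
    moreover have "?V n * (scaled2 n z)\<^sup>2 \<le> K2 * (a 1 * \<bar>z\<bar> * b 2)\<^sup>2"
      using K(2)[of n] K_nonneg scaled_bounds(1,2)[of n z]
      by (intro mult_mono power_mono zero_le_power2) linarith+
    ultimately show ?thesis
      unfolding path_mean_scaled w_def by (rule add_mono)
  qed
  have lim: "(\<lambda>n. (real n)\<^sup>2 * path_mean n z) \<longlonglongrightarrow> ?L z" if "0 \<le> z" for z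
    unfolding path_mean_scaled
    by (intro tendsto_add tendsto_mult tendsto_power n2_m_over_s3 n2_m2_over_s4 scaled_tendsto that)
  have err: "(\<lambda>n. (real n)\<^sup>2 * path_error n z) \<longlonglongrightarrow> 0" for z
  proof -
    have "(\<lambda>n. 4 * (real n ^ 2 * real (m n) ^ 2 * ((C + \<bar>z\<bar>)\<^sup>2 / s n) ^ 5) +
        2 * (real n ^ 2 * real (m n) ^ 3 * ((C + \<bar>z\<bar>)\<^sup>2 / s n) ^ 6)) \<longlonglongrightarrow> 4 * 0 + 2 * 0"
      by (intro tendsto_add tendsto_mult tendsto_const error_tendsto_0) auto
    then show ?thesis by (simp add: path_error_def algebra_simps)
  qed
  have L: "(\<integral>z. ?L z \<partial>P1) = path_limit"
  proof -
    have "(\<integral>z. ?L z \<partial>P1) = (\<integral>z. ((a 1)\<^sup>2 * b 3 / sqrt \<beta>) * z + ((a 1)\<^sup>2 * (b 2)\<^sup>2) * z ^ 2 \<partial>P1)"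
      by (intro Bochner_Integration.integral_cong refl) (simp add: power_mult_distrib algebra_simps)
    also have "\<dots> = ((a 1)\<^sup>2 * b 3 / sqrt \<beta>) * (\<integral>z. z \<partial>P1) + ((a 1)\<^sup>2 * (b 2)\<^sup>2) * (\<integral>z. z ^ 2 \<partial>P1)"
      by (subst Bochner_Integration.integral_add)
         (auto intro!: Bochner_Integration.integrable_mult_right P1_square)
    also have "(\<integral>z. z \<partial>P1) = a 1" by (simp add: a_def)
    also have "(\<integral>z. z ^ 2 \<partial>P1) = a 2" by (simp add: a_def)
    finally show ?thesis by (simp add: path_limit_def power2_eq_square power3_eq_cube)
  qed
  have "(\<lambda>n. \<integral>z. (real n)\<^sup>2 * path_mean n z \<partial>P1) \<longlonglongrightarrow> (\<integral>z. ?L z \<partial>P1)"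
  proof (rule integral_dominated_convergence[OF _ _ int_w])
    show "AE z in P1. (\<lambda>n. (real n)\<^sup>2 * path_mean n z) \<longlonglongrightarrow> ?L z"
      using P1_nonneg by eventually_elim (rule lim)
    show "AE z in P1. norm ((real n)\<^sup>2 * path_mean n z) \<le> w z" for n
      using bound[of n] by (simp add: path_mean_nonneg)
  qed measurable
  then show "(\<lambda>n. (real n)\<^sup>2 * path_hi n) \<longlonglongrightarrow> path_limit"
    by (simp only: integral_mult_right_zero path_hi_def L)
  \<comment> \<open>The error only has to vanish for each fixed z; the cut integrand lies below the
    union bound, so the same majorant \<open>w\<close> serves.\<close>
  have "(\<lambda>n. \<integral>z. (real n)\<^sup>2 * max 0 (path_mean n z - path_error n z) \<partial>P1) \<longlonglongrightarrow> (\<integral>z. ?L z \<partial>P1)"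
  proof (rule integral_dominated_convergence[OF _ _ int_w])
    show "AE z in P1. (\<lambda>n. (real n)\<^sup>2 * max 0 (path_mean n z - path_error n z)) \<longlonglongrightarrow> ?L z"
      using P1_nonneg
    proof eventually_elim
      case (elim z)
      have "(\<lambda>n. max 0 ((real n)\<^sup>2 * path_mean n z - (real n)\<^sup>2 * path_error n z)) \<longlonglongrightarrow> max 0 (?L z - 0)"
        by (intro tendsto_max tendsto_diff tendsto_const lim elim err)
      \<comment> \<open>The limit is nonnegative for z \<ge> 0, so the cut-off disappears.\<close>
      moreover have "max 0 (?L z - 0) = ?L z"
        using elim \<beta>_pos by (simp add: max_def)
      moreover have "(real n)\<^sup>2 * max 0 (path_mean n z - path_error n z) =
          max 0 ((real n)\<^sup>2 * path_mean n z - (real n)\<^sup>2 * path_error n z)" for n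
        by (simp add: max_mult_distrib_left right_diff_distrib)
      ultimately show ?case by simp
    qed
    show "AE z in P1. norm ((real n)\<^sup>2 * max 0 (path_mean n z - path_error n z)) \<le> w z" for n
    proof (rule AE_I2)
      fix z
      have "(real n)\<^sup>2 * max 0 (path_mean n z - path_error n z) \<le> (real n)\<^sup>2 * path_mean n z"
        by (intro mult_left_mono) (auto simp: path_mean_nonneg path_error_nonneg)
      then show "norm ((real n)\<^sup>2 * max 0 (path_mean n z - path_error n z)) \<le> w z"
        using bound[of n z] by (simp add: abs_mult)
    qed
  qed measurable
  then show "(\<lambda>n. (real n)\<^sup>2 * path_lo n) \<longlonglongrightarrow> path_limit"
    by (simp only: integral_mult_right_zero path_lo_def L)
qed

section \<open>Limits of the scaled probabilities\<close>

lemma error_c_tendsto_0: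
  "p + q < t \<Longrightarrow> (\<lambda>n. real n ^ p * real (m n) ^ q * R.c n ^ t) \<longlonglongrightarrow> 0"
  unfolding R_c by (rule error_tendsto_0)

lemma prob_triangle_approx:
  assumes ijk: "i \<in> {1..n}" "j \<in> {1..n}" "k \<in> {1..n}" "i \<noteq> j" "i \<noteq> k" "j \<noteq> k"
  shows "\<bar>R.prob n {X. adj X i j \<and> adj X i k \<and> adj X j k} - real (m n) * (LINT x|P2. f n x ^ 3)\<bar>
    \<le> real (m n) * (real (m n) * R.c n ^ 6 + real (m n) * (real (m n) * R.c n ^ 6))"
proof -
  have "R.prob n {X. X (i, w) \<and> X (j, w) \<and> X (k, w)} = (LINT x|P2. f n x ^ 3)" if w: "w \<in> {1..m n}" for w
  proof -
    have "R.prob n {X. X (i, w) \<and> X (j, w) \<and> X (k, w)} =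
        R.prob n {X. (\<forall>l\<in>{i, j, k}. X (l, w)) \<and> (\<forall>l\<in>{}. \<not> X (l, w))}"
      by (intro arg_cong[of _ _ "R.prob n"]) auto
    also have "\<dots> = (LINT x|P2. f n x ^ 3)"
      by (subst R.prob_column) (use ijk w in \<open>auto simp: R_mean_edge_prob power3_eq_cube mult.assoc\<close>)
    finally show ?thesis .
  qed
  then have "(\<Sum>w\<in>{1..m n}. R.prob n {X. X (i, w) \<and> X (j, w) \<and> X (k, w)}) = real (m n) * (LINT x|P2. f n x ^ 3)"
    by simp
  with R.triangle_approx[OF ijk(4-6), of n] show ?thesis by simp
qed

lemma triangle_error_tendsto_0:
  "(\<lambda>n. (real n)\<^sup>2 * (real (m n) * (real (m n) * R.c n ^ 6 + real (m n) * (real (m n) * R.c n ^ 6)))) \<longlonglongrightarrow> 0"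
proof -
  have "(\<lambda>n. real n ^ 2 * real (m n) ^ 2 * R.c n ^ 6 + real n ^ 2 * real (m n) ^ 3 * R.c n ^ 6) \<longlonglongrightarrow> 0 + 0"
    by (intro tendsto_add error_c_tendsto_0) auto
  then show ?thesis
    by (simp add: power2_eq_square power3_eq_cube algebra_simps)
qed

lemma prob_triangle_tendsto:
  "(\<lambda>n. (real n)\<^sup>2 * R.prob n {X. adj X 1 2 \<and> adj X 1 3 \<and> adj X 2 3}) \<longlonglongrightarrow> a 1 ^ 3 * b 3 / sqrt \<beta>"
proof (rule tendsto_approx[OF _ triangle_tendsto triangle_error_tendsto_0])
  show "\<forall>\<^sub>F n in sequentially.
    \<bar>(real n)\<^sup>2 * R.prob n {X. adj X 1 2 \<and> adj X 1 3 \<and> adj X 2 3} - (real n)\<^sup>2 * (real (m n) * (LINT x|P2. f n x ^ 3))\<bar>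
    \<le> (real n)\<^sup>2 * (real (m n) * (real (m n) * R.c n ^ 6 + real (m n) * (real (m n) * R.c n ^ 6)))"
    using eventually_ge_at_top[of 3]
  proof eventually_elim
    case (elim n)
    then show ?case
      unfolding right_diff_distrib[symmetric] abs_mult
      by (simp only: abs_power2 abs_of_nonneg[OF zero_le_power2])
         (intro mult_left_mono prob_triangle_approx, auto)
  qed
qed

lemma prob_path_tendsto:
  "(\<lambda>n. (real n)\<^sup>2 * R.prob n {X. adj X 1 3 \<and> adj X 2 3}) \<longlonglongrightarrow> path_limit"
proof (rule tendsto_sandwich[OF _ _ path_tendsto(2,1)])
  show "\<forall>\<^sub>F n in sequentially. (real n)\<^sup>2 * path_lo n \<le> (real n)\<^sup>2 * R.prob n {X. adj X 1 3 \<and> adj X 2 3}"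
    using eventually_ge_at_top[of 3]
    by eventually_elim (intro mult_left_mono prob_path_bounds; simp)
  show "\<forall>\<^sub>F n in sequentially. (real n)\<^sup>2 * R.prob n {X. adj X 1 3 \<and> adj X 2 3} \<le> (real n)\<^sup>2 * path_hi n"
    using eventually_ge_at_top[of 3]
    by eventually_elim (intro mult_left_mono prob_path_bounds; simp)
qed

lemma prob_adj_common_nbrs_tendsto:
  "(\<lambda>n. real n * R.prob n {X. adj X 1 2 \<and> common_nbrs n X 1 2 = r}) \<longlonglongrightarrow> column_limit r"
proof (rule tendsto_approx[OF _ column_tendsto])
  let ?e = "\<lambda>n. real (m n) * (real (m n) * R.c n ^ 4 + real n * (real (m n) * (real (m n) * R.c n ^ 6)))"
  show "\<forall>\<^sub>F n in sequentially.
    \<bar>real n * R.prob n {X. adj X 1 2 \<and> common_nbrs n X 1 2 = r} -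
      real n * (real (m n) * (real ((n - 2) choose r) * (LINT x|P2. f n x ^ (r + 2) * (1 - f n x) ^ (n - 2 - r))))\<bar>
    \<le> real n * ?e n"
    using eventually_ge_at_top[of 2]
  proof eventually_elim
    case (elim n)
    have "R.prob n {X. X (1, w) \<and> X (2, w) \<and> card {k \<in> {1..n} - {1, 2}. X (k, w)} = r} =
      real ((n - 2) choose r) * (LINT x|P2. f n x ^ (r + 2) * (1 - f n x) ^ (n - 2 - r))" if "w \<in> {1..m n}" for w
      by (rule R.prob_column_card[OF that]) (use elim in \<open>auto simp: R_mean_edge_prob\<close>)
    then have "(\<Sum>w\<in>{1..m n}. R.prob n {X. X (1, w) \<and> X (2, w) \<and> card {k \<in> {1..n} - {1, 2}. X (k, w)} = r}) =
      real (m n) * (real ((n - 2) choose r) * (LINT x|P2. f n x ^ (r + 2) * (1 - f n x) ^ (n - 2 - r)))"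
      by simp
    with R.adj_common_nbrs_approx[of 1 2 n r]
    have "\<bar>R.prob n {X. adj X 1 2 \<and> common_nbrs n X 1 2 = r} -
      real (m n) * (real ((n - 2) choose r) * (LINT x|P2. f n x ^ (r + 2) * (1 - f n x) ^ (n - 2 - r)))\<bar> \<le> ?e n"
      by simp
    then show ?case
      unfolding right_diff_distrib[symmetric] abs_mult abs_of_nat by (rule mult_left_mono) simp
  qed
  have "(\<lambda>n. real n ^ 1 * real (m n) ^ 2 * R.c n ^ 4 + real n ^ 2 * real (m n) ^ 3 * R.c n ^ 6) \<longlonglongrightarrow> 0 + 0"
    by (intro tendsto_add error_c_tendsto_0) auto
  then show "(\<lambda>n. real n * ?e n) \<longlonglongrightarrow> 0"
    by (simp add: power2_eq_square power3_eq_cube algebra_simps)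
qed

lemma two_wedges_error_tendsto_0:
  "(\<lambda>n. real n * (real n * (real n * (real (m n) * (real (m n) * R.c n ^ 6) +
     2 * (real (m n) * (real (m n) * (real (m n) * R.c n ^ 7))) +
     real (m n) * (real (m n) * (real (m n) * (real (m n) * R.c n ^ 8))))))) \<longlonglongrightarrow> 0"
proof -
  have "(\<lambda>n. real n ^ 3 * real (m n) ^ 2 * R.c n ^ 6 + 2 * (real n ^ 3 * real (m n) ^ 3 * R.c n ^ 7) +
      real n ^ 3 * real (m n) ^ 4 * R.c n ^ 8) \<longlonglongrightarrow> 0 + 2 * 0 + 0"
    by (intro tendsto_add tendsto_mult tendsto_const error_c_tendsto_0) auto
  then show ?thesis
    by (simp add: power2_eq_square power3_eq_cube power4_eq_xxxx algebra_simps)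
qed

lemma prob_not_adj_common_nbrs_ge_2_tendsto:
  assumes "2 \<le> r"
  shows "(\<lambda>n. real n * R.prob n {X. \<not> adj X 1 2 \<and> common_nbrs n X 1 2 = r}) \<longlonglongrightarrow> 0"
proof (rule Lim_null_comparison[OF _ two_wedges_error_tendsto_0], intro always_eventually allI)
  fix n
  show "norm (real n * R.prob n {X. \<not> adj X 1 2 \<and> common_nbrs n X 1 2 = r}) \<le>
    real n * (real n * (real n * (real (m n) * (real (m n) * R.c n ^ 6) +
     2 * (real (m n) * (real (m n) * (real (m n) * R.c n ^ 7))) +
     real (m n) * (real (m n) * (real (m n) * (real (m n) * R.c n ^ 8))))))"
    using mult_left_mono[OF R.prob_not_adj_common_nbrs_ge_2_le[of 1 2 r n], of "real n"] assms
    by (simp add: abs_mult)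
qed

lemma prob_wedge:
  "R.prob n {X. R.wedge i j k X} =
    R.prob n {X. adj X i k \<and> adj X j k} - R.prob n {X. adj X i j \<and> adj X i k \<and> adj X j k}"
proof -
  have "{X. R.wedge i j k X} = {X. adj X i k \<and> adj X j k} - {X. adj X i j \<and> adj X i k \<and> adj X j k}"
    by (auto simp: R.wedge_def)
  then show ?thesis
    by (simp only:) (subst R.finite_measure_Diff, auto)
qed

lemma card_other_vertices: "card ({1..n} - {1, 2 :: nat}) = n - 2" if "2 \<le> n"
  using that by (subst card_Diff_subset) auto

text \<open>Each of the n - 2 middle vertices contributes path minus triangle, with bounds uniform
  in the vertex. The triangle limit cancels the first summand of \<open>path_limit\<close>, and the
  paths with two different attributes remain.\<close>

lemma prob_not_adj_common_nbrs_1_tendsto: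
  "(\<lambda>n. real n * R.prob n {X. \<not> adj X 1 2 \<and> common_nbrs n X 1 2 = 1}) \<longlonglongrightarrow> (a 1)\<^sup>2 * a 2 * (b 2)\<^sup>2"
proof (rule tendsto_approx[OF _ _ two_wedges_error_tendsto_0])
  let ?W = "\<lambda>n. \<Sum>k\<in>{1..n} - {1, 2}. R.prob n {X. R.wedge 1 2 k X}"
  let ?t = "\<lambda>n. real (m n) * (LINT x|P2. f n x ^ 3)"
  let ?e = "\<lambda>n. real (m n) * (real (m n) * R.c n ^ 6 + real (m n) * (real (m n) * R.c n ^ 6))"
  show "\<forall>\<^sub>F n in sequentially.
    \<bar>real n * R.prob n {X. \<not> adj X 1 2 \<and> common_nbrs n X 1 2 = 1} - real n * ?W n\<bar> \<le>
    real n * (real n * (real n * (real (m n) * (real (m n) * R.c n ^ 6) +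
     2 * (real (m n) * (real (m n) * (real (m n) * R.c n ^ 7))) +
     real (m n) * (real (m n) * (real (m n) * (real (m n) * R.c n ^ 8))))))"
    unfolding right_diff_distrib[symmetric] abs_mult abs_of_nat
    by (intro always_eventually allI mult_left_mono R.not_adj_common_nbrs_1_approx) auto
  have frac: "(\<lambda>n. real (n - 2) / real n) \<longlonglongrightarrow> 1"
    using tendsto_binomial_div_power[of 2 1] by (simp add: choose_one)
  \<comment> \<open>The sign d = -1 or d = 1 of the triangle error serves the lower and the upper
    bound at once.\<close>
  have lim: "(\<lambda>n. real (n - 2) / real n * ((real n)\<^sup>2 * h n - (real n)\<^sup>2 * ?t n + d * ((real n)\<^sup>2 * ?e n)))
      \<longlonglongrightarrow> (a 1)\<^sup>2 * a 2 * (b 2)\<^sup>2" if "(\<lambda>n. (real n)\<^sup>2 * h n) \<longlonglongrightarrow> path_limit" for h and d :: real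
  proof -
    have "(\<lambda>n. real (n - 2) / real n * ((real n)\<^sup>2 * h n - (real n)\<^sup>2 * ?t n + d * ((real n)\<^sup>2 * ?e n)))
      \<longlonglongrightarrow> 1 * (path_limit - a 1 ^ 3 * b 3 / sqrt \<beta> + d * 0)"
      by (intro tendsto_mult tendsto_add tendsto_diff tendsto_const frac that triangle_tendsto triangle_error_tendsto_0)
    then show ?thesis by (simp add: path_limit_def)
  qed
  have scale: "real (n - 2) / real n * ((real n)\<^sup>2 * x - (real n)\<^sup>2 * y + d * ((real n)\<^sup>2 * z)) =
      real n * (real (n - 2) * (x - y + d * z))" for n and d x y z :: real
    by (cases "n = 0") (simp_all add: power2_eq_square algebra_simps)
  have wedge: "path_lo n - ?t n + (- 1) * ?e n \<le> R.prob n {X. R.wedge 1 2 k X}"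
      "R.prob n {X. R.wedge 1 2 k X} \<le> path_hi n - ?t n + 1 * ?e n"
    if "k \<in> {1..n} - {1, 2}" "2 \<le> n" for n k
    unfolding prob_wedge
    using prob_triangle_approx[of 1 n 2 k] prob_path_bounds[of 1 n 2 k] that by auto
  show "(\<lambda>n. real n * ?W n) \<longlonglongrightarrow> (a 1)\<^sup>2 * a 2 * (b 2)\<^sup>2"
  proof (rule tendsto_sandwich[OF _ _ lim[OF path_tendsto(2), of "- 1"] lim[OF path_tendsto(1), of 1]])
    show "\<forall>\<^sub>F n in sequentially. real (n - 2) / real n *
        ((real n)\<^sup>2 * path_lo n - (real n)\<^sup>2 * ?t n + - 1 * ((real n)\<^sup>2 * ?e n)) \<le> real n * ?W n"
      using eventually_ge_at_top[of 2]
    proof eventually_elim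
      case (elim n)
      have "real (card ({1..n} - {1, 2 :: nat})) * (path_lo n - ?t n + - 1 * ?e n) \<le> ?W n"
        using wedge(1) elim by (intro sum_bounded_below) auto
      then show ?case
        unfolding scale card_other_vertices[OF elim] by (intro mult_left_mono) auto
    qed
    show "\<forall>\<^sub>F n in sequentially. real n * ?W n \<le> real (n - 2) / real n *
        ((real n)\<^sup>2 * path_hi n - (real n)\<^sup>2 * ?t n + 1 * ((real n)\<^sup>2 * ?e n))"
      using eventually_ge_at_top[of 2]
    proof eventually_elim
      case (elim n)
      have "?W n \<le> real (card ({1..n} - {1, 2 :: nat})) * (path_hi n - ?t n + 1 * ?e n)"
        using wedge(2) elim by (intro sum_bounded_above) auto
      then show ?case
        unfolding scale card_other_vertices[OF elim] by (intro mult_left_mono) auto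
    qed
  qed
qed

text \<open>For r = 0 the conditioning event is asymptotically certain, so the numerator alone
  decides the rate of cl(0).\<close>

lemma prob_common_nbrs_0_tendsto:
  "(\<lambda>n. R.prob n {X. common_nbrs n X 1 2 = 0}) \<longlonglongrightarrow> 1"
proof (rule tendsto_approx[where y = "\<lambda>_. 1"])
  let ?e = "\<lambda>n. real n * (real (m n) * R.c n ^ 3) + real n * (real (m n) * (real (m n) * R.c n ^ 4))"
  have "(\<lambda>n. real n ^ 1 * real (m n) ^ 1 * R.c n ^ 3 + real n ^ 1 * real (m n) ^ 2 * R.c n ^ 4) \<longlonglongrightarrow> 0 + 0"
    by (intro tendsto_add error_c_tendsto_0) auto
  then show "?e \<longlonglongrightarrow> 0"
    by (simp add: power2_eq_square algebra_simps)
  show "\<forall>\<^sub>F n in sequentially. \<bar>R.prob n {X. common_nbrs n X 1 2 = 0} - 1\<bar> \<le> ?e n"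
  proof (intro always_eventually allI)
    fix n
    have "R.prob n (- {X. common_nbrs n X 1 2 = 0}) \<le> R.prob n {X. \<exists>k. adj X 1 k \<and> adj X 2 k}"
      by (intro R.finite_measure_mono) (auto simp: common_nbrs_def)
    also have "\<dots> \<le> ?e n"
      by (rule R.prob_common_neighbour_le) simp
    finally show "\<bar>R.prob n {X. common_nbrs n X 1 2 = 0} - 1\<bar> \<le> ?e n"
      using R.prob_compl[of "{X. common_nbrs n X 1 2 = 0}" n] by (simp add: Compl_eq_Diff_UNIV)
  qed
qed auto

section \<open>Clustering quantities as quotients\<close>

lemma clustering_coeff_eq:
  "clustering_coeff n (m n) P1 P2 =
    R.prob n {X. adj X 1 2 \<and> adj X 1 3 \<and> adj X 2 3} / R.prob n {X. adj X 1 3 \<and> adj X 2 3}"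
  by (simp add: clustering_coeff_def cond_prob_def rig_eq_law)

lemma clustering_fun_eq:
  "clustering_fun n (m n) P1 P2 r =
    R.prob n {X. adj X 1 2 \<and> common_nbrs n X 1 2 = r} / R.prob n {X. common_nbrs n X 1 2 = r}"
  by (simp add: clustering_fun_def cond_prob_def rig_eq_law)

lemma prob_common_nbrs_eq:
  "R.prob n {X. common_nbrs n X 1 2 = r} =
    R.prob n {X. adj X 1 2 \<and> common_nbrs n X 1 2 = r} + R.prob n {X. \<not> adj X 1 2 \<and> common_nbrs n X 1 2 = r}"
  by (subst R.finite_measure_Union[symmetric]) (auto intro!: arg_cong[of _ _ "R.prob n"])

text \<open>Numerator and denominator are both multiplied by n. The limit \<open>q\<close> of the
  non-adjacent part is a_1^2 a_2 b_2^2 for r = 1; for r \<ge> 2 it is 0, and the quotient tends to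
  1.\<close>

lemma clustering_fun_tendsto:
  assumes "(\<lambda>n. real n * R.prob n {X. \<not> adj X 1 2 \<and> common_nbrs n X 1 2 = r}) \<longlonglongrightarrow> q"
    and "column_limit r + q \<noteq> 0"
  shows "(\<lambda>n. clustering_fun n (m n) P1 P2 r) \<longlonglongrightarrow> column_limit r / (column_limit r + q)"
proof -
  let ?p = "\<lambda>n. R.prob n {X. adj X 1 2 \<and> common_nbrs n X 1 2 = r}"
  let ?q = "\<lambda>n. R.prob n {X. \<not> adj X 1 2 \<and> common_nbrs n X 1 2 = r}"
  have "(\<lambda>n. (real n * ?p n) / (real n * ?p n + real n * ?q n)) \<longlonglongrightarrow> column_limit r / (column_limit r + q)"
    by (intro tendsto_divide tendsto_add prob_adj_common_nbrs_tendsto assms)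
  then show ?thesis
  proof (rule Lim_transform_eventually)
    show "\<forall>\<^sub>F n in sequentially. (real n * ?p n) / (real n * ?p n + real n * ?q n) = clustering_fun n (m n) P1 P2 r"
      using eventually_gt_at_top[of 0]
      by eventually_elim (simp add: clustering_fun_eq prob_common_nbrs_eq distrib_left[symmetric])
  qed
qed

lemma clustering_coeff_tendsto:
  assumes "path_limit \<noteq> 0"
  shows "(\<lambda>n. clustering_coeff n (m n) P1 P2) \<longlonglongrightarrow> (a 1 ^ 3 * b 3 / sqrt \<beta>) / path_limit"
proof -
  let ?p = "\<lambda>n. R.prob n {X. adj X 1 2 \<and> adj X 1 3 \<and> adj X 2 3}"
  let ?q = "\<lambda>n. R.prob n {X. adj X 1 3 \<and> adj X 2 3}"
  have "(\<lambda>n. ((real n)\<^sup>2 * ?p n) / ((real n)\<^sup>2 * ?q n)) \<longlonglongrightarrow> (a 1 ^ 3 * b 3 / sqrt \<beta>) / path_limit"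
    by (intro tendsto_divide prob_triangle_tendsto prob_path_tendsto assms)
  then show ?thesis
    by (rule Lim_transform_eventually)
       (use eventually_gt_at_top[of 0] in eventually_elim, simp add: clustering_coeff_eq)
qed

section \<open>Identification of the constants and their positivity\<close>

definition bstar :: "nat \<Rightarrow> real" where
  "bstar k = (LINT x|P2. x ^ k * exp (- (a 1 * x / sqrt \<beta>)))"

lemma column_limit_0: "column_limit 0 = (a 1)\<^sup>2 * bstar 2"
proof -
  have "column_limit 0 = (LINT x|P2. (a 1)\<^sup>2 * (x ^ 2 * exp (- (a 1 * x / sqrt \<beta>))))"
    unfolding column_limit_def
    by (intro Bochner_Integration.integral_cong refl) (simp add: power_mult_distrib)
  then show ?thesis by (simp only: integral_mult_right_zero bstar_def)
qed

lemma column_limit_1: "column_limit 1 = a 1 ^ 3 * bstar 3 / sqrt \<beta>"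
proof -
  have "column_limit 1 = (LINT x|P2. a 1 ^ 3 / sqrt \<beta> * (x ^ 3 * exp (- (a 1 * x / sqrt \<beta>))))"
    unfolding column_limit_def
    by (intro Bochner_Integration.integral_cong refl) (simp add: power2_eq_square power3_eq_cube)
  then have "column_limit 1 = a 1 ^ 3 / sqrt \<beta> * bstar 3"
    by (simp only: integral_mult_right_zero bstar_def)
  then show ?thesis by simp
qed

text \<open>A positive second moment excludes the point mass at 0, so the nonnegative weight has a
  positive mean.\<close>

lemma a_1_pos: "0 < a 1" if "0 < a 2"
proof -
  have "\<not> (AE x in P1. x = 0)"
  proof
    assume "AE x in P1. x = 0"
    then have "a 2 = (LINT x|P1. 0)"
      unfolding a_def by (intro integral_cong_AE) (auto elim: eventually_mono)
    then show False using that by simp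
  qed
  then have "0 < (LINT x|P1. x)"
    by (intro integral_pos) (simp_all add: P1_nonneg)
  then show ?thesis by (simp add: a_def)
qed

lemma not_AE_P2_0: "\<not> (AE x in P2. x = 0)" if "0 < b 3"
proof
  assume "AE x in P2. x = 0"
  then have "b 3 = (LINT x|P2. 0)"
    unfolding b_def by (intro integral_cong_AE) (auto elim: eventually_mono)
  then show False using that by simp
qed

lemma b_2_pos: "0 < b 2" if "0 < b 3"
proof -
  have "\<not> (AE x in P2. \<bar>x\<bar> ^ 2 = 0)"
    using not_AE_P2_0[OF that] by simp
  then have "0 < (LINT x|P2. \<bar>x\<bar> ^ 2)"
    by (intro integral_pos integrable_P2) simp_all
  then show ?thesis by (simp add: b_eq_abs)
qed

text \<open>The integrand is positive for x > 0, so a vanishing integral would concentrate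
  \<open>P2\<close> at 0, against b_3 > 0.\<close>

lemma column_limit_pos:
  assumes "0 < a 2" "0 < b 3"
  shows "0 < column_limit r"
proof -
  note a1 = a_1_pos[OF assms(1)]
  let ?h = "\<lambda>x. (a 1 * x)\<^sup>2 * ((a 1 * x / sqrt \<beta>) ^ r / fact r * exp (- (a 1 * x / sqrt \<beta>)))"
  \<comment> \<open>A Poisson point probability bounds this factor by 1. Integrability has to be
    shown because the Bochner integral of a non-integrable function is 0 by convention.\<close>
  have poisson: "y ^ r / fact r * exp (- y) \<le> 1" if "0 < y" for y :: real
    using pmf_le_1[of "poisson_pmf y" r] that by simp
  have pos: "0 < ?h x" if "0 < x" for x
    using that a1 \<beta>_pos by simp
  have le: "?h x \<le> (a 1)\<^sup>2 * \<bar>x\<bar> ^ 2" if "0 < x" for x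
  proof -
    have "?h x \<le> (a 1 * x)\<^sup>2 * 1"
      using poisson[of "a 1 * x / sqrt \<beta>"] that a1 \<beta>_pos by (intro mult_left_mono) auto
    then show ?thesis by (simp add: power_mult_distrib)
  qed
  have h0: "?h 0 = 0" by simp
  show ?thesis
    unfolding column_limit_def
  proof (rule integral_pos)
    have "integrable P2 (\<lambda>x. (a 1)\<^sup>2 * \<bar>x\<bar> ^ 2)"
      by (intro Bochner_Integration.integrable_mult_right integrable_P2) simp
    then show "integrable P2 ?h"
    proof (rule Bochner_Integration.integrable_bound)
      show "AE x in P2. norm (?h x) \<le> norm ((a 1)\<^sup>2 * \<bar>x\<bar> ^ 2)"
        using P2_nonneg
      proof eventually_elim
        case (elim x)
        then show ?case
          using pos[of x] le[of x] h0 by (cases "x = 0") auto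
      qed
    qed measurable
    show "AE x in P2. 0 \<le> ?h x"
      using P2_nonneg
    proof eventually_elim
      case (elim x)
      then show ?case using pos[of x] h0 by (cases "x = 0") auto
    qed
    show "\<not> (AE x in P2. ?h x = 0)"
    proof
      assume "AE x in P2. ?h x = 0"
      with P2_nonneg have "AE x in P2. x = 0"
      proof eventually_elim
        case (elim x)
        show ?case
        proof (cases "0 < x")
          case True
          then show ?thesis using pos[OF True] elim by linarith
        next
          case False
          then show ?thesis using elim by linarith
        qed
      qed
      then show False using not_AE_P2_0[OF assms(2)] by contradiction
    qed
  qed
qed

text \<open>Since a_1^2 b_2^* is the positive constant \<open>column_limit 0\<close>, the quotient
  by the claimed rate can be formed and its limit read off.\<close>

lemma clustering_fun_0:
  assumes "0 < a 2" "0 < b 3"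
  shows "(\<lambda>n. clustering_fun n (m n) P1 P2 0) \<sim>[sequentially] (\<lambda>n. (a 1)\<^sup>2 * bstar 2 / real n)"
proof (rule asymp_equivI')
  let ?p = "\<lambda>n. R.prob n {X. adj X 1 2 \<and> common_nbrs n X 1 2 = 0}"
  let ?q = "\<lambda>n. R.prob n {X. common_nbrs n X 1 2 = 0}"
  have K: "column_limit 0 \<noteq> 0" using column_limit_pos[OF assms] by (metis less_irrefl)
  have "(\<lambda>n. (real n * ?p n) / ?q n / column_limit 0) \<longlonglongrightarrow> column_limit 0 / 1 / column_limit 0"
    by (intro tendsto_divide prob_adj_common_nbrs_tendsto prob_common_nbrs_0_tendsto tendsto_const K) simp
  then show "(\<lambda>n. clustering_fun n (m n) P1 P2 0 / ((a 1)\<^sup>2 * bstar 2 / real n)) \<longlonglongrightarrow> 1"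
    using K by (simp add: clustering_fun_eq column_limit_0[symmetric] ac_simps)
qed

lemma clustering_limits:
  assumes "0 < a 2" "0 < b 3"
  defines "\<kappa> \<equiv> a 1 * inverse (a 2) * inverse ((b 2)\<^sup>2)"
  shows "(\<lambda>n. clustering_coeff n (m n) P1 P2) \<longlonglongrightarrow> b 3 * \<kappa> / (b 3 * \<kappa> + sqrt \<beta>)"
    and "(\<lambda>n. clustering_fun n (m n) P1 P2 1) \<sim>[sequentially] (\<lambda>n. bstar 3 * \<kappa> / (bstar 3 * \<kappa> + sqrt \<beta>))"
    and "2 \<le> r \<Longrightarrow> (\<lambda>n. clustering_fun n (m n) P1 P2 r) \<longlonglongrightarrow> 1"
proof -
  have pos: "0 < a 1" "0 < a 2" "0 < b 2" "0 < b 3" "0 < sqrt \<beta>"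
    using assms a_1_pos b_2_pos \<beta>_pos by auto
  \<comment> \<open>Both fractions have this form: y = b_3 for the clustering coefficient and y =
    b_3^* for cl(1), with the same contribution of two-attribute paths.\<close>
  have ratio: "(a 1 ^ 3 * y / sqrt \<beta>) / (a 1 ^ 3 * y / sqrt \<beta> + (a 1)\<^sup>2 * a 2 * (b 2)\<^sup>2) =
      y * \<kappa> / (y * \<kappa> + sqrt \<beta>)" if "0 < y" for y
  proof -
    define u v w where "u = a 1" and "v = a 2 * (b 2)\<^sup>2" and "w = sqrt \<beta>"
    have uvw: "0 < u" "0 < v" "0 < w" using pos by (simp_all add: u_def v_def w_def)
    have \<kappa>: "\<kappa> = u / v" by (simp add: \<kappa>_def u_def v_def divide_inverse)
    have 1: "0 < y * u + v * w" using uvw that by (simp add: add_pos_pos)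
    have "(u ^ 3 * y / w) / (u ^ 3 * y / w + u\<^sup>2 * v) = (y * u) / (y * u + v * w)"
    proof -
      \<comment> \<open>The common factor u^2 / w of numerator and denominator is split off.\<close>
      have "u ^ 3 * y / w = u\<^sup>2 / w * (y * u)" "u ^ 3 * y / w + u\<^sup>2 * v = u\<^sup>2 / w * (y * u + v * w)"
        using uvw by (simp_all add: field_simps power2_eq_square power3_eq_cube)
      then show ?thesis using uvw by (simp only:) (rule nonzero_mult_divide_mult_cancel_left, simp)
    qed
    also have "\<dots> = y * (u / v) / (y * (u / v) + w)"
    proof -
      have "y * (u / v) + w = (y * u + v * w) / v" using uvw by (simp add: field_simps)
      then show ?thesis using uvw by simp
    qed
    finally show ?thesis
      by (simp add: \<kappa> u_def v_def w_def mult.assoc)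
  qed
  have path: "0 < path_limit"
    using pos by (simp add: path_limit_def add_pos_pos)
  show "(\<lambda>n. clustering_coeff n (m n) P1 P2) \<longlonglongrightarrow> b 3 * \<kappa> / (b 3 * \<kappa> + sqrt \<beta>)"
    using clustering_coeff_tendsto path ratio[OF pos(4)] by (simp add: path_limit_def)
  have c1: "0 < column_limit 1" by (rule column_limit_pos[OF assms(1,2)])
  then have b3: "0 < bstar 3"
    using pos by (simp add: column_limit_1 zero_less_divide_iff zero_less_mult_iff)
  have "0 < \<kappa>" using pos by (simp add: \<kappa>_def)
  \<comment> \<open>Convergence to a constant yields asymptotic equivalence because the constant is
    not 0.\<close>
  then have lim_pos: "bstar 3 * \<kappa> / (bstar 3 * \<kappa> + sqrt \<beta>) \<noteq> 0"
    using b3 pos by (simp add: add_pos_pos less_imp_neq[symmetric])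
  have "column_limit 1 + (a 1)\<^sup>2 * a 2 * (b 2)\<^sup>2 \<noteq> 0"
    using c1 pos by (intro less_imp_neq[symmetric] add_pos_pos) auto
  from clustering_fun_tendsto[OF prob_not_adj_common_nbrs_1_tendsto this]
  have "(\<lambda>n. clustering_fun n (m n) P1 P2 1) \<longlonglongrightarrow> bstar 3 * \<kappa> / (bstar 3 * \<kappa> + sqrt \<beta>)"
    unfolding column_limit_1 ratio[OF b3] .
  then show "(\<lambda>n. clustering_fun n (m n) P1 P2 1) \<sim>[sequentially] (\<lambda>n. bstar 3 * \<kappa> / (bstar 3 * \<kappa> + sqrt \<beta>))"
    using lim_pos by (rule tendsto_imp_asymp_equiv_const)
  show "(\<lambda>n. clustering_fun n (m n) P1 P2 r) \<longlonglongrightarrow> 1" if "2 \<le> r"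
  proof -
    have "column_limit r \<noteq> 0"
      using column_limit_pos[OF assms(1,2), of r] by simp
    then show ?thesis
      using clustering_fun_tendsto[OF prob_not_adj_common_nbrs_ge_2_tendsto[OF that]] by simp
  qed
qed

end

theorem theorem3:
  fixes P1 P2 :: "real measure" and m :: "nat \<Rightarrow> nat" and \<beta> :: real
  defines "a \<equiv> (\<lambda>k::nat. LINT x|P1. x ^ k)"
    and "b \<equiv> (\<lambda>k::nat. LINT x|P2. x ^ k)"
  defines "\<kappa> \<equiv> a 1 * inverse (a 2) * inverse ((b 2)\<^sup>2)"
    and "bstar \<equiv> (\<lambda>k::nat. LINT x|P2. x ^ k * exp (- (a 1 * x / sqrt \<beta>)))"
  assumes "real_distribution P1" "AE x in P1. 0 \<le> x"
    and "real_distribution P2" "AE x in P2. 0 \<le> x"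
    and "integrable P1 (\<lambda>x. x ^ 2)" "0 < a 2"
    and "integrable P2 (\<lambda>x. x ^ 3)" "0 < b 3"
    and "filterlim m at_top sequentially"
    and "(\<lambda>n. real (m n) / real n) \<longlonglongrightarrow> \<beta>" "0 < \<beta>"
  shows "((\<lambda>n. clustering_coeff n (m n) P1 P2) \<longlonglongrightarrow> b 3 * \<kappa> / (b 3 * \<kappa> + sqrt \<beta>))
    \<and> ((\<lambda>n. clustering_fun n (m n) P1 P2 0) \<sim>[sequentially] (\<lambda>n. (a 1)\<^sup>2 * bstar 2 / real n))
    \<and> ((\<lambda>n. clustering_fun n (m n) P1 P2 1) \<sim>[sequentially]
          (\<lambda>n. bstar 3 * \<kappa> / (bstar 3 * \<kappa> + sqrt \<beta>)))
    \<and> (\<forall>r\<ge>2. (\<lambda>n. clustering_fun n (m n) P1 P2 r) \<longlonglongrightarrow> 1)"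
proof -
  interpret S: rig_sequence P1 P2 m \<beta>
    by (rule rig_sequence.intro) fact+
  have a: "S.a = a" and b: "S.b = b"
    by (simp_all add: fun_eq_iff S.a_def S.b_def a_def b_def)
  have bstar: "S.bstar = bstar"
    by (simp add: fun_eq_iff S.bstar_def bstar_def a)
  have pos: "0 < S.a 2" "0 < S.b 3"
    using assms by (simp_all add: a b)
  show ?thesis
    using S.clustering_limits[OF pos] S.clustering_fun_0[OF pos]
    unfolding a b bstar \<kappa>_def by blast
qed

end
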